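(* Let $R\in M_d(\mathbb{Z})$ be an expansive matrix and let $B,L\subset\mathbb{Z}^d$ be finite sets such that $(R,B,L)$ forms a Hadamard triple, $\#B<|\det R|$, and the periodic zero set $\mathcal{Z}(\mu(R,B))$ is empty. Then for every $b>1$ the measure $\mu(R,B)$ admits a $b$-lacunary spectrum $\Lambda$.
   Context: A matrix $R\in M_d(\mathbb{Z})$ is expansive if all its eigenvalues have modulus strictly greater than $1$. For finite nonempty sets $B,L\subset\mathbb{Z}^d$ with $\#B=\#L=:q$, $(R,B,L)$ is a Hadamard triple if the matrix $H=\frac{1}{\sqrt q}\left[e^{-2\pi i\langle R^{-1}b,l\rangle}\right]_{b\in B,l\in L}$ is unitary. The self-affine measure $\mu(R,B)$ is the unique Borel probability measure $\mu$ on $\mathbb{R}^d$ satisfying $\mu(E)=\frac1q\sum_{b\in B}\mu(\tau_b^{-1}(E))$ for all Borel sets $E$, where $\tau_b(x)=R^{-1}(x+b)$ and $q=\#B$. The Fourier transform is $\widehat\mu(\xi)=\int e^{-2\pi i\xi\cdot x}\,d\mu(x)$, and the periodic zero set is $\mathcal{Z}(\mu)=\{\xi\in\mathbb{R}^d:\widehat\mu(\xi+k)=0\ \text{for all }k\in\mathbb{Z}^d\}$. A countable set $\Lambda\subset\mathbb{R}^d$ is a spectrum of a Borel probability measure $\mu$ if the family $\{e^{2\pi i\lambda\cdot x}\}_{\lambda\in\Lambda}$ is an orthonormal basis of $L^2(\mu)$. A countable (finite or infinite) set $\Lambda\subset\mathbb{R}^d$ is $b$-lacunary if it can be enumerated as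 $\lambda_0,\lambda_1,\lambda_2,\dots$ with $\lambda_0=0$, $|\lambda_1|\ge b$, and $|\lambda_{n+1}|\ge b|\lambda_n|$ for all $n\ge1$ (the conditions being imposed only for those indices that occur, in case $\Lambda$ is finite). *)

theory Defs
  imports "HOL-Probability.Probability"
begin

section \<open>Integer vectors and matrices\<close>

definition real_vec :: "int ^ 'n \<Rightarrow> real ^ 'n" where
  "real_vec k = (\<chi> i. of_int (k $ i))"

definition eigenvalue :: "complex ^ 'n ^ 'n \<Rightarrow> complex \<Rightarrow> bool" where
  "eigenvalue A c \<longleftrightarrow> (\<exists>v. v \<noteq> 0 \<and> A *v v = c *s v)"

definition expansive :: "int ^ 'n ^ 'n \<Rightarrow> bool" where
  "expansive R \<longleftrightarrow> (\<forall>c. eigenvalue (map_matrix of_int R) c \<longrightarrow> norm c > 1)"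

text \<open>The action of the inverse matrix; it is meaningful when \<open>R\<close> is nonsingular over the
  reals, in particular when \<open>R\<close> is expansive.\<close>

definition inv_apply :: "int ^ 'n ^ 'n \<Rightarrow> real ^ 'n \<Rightarrow> real ^ 'n" where
  "inv_apply R x = matrix_inv (map_matrix real_of_int R) *v x"


section \<open>Hadamard triples\<close>

text \<open>A matrix with rows indexed by \<open>I\<close> and columns by \<open>J\<close>; unitarity is
  \<open>H H\<^sup>* = 1\<close> and \<open>H\<^sup>* H = 1\<close>.\<close>

definition unitary_on :: "'a set \<Rightarrow> 'b set \<Rightarrow> ('a \<Rightarrow> 'b \<Rightarrow> complex) \<Rightarrow> bool" where
  "unitary_on I J H \<longleftrightarrow>
     (\<forall>i\<in>I. \<forall>i'\<in>I. (\<Sum>j\<in>J. H i j * cnj (H i' j)) = (if i = i' then 1 else 0)) \<and>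
     (\<forall>j\<in>J. \<forall>j'\<in>J. (\<Sum>i\<in>I. cnj (H i j) * H i j') = (if j = j' then 1 else 0))"

definition hadamard_triple :: "int ^ 'n ^ 'n \<Rightarrow> (int ^ 'n) set \<Rightarrow> (int ^ 'n) set \<Rightarrow> bool" where
  "hadamard_triple R B L \<longleftrightarrow>
     finite B \<and> B \<noteq> {} \<and> finite L \<and> L \<noteq> {} \<and> card B = card L \<and>
     unitary_on B L (\<lambda>b l. 1 / of_real (sqrt (real (card B))) *
       exp (- 2 * of_real pi * \<i> * of_real (inv_apply R (real_vec b) \<bullet> real_vec l)))"


section \<open>Self-affine measures\<close>

definition affine_map :: "int ^ 'n ^ 'n \<Rightarrow> int ^ 'n \<Rightarrow> real ^ 'n \<Rightarrow> real ^ 'n" where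
  "affine_map R b x = inv_apply R (x + real_vec b)"

definition borel_prob :: "'a :: topological_space measure \<Rightarrow> bool" where
  "borel_prob \<mu> \<longleftrightarrow> prob_space \<mu> \<and> sets \<mu> = sets borel"

text \<open>Existence and uniqueness hold when \<open>R\<close> is expansive and \<open>B\<close> is finite and nonempty
  (Hutchinson); otherwise the description may fail to denote.\<close>

definition self_affine_measure :: "int ^ 'n ^ 'n \<Rightarrow> (int ^ 'n) set \<Rightarrow> (real ^ 'n) measure" where
  "self_affine_measure R B = (THE \<mu>. borel_prob \<mu> \<and>
     (\<forall>E \<in> sets borel. measure \<mu> E =
        1 / real (card B) * (\<Sum>b\<in>B. measure \<mu> (affine_map R b -` E))))"

definition fourier_transform :: "(real ^ 'n) measure \<Rightarrow> real ^ 'n \<Rightarrow> complex" where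
  "fourier_transform \<mu> \<xi> = (\<integral>x. exp (- 2 * of_real pi * \<i> * of_real (\<xi> \<bullet> x)) \<partial>\<mu>)"

definition periodic_zero_set :: "(real ^ 'n) measure \<Rightarrow> (real ^ 'n) set" where
  "periodic_zero_set \<mu> = {\<xi>. \<forall>k :: int ^ 'n. fourier_transform \<mu> (\<xi> + real_vec k) = 0}"


section \<open>Spectra\<close>

text \<open>Elements of \<open>L\<^sup>2(\<mu>)\<close> are represented by functions; equality almost everywhere is
  invisible to the inner product and to the norm.\<close>

definition L2 :: "'a measure \<Rightarrow> ('a \<Rightarrow> complex) set" where
  "L2 \<mu> = {f \<in> borel_measurable \<mu>. integrable \<mu> (\<lambda>x. (norm (f x))\<^sup>2)}"

definition L2_inner :: "'a measure \<Rightarrow> ('a \<Rightarrow> complex) \<Rightarrow> ('a \<Rightarrow> complex) \<Rightarrow> complex" where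
  "L2_inner \<mu> f g = (\<integral>x. f x * cnj (g x) \<partial>\<mu>)"

definition L2_norm :: "'a measure \<Rightarrow> ('a \<Rightarrow> complex) \<Rightarrow> real" where
  "L2_norm \<mu> f = sqrt (\<integral>x. (norm (f x))\<^sup>2 \<partial>\<mu>)"

text \<open>An orthonormal basis in the Hilbert space sense: an orthonormal family whose finite
  linear combinations are dense.\<close>

definition L2_orthonormal_basis :: "'a measure \<Rightarrow> 'i set \<Rightarrow> ('i \<Rightarrow> 'a \<Rightarrow> complex) \<Rightarrow> bool" where
  "L2_orthonormal_basis \<mu> I e \<longleftrightarrow>
     (\<forall>i\<in>I. e i \<in> L2 \<mu>) \<and>
     (\<forall>i\<in>I. \<forall>j\<in>I. L2_inner \<mu> (e i) (e j) = (if i = j then 1 else 0)) \<and>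
     (\<forall>f \<in> L2 \<mu>. \<forall>\<epsilon>>0. \<exists>F c. finite F \<and> F \<subseteq> I \<and>
        L2_norm \<mu> (\<lambda>x. f x - (\<Sum>i\<in>F. c i * e i x)) < \<epsilon>)"

definition is_spectrum :: "(real ^ 'n) measure \<Rightarrow> (real ^ 'n) set \<Rightarrow> bool" where
  "is_spectrum \<mu> \<Lambda> \<longleftrightarrow> countable \<Lambda> \<and>
     L2_orthonormal_basis \<mu> \<Lambda> (\<lambda>\<xi> x. exp (2 * of_real pi * \<i> * of_real (\<xi> \<bullet> x)))"

text \<open>The set is enumerated without repetition by the indices below \<open>N\<close>, where
  \<open>N = \<infinity>\<close> is the infinite case; \<open>0 < N\<close> says that the initial term \<open>0\<close> occurs.\<close>

definition lacunary :: "real \<Rightarrow> (real ^ 'n) set \<Rightarrow> bool" where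
  "lacunary b \<Lambda> \<longleftrightarrow> (\<exists>(N :: enat) s.
     bij_betw s {n. enat n < N} \<Lambda> \<and>
     0 < N \<and> s 0 = 0 \<and>
     (enat 1 < N \<longrightarrow> norm (s 1) \<ge> b) \<and>
     (\<forall>n\<ge>1. enat (n + 1) < N \<longrightarrow> norm (s (n + 1)) \<ge> b * norm (s n)))"

end

theory Submission
  imports Defs "HOL-Complex_Analysis.Complex_Analysis"
begin

no_notation fps_nth (infixl \<open>$\<close> 75)

text \<open>
  Write \<open>T\<close> for the transpose of \<open>R\<close>, \<open>S\<close> for its inverse, \<open>q\<close> for the cardinality of \<open>B\<close>, \<open>ft\<close> for the
  Fourier transform of the measure and \<open>mask\<close> for that of the uniform measure on \<open>B\<close>; then
  \<open>ft \<xi> = mask (S \<xi>) * ft (S \<xi>)\<close>. The spectrum is built one element at a time along the base \<open>q\<close>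
  expansion of the index: an index \<open>a * q ^ n + N\<close> with \<open>0 < a < q\<close> and \<open>N < q ^ n\<close> gets the frequency
  \<open>s N + T ^ n (l a) + T ^ (n + 1) k\<close>, where \<open>l a\<close> runs through \<open>L\<close> (translated to contain \<open>0\<close>) and the
  integer vector \<open>k\<close> is free. Unitarity makes the first \<open>q ^ n\<close> frequencies a spectrum of the level \<open>n\<close>
  approximation of the measure whatever the \<open>k\<close> are, and completeness survives in the limit as soon as
  \<open>|ft (S ^ n (s N))|\<close> is bounded below for \<open>N < q ^ n\<close>.

  Lacunarity therefore needs arbitrarily large \<open>k\<close> for which \<open>|ft (\<xi> + k)|\<close> is bounded below uniformly
  in \<open>\<xi>\<close>. Emptiness of the periodic zero set and compactness give one \<open>k\<close>; it may be replaced by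
  \<open>k + T ^ n k'\<close> for large \<open>n\<close> whenever \<open>k'\<close> is an integer vector with \<open>ft k' \<noteq> 0\<close>. Some such \<open>k'\<close> is
  nonzero: otherwise \<open>mask (S l) = 0\<close> for every integer vector \<open>l\<close> outside the image of \<open>T\<close>, so \<open>B\<close>
  represents all residues modulo \<open>R\<close> and \<open>|det R| \<le> q\<close>.
\<close>

section \<open>Residues of the integer lattice modulo a matrix\<close>

lemma det_map_matrix_of_int:
  "det (map_matrix of_int A :: real^'n^'n) = of_int (det (A :: int^'n^'n))"
  by (simp add: det_def map_matrix_def)

lemma real_vec_simps [simp]:
  "real_vec (x + y) = real_vec x + real_vec y" "real_vec (x - y) = real_vec x - real_vec y"
  "real_vec 0 = 0" "real_vec (- x) = - real_vec x" "real_vec x $ i = of_int (x $ i)"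
  by (simp_all add: real_vec_def vec_eq_iff)

lemma real_vec_eq_iff [simp]: "real_vec x = real_vec y \<longleftrightarrow> x = y"
  by (simp add: vec_eq_iff)

lemma real_vec_mult: "real_vec (R *v k) = map_matrix real_of_int R *v real_vec k"
  by (simp add: vec_eq_iff matrix_vector_mult_def map_matrix_def)

lemma finite_vec_box: "finite {k :: 'a ^ 'n. \<forall>i. k $ i \<in> S}" if "finite S"
proof -
  have "{k :: 'a ^ 'n. \<forall>i. k $ i \<in> S} \<subseteq> vec_lambda ` (PiE UNIV (\<lambda>_. S))"
  proof
    fix k :: "'a ^ 'n" assume "k \<in> {k. \<forall>i. k $ i \<in> S}"
    then have "k = vec_lambda (\<lambda>i. k $ i)" "(\<lambda>i. k $ i) \<in> PiE UNIV (\<lambda>_. S)" by auto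
    then show "k \<in> vec_lambda ` (PiE UNIV (\<lambda>_. S))" by (rule image_eqI)
  qed
  moreover have "finite (PiE (UNIV :: 'n set) (\<lambda>_. S))"
    by (intro finite_PiE) (auto simp: that)
  ultimately show ?thesis using finite_subset finite_imageI by blast
qed

lemma finite_bounded_int_vectors:
  "finite {k :: int ^ 'n. norm (real_vec k) \<le> m}"
proof (rule finite_subset[OF _ finite_vec_box[of "{- \<lceil>m\<rceil>..\<lceil>m\<rceil>}"]], safe)
  fix k :: "int ^ 'n" and i assume "norm (real_vec k) \<le> m"
  then have "\<bar>real_of_int (k $ i)\<bar> \<le> m"
    using component_le_norm_cart[of "real_vec k" i] by simp
  then show "k $ i \<in> {- \<lceil>m\<rceil>..\<lceil>m\<rceil>}" by (simp add: abs_le_iff) linarith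
qed

section \<open>Volume of the unit cube and its integer translates\<close>

lemma measure_unit_box:
  "measure lebesgue (box 0 (1 :: real ^ 'n)) = 1" "measure lebesgue (cbox 0 (1 :: real ^ 'n)) = 1"
proof -
  have "measure lborel (cbox 0 (1 :: real ^ 'n)) = 1"
    by (subst content_cbox_cart) (auto simp: interval_ne_empty_cart)
  then show *: "measure lebesgue (cbox 0 (1 :: real ^ 'n)) = 1"
    by (simp add: measure_completion)
  have "0 \<in> cbox 0 (1 :: real ^ 'n)" by (simp add: mem_box_cart)
  have le: "\<And>b. b \<in> Basis \<Longrightarrow> 0 \<bullet> b \<le> (1 :: real ^ 'n) \<bullet> b"
    using \<open>0 \<in> cbox 0 (1 :: real ^ 'n)\<close> unfolding mem_box by simp
  have "measure lborel (box 0 (1 :: real ^ 'n)) = measure lborel (cbox 0 (1 :: real ^ 'n))"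
    by (subst measure_lborel_box_eq, subst measure_lborel_cbox_eq) (rule refl)
  then show "measure lebesgue (box 0 (1 :: real ^ 'n)) = 1"
    using * by (simp add: measure_completion)
qed

lemma exists_floor_vector: "\<exists>z :: int ^ 'n. y - real_vec z \<in> cbox 0 (1 :: real ^ 'n)"
proof
  have "0 \<le> y $ i - \<lfloor>y $ i\<rfloor> \<and> y $ i - \<lfloor>y $ i\<rfloor> \<le> 1" for i
    using floor_correct[of "y $ i"] by linarith
  then show "y - real_vec (\<chi> i. \<lfloor>y $ i\<rfloor>) \<in> cbox 0 (1 :: real ^ 'n)"
    by (simp add: mem_box_cart)
qed

lemma unit_box_translates_disjoint:
  assumes "x \<in> box 0 (1 :: real ^ 'n)" "x + real_vec k \<in> box 0 1"
  shows "k = 0"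
proof -
  have "\<bar>k $ i\<bar> < 1" for i
    using assms[unfolded mem_box_cart, THEN spec[of _ i]] by simp
  then show ?thesis by (simp add: vec_eq_iff)
qed

text \<open>Comparison of volumes. The sets \<open>P b\<close> have total measure at most
  \<open>card B / |det R|\<close>, and by the covering hypothesis the integer translates of their
  union \<open>D\<close> fill the space. So the unit cube is covered by pieces which integer
  translations move to disjoint subsets of \<open>D\<close>.\<close>

lemma abs_det_le_card_residues_wellorder:
  fixes R :: "int ^ ('n :: {finite, wellorder}) ^ ('n :: {finite, wellorder})"
  assumes B: "finite B" and det: "det R \<noteq> 0"
    and cover: "\<And>z. \<exists>b\<in>B. \<exists>k. z = b + R *v k"
  shows "\<bar>det R\<bar> \<le> int (card B)"
proof -
  define M where "M = map_matrix real_of_int R"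
  have detM: "det M = of_int (det R)" by (simp add: M_def det_map_matrix_of_int)
  with det have "invertible M" by (simp add: invertible_det_nz)
  then obtain A where A: "A ** M = mat 1" "M ** A = mat 1" by (auto simp: invertible_def)
  then have AM: "A *v (M *v x) = x" and MA: "M *v (A *v x) = x" for x
    by (simp_all add: matrix_vector_mul_assoc)
  have "det A * det M = 1" using A(1) by (metis det_I det_mul)
  then have detA: "\<bar>det A\<bar> * \<bar>real_of_int (det R)\<bar> = 1" by (simp add: detM flip: abs_mult)
  define P where "P b = (*v) A ` ((+) (real_vec b) ` cbox 0 1)" for b
  have P: "P b \<in> lmeasurable" "measure lebesgue (P b) = \<bar>det A\<bar>" for b
  proof -
    have "(+) (real_vec b) ` cbox 0 1 \<in> lmeasurable"
      by (intro measurable_translation) simp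
    then show "P b \<in> lmeasurable" "measure lebesgue (P b) = \<bar>det A\<bar>"
      unfolding P_def by (simp_all add: measurable_linear_image measure_linear_image measure_translation measure_unit_box)
  qed
  define D where "D = (\<Union>b\<in>B. P b)"
  have D: "D \<in> lmeasurable" unfolding D_def using B P by (intro fmeasurable.finite_UN) auto
  have "compact D" unfolding D_def P_def
    by (intro compact_UN B compact_continuous_image compact_translation linear_continuous_on) (auto simp: matrix_vector_mul_bounded_linear)
  then obtain m where m: "\<And>x. x \<in> D \<Longrightarrow> norm x \<le> m"
    by (meson bounded_iff compact_imp_bounded)
  obtain m' where m': "\<And>x. x \<in> box 0 (1 :: real ^ ('n :: _)) \<Longrightarrow> norm x \<le> m'"
    using bounded_box bounded_iff by metis
  \<comment> \<open>The cube and \<open>D\<close> are bounded, so only finitely many integer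
    translates of \<open>D\<close> meet the cube.\<close>
  define Ks where "Ks = {k :: int ^ ('n :: _). norm (real_vec k) \<le> m + m'}"
  have Ks: "finite Ks" unfolding Ks_def by (rule finite_bounded_int_vectors)
  have cov: "box 0 1 \<subseteq> (\<Union>k\<in>Ks. box 0 1 \<inter> (+) (real_vec k) ` D)"
  proof
    fix x :: "real ^ ('n :: _)" assume x: "x \<in> box 0 1"
    obtain z where z: "M *v x - real_vec z \<in> cbox 0 1" using exists_floor_vector by blast
    obtain b k where b: "b \<in> B" "z = b + R *v k" using cover by blast
    define u where "u = M *v x - real_vec z"
    have "M *v x = M *v real_vec k + (real_vec b + u)"
      using b by (simp add: u_def real_vec_mult M_def)
    then have "x = real_vec k + A *v (real_vec b + u)"
      by (metis AM matrix_vector_right_distrib)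
    moreover have "A *v (real_vec b + u) \<in> D"
      using b(1) z unfolding D_def P_def u_def[symmetric] by blast
    ultimately have "x \<in> (+) (real_vec k) ` D" "norm (real_vec k) \<le> m + m'"
      using m' [OF x] m[of "A *v (real_vec b + u)"] norm_triangle_ineq4[of x "A *v (real_vec b + u)"] by auto
    then show "x \<in> (\<Union>k\<in>Ks. box 0 1 \<inter> (+) (real_vec k) ` D)"
      using x by (auto simp: Ks_def)
  qed
  have box: "box 0 (1 :: real ^ ('n :: _)) \<in> lmeasurable" by simp
  have tD: "(+) (real_vec k) ` D \<in> lmeasurable" for k by (intro measurable_translation D)
  have tb: "(+) (- real_vec k) ` box 0 1 \<in> lmeasurable" for k :: "int ^ ('n :: _)" by (intro measurable_translation box)
  have "1 = measure lebesgue (box 0 (1 :: real ^ ('n :: _)))" by (simp add: measure_unit_box)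
  also have "\<dots> \<le> measure lebesgue (\<Union>k\<in>Ks. box 0 1 \<inter> (+) (real_vec k) ` D)"
    by (rule measure_mono_fmeasurable[OF cov]) (use Ks box tD in \<open>auto intro!: fmeasurable.finite_UN\<close>)
  also have "\<dots> \<le> (\<Sum>k\<in>Ks. measure lebesgue (box 0 1 \<inter> (+) (real_vec k) ` D))"
    using Ks box tD by (intro measure_UNION_le) (auto intro: fmeasurableD)
  \<comment> \<open>The pieces of the cube may overlap, but once moved into \<open>D\<close> they
    are disjoint: two points of the open unit cube that differ by an integer vector
    coincide.\<close>
  also have "\<dots> = (\<Sum>k\<in>Ks. measure lebesgue ((+) (- real_vec k) ` box 0 1 \<inter> D))"
  proof (rule sum.cong[OF refl])
    fix k
    have "(+) (real_vec k) ` ((+) (- real_vec k) ` box 0 1 \<inter> D) = box 0 1 \<inter> (+) (real_vec k) ` D"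
      by (auto simp: image_iff algebra_simps)
    then show "measure lebesgue (box 0 1 \<inter> (+) (real_vec k) ` D) = measure lebesgue ((+) (- real_vec k) ` box 0 1 \<inter> D)"
      by (metis measure_translation)
  qed
  also have "\<dots> = measure lebesgue (\<Union>k\<in>Ks. (+) (- real_vec k) ` box 0 1 \<inter> D)"
  proof (rule measure_UNION'[symmetric])
    show "finite Ks" by (rule Ks)
    show "(+) (- real_vec k) ` box 0 1 \<inter> D \<in> lmeasurable" for k :: "int ^ ('n :: _)"
      using tb D by blast
    show "pairwise (\<lambda>k k'. disjnt ((+) (- real_vec k) ` box 0 1 \<inter> D) ((+) (- real_vec k') ` box 0 1 \<inter> D)) Ks"
      unfolding pairwise_def disjnt_iff
    proof safe
      fix k k' x y assume xy: "x \<in> box 0 1" "y \<in> box 0 1" "- real_vec k + x = - real_vec k' + y" and "k \<noteq> k'"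
      then have "y = x + real_vec (k' - k)" by (simp add: algebra_simps)
      with xy unit_box_translates_disjoint[of x "k' - k"] \<open>k \<noteq> k'\<close> show False by simp
    qed
  qed
  also have "\<dots> \<le> measure lebesgue D"
    by (rule measure_mono_fmeasurable) (use Ks tb D in \<open>auto intro!: sets.finite_UN fmeasurableD\<close>)
  also have "\<dots> \<le> (\<Sum>b\<in>B. measure lebesgue (P b))"
    unfolding D_def using B P by (intro measure_UNION_le) auto
  also have "\<dots> = card B * \<bar>det A\<bar>" by (simp add: P)
  finally have "\<bar>real_of_int (det R)\<bar> * 1 \<le> \<bar>real_of_int (det R)\<bar> * (card B * \<bar>det A\<bar>)"
    by (intro mult_left_mono) auto
  also have "\<dots> = card B * (\<bar>det A\<bar> * \<bar>real_of_int (det R)\<bar>)" by (simp add: mult_ac)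
  finally have "\<bar>real_of_int (det R)\<bar> \<le> card B" by (simp add: detA)
  then show ?thesis by linarith
qed

text \<open>The library proves the volume formula for linear images only for well-ordered index types; the
  type \<open>idx\<close> is a well-ordered copy of an arbitrary finite index type.\<close>

typedef (overloaded) ('n :: finite) idx = "{..<CARD('n)}"
  by (rule exI[of _ 0]) simp

instantiation idx :: (finite) wellorder
begin

definition less_eq_idx :: "'a idx \<Rightarrow> 'a idx \<Rightarrow> bool" where "less_eq_idx x y \<longleftrightarrow> Rep_idx x \<le> Rep_idx y"
definition less_idx :: "'a idx \<Rightarrow> 'a idx \<Rightarrow> bool" where "less_idx x y \<longleftrightarrow> Rep_idx x < Rep_idx y"

instance
proof
  fix P and a :: "'a idx" assume step: "\<And>x :: 'a idx. (\<And>y. y < x \<Longrightarrow> P y) \<Longrightarrow> P x"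
  show "P a"
  proof (induction a rule: measure_induct_rule[of Rep_idx])
    case (less x)
    show ?case by (rule step) (rule less.IH, simp add: less_idx_def)
  qed
next
  fix x y z :: "'a idx"
  show "x < y \<longleftrightarrow> x \<le> y \<and> \<not> y \<le> x" "x \<le> x" "x \<le> y \<or> y \<le> x"
    unfolding less_eq_idx_def less_idx_def by linarith+
  show "x \<le> z" if "x \<le> y" "y \<le> z"
    using that unfolding less_eq_idx_def by linarith
  show "x = y" if "x \<le> y" "y \<le> x"
    using that unfolding less_eq_idx_def Rep_idx_inject[symmetric] by linarith
qed

end

instance idx :: (finite) finite
proof
  have "finite (Rep_idx ` (UNIV :: 'a idx set))"
    by (rule finite_subset[OF image_subsetI[OF Rep_idx]]) simp
  then show "finite (UNIV :: 'a idx set)"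
    by (rule finite_imageD) (auto simp: inj_on_def Rep_idx_inject)
qed

lemma exists_bij_idx: "\<exists>h :: 'n idx \<Rightarrow> 'n :: finite. bij h"
proof -
  have "bij_betw Rep_idx (UNIV :: 'n idx set) {..<CARD('n)}"
    by (rule bij_betwI[where g = Abs_idx], rule Pi_I, rule Rep_idx) (simp_all add: Rep_idx_inverse Abs_idx_inverse)
  moreover obtain g where "bij_betw g {..<CARD('n)} (UNIV :: 'n set)"
    using ex_bij_betw_nat_finite[of "UNIV :: 'n set"] by (auto simp: lessThan_atLeast0)
  ultimately show ?thesis using bij_betw_trans by blast
qed

text \<open>Conjugation by \<open>h\<close> is a sign-preserving bijection between the permutations
  of the two index types and carries one Leibniz formula to the other.\<close>

lemma det_reindex:
  fixes M :: "'a::comm_ring_1 ^ 'n ^ 'n" and h :: "'m :: finite \<Rightarrow> 'n"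
  assumes h: "bij h"
  shows "det (\<chi> i j. M $ h i $ h j) = det M"
proof -
  have hinv: "h (inv h x) = x" "inv h (h y) = y" for x y
    using h by (simp_all add: bij_is_surj surj_f_inv_f bij_is_inj)
  have inv: "bij (inv h)" using h by (rule bij_imp_bij_inv)
  have map: "map_permutation UNIV h p = h \<circ> p \<circ> inv h" for p
    using h by (auto simp: map_permutation_def fun_eq_iff restrict_id_def bij_is_surj)
  have mapi: "map_permutation UNIV (inv h) p = inv h \<circ> p \<circ> h" for p
    using inv h by (auto simp: map_permutation_def fun_eq_iff restrict_id_def bij_is_surj inv_inv_eq)
  show ?thesis
    unfolding det_def
  proof (rule sum.reindex_bij_witness[where i = "map_permutation UNIV (inv h)" and j = "map_permutation UNIV h"])
    fix p :: "'m \<Rightarrow> 'm" assume "p \<in> {p. p permutes UNIV}"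
    then have p: "p permutes UNIV" by simp
    show "map_permutation UNIV (inv h) (map_permutation UNIV h p) = p"
      unfolding map mapi by (simp add: fun_eq_iff hinv)
    show "map_permutation UNIV h p \<in> {p. p permutes UNIV}"
      using map_permutation_permutes[OF h p] by simp
    have "(\<Prod>i\<in>UNIV. M $ i $ map_permutation UNIV h p i) = (\<Prod>i\<in>UNIV. M $ h i $ map_permutation UNIV h p (h i))"
      by (rule prod.reindex_bij_betw[OF h, symmetric])
    then show "of_int (sign (map_permutation UNIV h p)) * (\<Prod>i\<in>UNIV. M $ i $ map_permutation UNIV h p i) =
        of_int (sign p) * (\<Prod>i\<in>UNIV. (\<chi> i j. M $ h i $ h j) $ i $ p i)"
      using sign_map_permutation[of h UNIV p] p h by (simp add: map hinv bij_is_inj)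
  next
    fix p :: "'n \<Rightarrow> 'n" assume "p \<in> {p. p permutes UNIV}"
    then have p: "p permutes UNIV" by simp
    show "map_permutation UNIV h (map_permutation UNIV (inv h) p) = p"
      unfolding map mapi by (simp add: fun_eq_iff hinv)
    show "map_permutation UNIV (inv h) p \<in> {p. p permutes UNIV}"
      using map_permutation_permutes[OF inv p] by simp
  qed
qed

text \<open>Relabelling the coordinates along \<open>h\<close> keeps the determinant and the
  covering of residues, which transfers the well-ordered case to every finite index type.\<close>

lemma abs_det_le_card_residues:
  fixes R :: "int ^ 'n ^ 'n"
  assumes B: "finite B" and det: "det R \<noteq> 0"
    and cover: "\<And>z. \<exists>b\<in>B. \<exists>k. z = b + R *v k"
  shows "\<bar>det R\<bar> \<le> int (card B)"
proof -
  obtain h :: "'n idx \<Rightarrow> 'n" where h: "bij h" using exists_bij_idx by blast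
  define V :: "int ^ 'n \<Rightarrow> int ^ 'n idx" where "V v = (\<chi> i. v $ h i)" for v
  define R' where "R' = (\<chi> i j. R $ h i $ h j)"
  have V_surj: "\<exists>v. z = V v" for z
  proof
    show "z = V (\<chi> i. z $ inv h i)"
      using h by (simp add: V_def vec_eq_iff bij_is_inj)
  qed
  have V_mult: "V (R *v k) = R' *v V k" for k
  proof -
    have "(\<Sum>j\<in>UNIV. R $ h i $ j * k $ j) = (\<Sum>j\<in>UNIV. R $ h i $ h j * k $ h j)" for i
      by (rule sum.reindex_bij_betw[OF h, symmetric])
    then show ?thesis by (simp add: V_def R'_def matrix_vector_mult_def vec_eq_iff)
  qed
  have V_add: "V (x + y) = V x + V y" for x y by (simp add: V_def vec_eq_iff)
  have det': "det R' = det R" unfolding R'_def by (rule det_reindex[OF h])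
  have "\<bar>det R'\<bar> \<le> int (card (V ` B))"
  proof (rule abs_det_le_card_residues_wellorder)
    show "finite (V ` B)" "det R' \<noteq> 0" using B det det' by simp_all
    fix z obtain v where "z = V v" using V_surj by blast
    moreover obtain b k where "b \<in> B" "v = b + R *v k" using cover by blast
    ultimately have "b \<in> B" "z = V b + R' *v V k" by (simp_all add: V_add V_mult)
    then show "\<exists>b\<in>V ` B. \<exists>k. z = b + R' *v k" by blast
  qed
  also have "\<dots> \<le> int (card B)" using card_image_le[OF B] by simp
  finally show ?thesis by (simp add: det')
qed

section \<open>Inverse powers of an expansive matrix\<close>

lemma holomorphic_on_det:
  fixes f :: "complex \<Rightarrow> complex^'n^'n"
  assumes "\<And>i j. (\<lambda>z. f z $ i $ j) holomorphic_on S"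
  shows "(\<lambda>z. det (f z)) holomorphic_on S"
  unfolding det_def by (intro holomorphic_intros assms)

lemma of_int_matrix_complex:
  "map_matrix of_int R = map_matrix complex_of_real (map_matrix real_of_int R)"
  by (simp add: map_matrix_def vec_eq_iff)

text \<open>A singular \<open>R - z\<close> has a nonzero kernel vector, which is an eigenvector of
  \<open>R\<close> for \<open>z\<close>; expansiveness excludes this in the closed unit
  disc.\<close>

lemma expansive_det_resolvent_nonzero:
  fixes R :: "int^'n^'n"
  assumes "expansive R" "norm z \<le> 1"
  shows "det (map_matrix complex_of_int R - mat z) \<noteq> 0"
proof
  assume "det (map_matrix complex_of_int R - mat z) = 0"
  then have "\<not> invertible (map_matrix complex_of_int R - mat z)"
    by (simp add: invertible_det_nz)
  then obtain v where v: "(map_matrix complex_of_int R - mat z) *v v = 0" "v \<noteq> 0"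
    unfolding invertible_left_inverse matrix_left_invertible_ker by blast
  have "mat z *v v = z *s v"
    by (simp add: matrix_vector_mult_def mat_def vec_eq_iff if_distrib[of "\<lambda>x. x * _"] cong: if_cong)
  with v have "map_matrix complex_of_int R *v v = z *s v"
    by (simp add: matrix_vector_mult_diff_rdistrib)
  with v have "eigenvalue (map_matrix of_int R) z"
    unfolding eigenvalue_def by blast
  with assms show False
    unfolding expansive_def by fastforce
qed

lemma det_map_matrix_of_real:
  "det (map_matrix of_real A :: complex^'n^'n) = of_real (det (A :: real^'n^'n))"
  by (simp add: det_def map_matrix_def)

lemma expansive_det_nonzero:
  fixes R :: "int^'n^'n"
  assumes "expansive R"
  shows "det (map_matrix real_of_int R) \<noteq> 0"
  using expansive_det_resolvent_nonzero[OF assms, of 0]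
  by (simp add: of_int_matrix_complex det_map_matrix_of_real mat_def flip: zero_vec_def)

lemma inv_apply_inverse:
  fixes R :: "int^'n^'n"
  assumes "expansive R"
  shows "map_matrix real_of_int R *v inv_apply R x = x"
    "inv_apply R (map_matrix real_of_int R *v x) = x"
proof -
  have "invertible (map_matrix real_of_int R)"
    using expansive_det_nonzero[OF assms] by (simp add: invertible_det_nz)
  then show "map_matrix real_of_int R *v inv_apply R x = x"
    "inv_apply R (map_matrix real_of_int R *v x) = x"
    using someI_ex[of "\<lambda>A. map_matrix real_of_int R ** A = mat 1 \<and> A ** map_matrix real_of_int R = mat 1"]
    unfolding inv_apply_def matrix_inv_def invertible_def by (simp_all add: matrix_vector_mul_assoc)
qed

text \<open>The resolvent \<open>z \<mapsto> (R - z)\<^sup>-\<^sup>1 v\<close> is holomorphic on a disc of radius greater than one by Cramer's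
  rule, and its Taylor coefficients at the origin are \<open>R\<^bsup>-(n+1)\<^esup> v\<close>.\<close>

lemma expansive_orbit_bound:
  fixes R :: "int^'n^'n"
  assumes R: "expansive R"
  shows "\<exists>\<rho>>1. \<forall>v. \<exists>C. \<forall>n. norm ((inv_apply R ^^ n) v) \<le> C * (1 / \<rho>) ^ n"
proof -
  define M where "M = map_matrix complex_of_int R"
  define P where "P z = M - mat z" for z
  define S where "S = {z. det (P z) \<noteq> 0}"
  have P_nth: "P z $ i $ j = M $ i $ j - (if i = j then z else 0)" for z i j
    by (simp add: P_def mat_def)
  have holP: "(\<lambda>z. P z $ i $ j) holomorphic_on X" for i j X
    unfolding P_nth by (cases "i = j") (auto intro!: holomorphic_intros)
  have "(\<lambda>z. det (P z)) holomorphic_on UNIV"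
    by (rule holomorphic_on_det) (rule holP)
  then have cont: "continuous_on UNIV (\<lambda>z. det (P z))"
    by (rule holomorphic_on_imp_continuous_on)
  have "open S"
    unfolding S_def by (intro open_Collect_neq cont continuous_intros)
  moreover have "cball 0 1 \<subseteq> S"
    using expansive_det_resolvent_nonzero[OF R] by (auto simp: S_def P_def M_def)
  \<comment> \<open>Compactness of the closed unit disc turns invertibility there into invertibility
    on a neighbourhood of uniform width \<open>e\<close>.\<close>
  ultimately obtain e where e: "e > 0" "(\<Union>x\<in>cball 0 1. ball x e) \<subseteq> S"
    using compact_subset_open_imp_ball_epsilon_subset[of "cball 0 1" S] by auto
  have ball: "ball 0 (1 + e) \<subseteq> S"
  proof
    fix z :: complex assume z: "z \<in> ball 0 (1 + e)"
    show "z \<in> S"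
    proof (cases "norm z \<le> 1")
      case True then show ?thesis using \<open>cball 0 1 \<subseteq> S\<close> by auto
    next
      case False
      \<comment> \<open>A point outside the unit disc is compared with its radial
        projection.\<close>
      then have "dist (sgn z) z = norm z - 1"
      proof -
        have "sgn z - z = of_real (1 - norm z) * sgn z"
          using False by (cases "z = 0") (auto simp: sgn_eq field_simps)
        moreover have "z \<noteq> 0" using False by auto
        ultimately show ?thesis using False
          by (simp add: dist_norm norm_mult norm_sgn flip: of_real_diff)
      qed
      with z have "z \<in> ball (sgn z) e" by auto
      moreover have "sgn z \<in> cball 0 1" by (simp add: norm_sgn)
      ultimately show ?thesis using e by blast
    qed
  qed
  define \<rho> where "\<rho> = 1 + e / 2"
  have "\<rho> > 1" using e by (simp add: \<rho>_def)
  moreover have "\<exists>C. \<forall>n. norm ((inv_apply R ^^ n) v) \<le> C * (1 / \<rho>) ^ n" for v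
  proof -
    define w :: "complex^'n" where "w = (\<chi> i. of_real (v $ i))"
    define x where "x z = (\<chi> k. det (\<chi> i j. if j = k then w $ i else P z $ i $ j) / det (P z))" for z
    have x: "P z *v x z = w" if "z \<in> ball 0 (1 + e)" for z
      using cramer[of "P z" "x z" w] that ball unfolding x_def S_def by blast
    have hol: "(\<lambda>z. x z $ k) holomorphic_on ball 0 (1 + e)" for k
    proof -
      have "(\<lambda>z. (\<chi> i j. if j = k then w $ i else P z $ i $ j) $ i $ j) holomorphic_on ball 0 (1 + e)" for i j
        by (cases "j = k") (simp_all add: holP)
      then have "(\<lambda>z. det (\<chi> i j. if j = k then w $ i else P z $ i $ j)) holomorphic_on ball 0 (1 + e)"
        by (rule holomorphic_on_det)
      moreover have "(\<lambda>z. det (P z)) holomorphic_on ball 0 (1 + e)"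
        by (rule holomorphic_on_det) (rule holP)
      moreover have "det (P z) \<noteq> 0" if "z \<in> ball 0 (1 + e)" for z
        using that ball by (auto simp: S_def)
      ultimately show ?thesis
        unfolding x_def vec_lambda_beta by (intro holomorphic_on_divide) auto
    qed
    define F where "F k = fps_expansion (\<lambda>z. x z $ k) 0" for k
    have F: "(\<lambda>z. x z $ k) has_fps_expansion F k" for k
      unfolding F_def using e by (intro has_fps_expansion_fps_expansion[OF _ _ hol]) auto
    \<comment> \<open>The system \<open>P z *v x z = w\<close> becomes one identity of formal power
      series per coordinate; its coefficients give the recursion for the Taylor vectors
      \<open>a n\<close>.\<close>
    have eq: "(\<Sum>j\<in>UNIV. fps_const (M $ i $ j) * F j) - fps_X * F i = fps_const (w $ i)" for i
    proof (rule fps_expansion_unique_complex)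
      show "(\<lambda>_. w $ i) has_fps_expansion fps_const (w $ i)" by simp
      have "(\<lambda>z. (\<Sum>j\<in>UNIV. M $ i $ j * x z $ j) - z * x z $ i) has_fps_expansion
        (\<Sum>j\<in>UNIV. fps_const (M $ i $ j) * F j) - fps_X * F i"
        by (intro fps_expansion_intros F)
      moreover have "eventually (\<lambda>z. (\<Sum>j\<in>UNIV. M $ i $ j * x z $ j) - z * x z $ i = w $ i) (nhds 0)"
      proof -
        have "eventually (\<lambda>z::complex. z \<in> ball 0 (1 + e)) (nhds 0)"
          using e by (intro eventually_nhds_in_open) auto
        then show ?thesis
        proof eventually_elim
          case (elim z)
          have "(\<Sum>j\<in>UNIV. (M $ i $ j - (if i = j then z else 0)) * x z $ j) = w $ i"
            using arg_cong[OF x[OF elim], of "\<lambda>u. u $ i"]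
            by (simp add: matrix_vector_mult_def P_nth)
          then show ?case
            by (simp add: left_diff_distrib sum_subtractf if_distrib[of "\<lambda>a. a * _"] cong: if_cong)
        qed
      qed
      ultimately show "(\<lambda>_. w $ i) has_fps_expansion
        (\<Sum>j\<in>UNIV. fps_const (M $ i $ j) * F j) - fps_X * F i"
        using has_fps_expansion_cong by fast
    qed
    define a where "a n = (\<chi> k. fps_nth (F k) n)" for n
    have Ma0: "M *v a 0 = w"
      using arg_cong[OF eq, of "\<lambda>f. fps_nth f 0"]
      by (simp add: matrix_vector_mult_def a_def vec_eq_iff fps_sum_nth)
    have MaS: "M *v a (Suc n) = a n" for n
      using arg_cong[OF eq, of "\<lambda>f. fps_nth f (Suc n)"]
      by (simp add: matrix_vector_mult_def a_def vec_eq_iff fps_sum_nth)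
    have "det M \<noteq> 0"
      using expansive_det_resolvent_nonzero[OF R, of 0] by (simp add: M_def mat_def flip: zero_vec_def)
    then have injM: "p = q" if "M *v p = M *v q" for p q
      using trans[OF iffD1[OF cramer that] iffD1[OF cramer refl, symmetric]] by blast
    have Mcx: "M *v (\<chi> i. of_real (u $ i)) = (\<chi> i. of_real ((map_matrix real_of_int R *v u) $ i))" for u
      by (simp add: M_def matrix_vector_mult_def map_matrix_def vec_eq_iff)
    have a: "a n = (\<chi> i. of_real ((inv_apply R ^^ Suc n) v $ i))" for n
    proof (induction n)
      case 0
      show ?case
        by (rule injM) (simp add: Mcx Ma0 w_def inv_apply_inverse[OF R])
    next
      case (Suc n)
      show ?case
        by (rule injM) (simp only: Mcx MaS Suc.IH, simp add: inv_apply_inverse[OF R])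
    qed
    \<comment> \<open>The radius \<open>\<rho>\<close> lies strictly inside the disc of convergence,
      so the terms of the series at \<open>\<rho>\<close> tend to 0 and are bounded.\<close>
    have "\<exists>K. \<forall>n. norm (fps_nth (F k) n * of_real \<rho> ^ n) \<le> K" for k
    proof -
      have "ereal (1 + e) \<le> fps_conv_radius (F k)"
        unfolding F_def by (intro conv_radius_fps_expansion) (simp only: eball_ereal hol)
      moreover have "ereal (norm (of_real \<rho> :: complex)) < ereal (1 + e)"
        unfolding norm_of_real using e by (simp add: \<rho>_def)
      ultimately have "ereal (norm (of_real \<rho> :: complex)) < fps_conv_radius (F k)"
        by (rule less_le_trans[rotated])
      then have "summable (\<lambda>n. fps_nth (F k) n * of_real \<rho> ^ n)"
        by (rule summable_fps)
      then have "Bseq (\<lambda>n. fps_nth (F k) n * of_real \<rho> ^ n)"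
        by (rule convergent_imp_Bseq[OF convergentI[OF summable_LIMSEQ_zero]])
      then show ?thesis by (auto simp: Bseq_def)
    qed
    then obtain K where K: "\<And>k n. norm (fps_nth (F k) n * of_real \<rho> ^ n) \<le> K k"
      by metis
    have step: "norm ((inv_apply R ^^ Suc n) v) \<le> (\<rho> * sum K UNIV) * (1 / \<rho>) ^ Suc n" for n
    proof -
      have "norm ((inv_apply R ^^ Suc n) v) \<le> (\<Sum>i\<in>UNIV. \<bar>(inv_apply R ^^ Suc n) v $ i\<bar>)"
        using norm_le_l1_cart by blast
      also have "\<dots> = (\<Sum>i\<in>UNIV. norm (fps_nth (F i) n))"
        using a[of n] by (intro sum.cong) (auto simp: a_def vec_eq_iff)
      also have "\<dots> \<le> (\<Sum>i\<in>UNIV. K i * (1 / \<rho>) ^ n)"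
        using K[of _ n] \<open>\<rho> > 1\<close>
        by (intro sum_mono) (auto simp: norm_mult norm_power power_one_over field_simps)
      also have "\<dots> = (\<rho> * sum K UNIV) * (1 / \<rho>) ^ Suc n"
        using \<open>\<rho> > 1\<close> by (simp add: sum_distrib_right)
      finally show ?thesis .
    qed
    \<comment> \<open>Coefficient \<open>n\<close> belongs to the power \<open>Suc n\<close>, so the
      power zero is covered separately by \<open>norm v\<close>.\<close>
    have "norm ((inv_apply R ^^ n) v) \<le> max (norm v) (\<rho> * sum K UNIV) * (1 / \<rho>) ^ n" for n
    proof (cases n)
      case (Suc m)
      show ?thesis
        using \<open>\<rho> > 1\<close> unfolding Suc
        by (intro order_trans[OF step[of m]] mult_right_mono) auto
    qed simp
    then show ?thesis by blast
  qed
  ultimately show ?thesis by blast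
qed

lemma linear_inv_apply: "linear (inv_apply R)"
  unfolding inv_apply_def by (rule matrix_vector_mul_linear)

lemma linear_funpow:
  fixes f :: "'a::real_vector \<Rightarrow> 'a"
  shows "linear f \<Longrightarrow> linear (f ^^ n)"
proof (induction n)
  case 0
  show ?case by (rule linearI) simp_all
next
  case (Suc n)
  then show ?case using linear_compose[of "f ^^ n" f] by (simp add: o_def)
qed

text \<open>The constants of the orbit bound depend on the vector; by linearity their sum over the
  basis serves all vectors at once, with \<open>r = 1 / \<rho>\<close>.\<close>

lemma expansive_power_bound:
  fixes R :: "int^'n^'n"
  assumes R: "expansive R"
  shows "\<exists>C r. 0 < r \<and> r < 1 \<and> (\<forall>n v. norm ((inv_apply R ^^ n) v) \<le> C * r ^ n * norm v)"
proof -
  obtain \<rho> where \<rho>: "\<rho> > 1" "\<And>v. \<exists>C. \<forall>n. norm ((inv_apply R ^^ n) v) \<le> C * (1 / \<rho>) ^ n"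
    using expansive_orbit_bound[OF R] by blast
  then obtain C where C: "\<And>v n. norm ((inv_apply R ^^ n) v) \<le> C v * (1 / \<rho>) ^ n"
    by metis
  have "norm ((inv_apply R ^^ n) v) \<le> (\<Sum>b\<in>Basis. C b) * (1 / \<rho>) ^ n * norm v" for n v
  proof -
    have lin: "linear (inv_apply R ^^ n)"
      by (intro linear_funpow linear_inv_apply)
    have "norm ((inv_apply R ^^ n) v) = norm (\<Sum>b\<in>Basis. (v \<bullet> b) *\<^sub>R (inv_apply R ^^ n) b)"
      using arg_cong[OF euclidean_representation[of v], of "inv_apply R ^^ n"]
      by (simp only: linear_sum[OF lin] linear_scale[OF lin])
    also have "\<dots> \<le> (\<Sum>b\<in>Basis. norm v * (C b * (1 / \<rho>) ^ n))"
      by (intro sum_norm_le) (auto intro!: mult_mono C Basis_le_norm)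
    finally show ?thesis by (simp add: sum_distrib_left sum_distrib_right mult_ac)
  qed
  with \<rho> show ?thesis by (intro exI[of _ "\<Sum>b\<in>Basis. C b"] exI[of _ "1 / \<rho>"]) auto
qed

section \<open>Existence and uniqueness of the self-affine measure\<close>

definition expo :: "'a::real_inner \<Rightarrow> 'a \<Rightarrow> complex" where
  "expo \<xi> x = exp (2 * of_real pi * \<i> * of_real (\<xi> \<bullet> x))"

text \<open>The invariance equation for an arbitrary map and digit set;
  \<open>self_affine_measure_eq\<close> ties it to the integer setting.\<close>

definition is_self_affine :: "('a::euclidean_space \<Rightarrow> 'a) \<Rightarrow> 'a set \<Rightarrow> 'a measure \<Rightarrow> bool" where
  "is_self_affine A B \<mu> \<longleftrightarrow> borel_prob \<mu> \<and>
     (\<forall>E\<in>sets borel. measure \<mu> E = 1 / real (card B) * (\<Sum>b\<in>B. measure \<mu> ((\<lambda>x. A (x + b)) -` E)))"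

text \<open>Decay is required of the powers of \<open>A\<close> only up to a constant
  \<open>C\<close>, because the inverse of an expansive matrix can have norm larger than
  one.\<close>

locale affine_ifs =
  fixes A :: "'a::euclidean_space \<Rightarrow> 'a" and B :: "'a set" and C r :: real
  assumes linA: "linear A"
    and bound: "norm ((A ^^ n) v) \<le> C * r ^ n * norm v"
    and r: "0 < r" "r < 1"
    and B: "finite B" "B \<noteq> {}"
begin

lemma A_measurable [measurable]: "A \<in> borel_measurable borel"
  by (intro borel_measurable_continuous_onI linear_continuous_on linA[unfolded linear_conv_bounded_linear])

lemma C_nonneg: "0 \<le> C"
proof -
  obtain b :: 'a where "b \<in> Basis" using nonempty_Basis by blast
  with bound[of 0 b] norm_ge_zero[of b] show ?thesis by (simp add: norm_Basis)
qed

lemma powers_tendsto_0: "(\<lambda>n. (A ^^ n) v) \<longlonglongrightarrow> 0"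
proof (rule tendsto_norm_zero_cancel, rule tendsto_sandwich[OF _ _ tendsto_const])
  show "(\<lambda>n. C * r ^ n * norm v) \<longlonglongrightarrow> 0"
    using r by (auto intro!: tendsto_eq_intros LIMSEQ_power_zero)
qed (auto intro!: always_eventually bound)

lemma measurable_branch:
  assumes [measurable_cong]: "sets \<mu> = sets borel"
  shows "(\<lambda>(b, x). A (x + b)) \<in> measure_pmf (pmf_of_set B) \<Otimes>\<^sub>M \<mu> \<rightarrow>\<^sub>M borel"
proof -
  have "(\<lambda>b. b) \<in> measure_pmf (pmf_of_set B) \<rightarrow>\<^sub>M borel" by simp
  then have "(\<lambda>p. fst p) \<in> measure_pmf (pmf_of_set B) \<Otimes>\<^sub>M \<mu> \<rightarrow>\<^sub>M borel"
    by (rule measurable_compose[OF measurable_fst])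
  then have "(\<lambda>p. A (snd p + fst p)) \<in> measure_pmf (pmf_of_set B) \<Otimes>\<^sub>M \<mu> \<rightarrow>\<^sub>M borel"
    by measurable
  then show ?thesis by (simp add: case_prod_beta)
qed

text \<open>Invariance means that a random point keeps its law when it is moved to
  \<open>A (x + b)\<close> with an independent, uniformly chosen digit \<open>b\<close>.\<close>

lemma self_affine_distr:
  assumes \<mu>: "is_self_affine A B \<mu>"
  shows "\<mu> = distr (measure_pmf (pmf_of_set B) \<Otimes>\<^sub>M \<mu>) borel (\<lambda>(b, x). A (x + b))"
proof -
  interpret \<mu>: prob_space \<mu> using \<mu> by (auto simp: is_self_affine_def borel_prob_def)
  have sets [measurable_cong]: "sets \<mu> = sets borel" using \<mu> by (auto simp: is_self_affine_def borel_prob_def)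
  let ?P = "measure_pmf (pmf_of_set B)"
  interpret P: pair_prob_space ?P \<mu> ..
  note measurable_branch[OF sets, measurable]
  show ?thesis
  proof (rule measure_eqI)
    fix E assume "E \<in> sets \<mu>"
    then have E [measurable]: "E \<in> sets borel" by (simp add: sets)
    have "emeasure (distr (?P \<Otimes>\<^sub>M \<mu>) borel (\<lambda>(b, x). A (x + b))) E
      = emeasure (?P \<Otimes>\<^sub>M \<mu>) ((\<lambda>(b, x). A (x + b)) -` E \<inter> space (?P \<Otimes>\<^sub>M \<mu>))"
      by (simp add: emeasure_distr)
    also have "\<dots> = (\<integral>\<^sup>+b. emeasure \<mu> (Pair b -` ((\<lambda>(b, x). A (x + b)) -` E \<inter> space (?P \<Otimes>\<^sub>M \<mu>))) \<partial>?P)"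
      by (rule \<mu>.emeasure_pair_measure_alt) measurable
    also have "\<dots> = (\<integral>\<^sup>+b. emeasure \<mu> ((\<lambda>x. A (x + b)) -` E) \<partial>?P)"
      by (intro nn_integral_cong arg_cong[of _ _ "emeasure \<mu>"])
        (auto simp: space_pair_measure sets_eq_imp_space_eq[OF sets])
    also have "\<dots> = (\<Sum>b\<in>B. emeasure \<mu> ((\<lambda>x. A (x + b)) -` E)) / ennreal (card B)"
      using B by (simp add: nn_integral_pmf_of_set ennreal_of_nat_eq_real_of_nat)
    also have "\<dots> = ennreal (measure \<mu> E)"
      using \<mu> B E by (simp add: is_self_affine_def \<mu>.emeasure_eq_measure divide_ennreal sum_nonneg card_gt_0_iff)
    finally show "emeasure \<mu> E = emeasure (distr (?P \<Otimes>\<^sub>M \<mu>) borel (\<lambda>(b, x). A (x + b))) E"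
      by (simp add: \<mu>.emeasure_eq_measure)
  qed (simp add: sets)
qed

text \<open>Change of variables along the random step, then Fubini for the bounded \<open>f\<close>;
  the integral over the digits is a finite average.\<close>

lemma self_affine_integral:
  fixes f :: "'a \<Rightarrow> 'b::{banach, second_countable_topology}"
  assumes \<mu>: "is_self_affine A B \<mu>" and f [measurable]: "f \<in> borel_measurable borel"
    and bdd: "\<And>x. norm (f x) \<le> K"
  shows "(\<integral>x. f x \<partial>\<mu>) = (\<Sum>b\<in>B. (\<integral>x. f (A (x + b)) \<partial>\<mu>)) /\<^sub>R card B"
proof -
  interpret \<mu>: prob_space \<mu> using \<mu> by (auto simp: is_self_affine_def borel_prob_def)
  have sets [measurable_cong]: "sets \<mu> = sets borel" using \<mu> by (auto simp: is_self_affine_def borel_prob_def)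
  let ?P = "measure_pmf (pmf_of_set B)"
  interpret P: pair_prob_space ?P \<mu> ..
  note measurable_branch[OF sets, measurable]
  have "(\<integral>x. f x \<partial>\<mu>) = (\<integral>p. f (case p of (b, x) \<Rightarrow> A (x + b)) \<partial>(?P \<Otimes>\<^sub>M \<mu>))"
    by (subst self_affine_distr[OF \<mu>]) (simp add: integral_distr)
  also have "\<dots> = (\<integral>p. (case p of (b, x) \<Rightarrow> f (A (x + b))) \<partial>(?P \<Otimes>\<^sub>M \<mu>))"
    by (simp add: case_prod_beta)
  also have "\<dots> = (\<integral>b. (\<integral>x. f (A (x + b)) \<partial>\<mu>) \<partial>?P)"
  proof (rule P.integral_fst[symmetric])
    show "integrable (?P \<Otimes>\<^sub>M \<mu>) (\<lambda>(b, x). f (A (x + b)))"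
    proof (rule P.P.integrable_const_bound[where B=K])
      have "(\<lambda>p. f (case p of (b, x) \<Rightarrow> A (x + b))) \<in> borel_measurable (?P \<Otimes>\<^sub>M \<mu>)"
        by measurable
      then show "(\<lambda>(b, x). f (A (x + b))) \<in> borel_measurable (?P \<Otimes>\<^sub>M \<mu>)"
        by (simp add: case_prod_beta)
    qed (auto intro!: AE_I2 bdd)
  qed
  also have "\<dots> = (\<Sum>b\<in>B. (\<integral>x. f (A (x + b)) \<partial>\<mu>)) /\<^sub>R card B"
    using B by (subst integral_measure_pmf[of B])
      (auto simp: sum_distrib_left divide_inverse scaleR_sum_right set_pmf_of_set)
  finally show ?thesis .
qed


text \<open>\<open>U\<close> averages over the branches. Invariance fixes the integral of
  \<open>(U ^^ n) f\<close>, while contraction brings this function pointwise ever closer to its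
  value at 0. That value does not involve \<open>\<mu>\<close>, which yields uniqueness.\<close>

lemma self_affine_integral_limit:
  fixes f :: "'a \<Rightarrow> real"
  assumes \<mu>: "is_self_affine A B \<mu>" and lip: "\<And>x y. \<bar>f x - f y\<bar> \<le> K * norm (x - y)"
    and bdd: "\<And>x. \<bar>f x\<bar> \<le> 1"
  defines "U \<equiv> \<lambda>g x. (\<Sum>b\<in>B. g (A (x + b))) / card B"
  shows "(\<lambda>n. (U ^^ n) f 0) \<longlonglongrightarrow> (\<integral>x. f x \<partial>\<mu>)"
proof -
  interpret \<mu>: prob_space \<mu> using \<mu> by (auto simp: is_self_affine_def borel_prob_def)
  have sets [measurable_cong]: "sets \<mu> = sets borel" using \<mu> by (auto simp: is_self_affine_def borel_prob_def)
  have card: "card B > 0" using B by (simp add: card_gt_0_iff)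
  have "0 \<le> K"
  proof -
    obtain b :: 'a where "b \<in> Basis" using nonempty_Basis by blast
    with lip[of b 0] show ?thesis by (simp add: norm_Basis)
  qed
  have "continuous_on UNIV f"
  proof (rule lipschitz_on_continuous_on[of K], rule lipschitz_onI)
    show "dist (f x) (f y) \<le> K * dist x y" for x y using lip by (simp add: dist_norm)
  qed fact
  then have f: "f \<in> borel_measurable borel" by (rule borel_measurable_continuous_onI)
  have U: "(U ^^ n) f \<in> borel_measurable borel" for n
    by (induction n) (auto simp: U_def f intro!: borel_measurable_sum borel_measurable_divide
      intro: measurable_compose[where N = borel, of "\<lambda>x. A (x + _)"])
  have Ubdd: "\<bar>(U ^^ n) f x\<bar> \<le> 1" for n x
  proof (induction n arbitrary: x)
    case (Suc n)
    have "\<bar>\<Sum>b\<in>B. (U ^^ n) f (A (x + b))\<bar> \<le> (\<Sum>b\<in>B. 1)"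
      by (rule order_trans[OF sum_abs]) (intro sum_mono Suc.IH)
    then show ?case using card by (simp add: U_def)
  qed (simp add: bdd)
  have Ulip: "\<bar>(U ^^ n) f x - (U ^^ n) f y\<bar> \<le> K * norm ((A ^^ n) (x - y))" for n x y
  proof (induction n arbitrary: x y)
    case (Suc n)
    have "\<bar>(\<Sum>b\<in>B. (U ^^ n) f (A (x + b))) - (\<Sum>b\<in>B. (U ^^ n) f (A (y + b)))\<bar>
      = \<bar>\<Sum>b\<in>B. (U ^^ n) f (A (x + b)) - (U ^^ n) f (A (y + b))\<bar>"
      by (simp add: sum_subtractf)
    also have "\<dots> \<le> (\<Sum>b\<in>B. K * norm ((A ^^ n) (A (x - y))))"
    proof (rule order_trans[OF sum_abs], rule sum_mono)
      fix b
      show "\<bar>(U ^^ n) f (A (x + b)) - (U ^^ n) f (A (y + b))\<bar> \<le> K * norm ((A ^^ n) (A (x - y)))"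
        using Suc.IH[of "A (x + b)" "A (y + b)"] by (simp add: linear_diff[OF linA, symmetric])
    qed
    finally show ?case using card
      by (simp add: U_def diff_divide_distrib[symmetric] divide_le_eq mult_ac funpow_swap1)
  qed (simp add: lip)
  have inv: "(\<integral>x. (U ^^ n) f x \<partial>\<mu>) = (\<integral>x. f x \<partial>\<mu>)" for n
  proof (induction n)
    case (Suc n)
    have "integrable \<mu> (\<lambda>x. (U ^^ n) f (A (x + b)))" for b
    proof (rule \<mu>.integrable_const_bound[where B=1])
      show "(\<lambda>x. (U ^^ n) f (A (x + b))) \<in> borel_measurable \<mu>"
        by (rule measurable_compose[OF _ U]) measurable
    qed (simp add: Ubdd)
    moreover have "(\<integral>x. (U ^^ n) f x \<partial>\<mu>) = (\<Sum>b\<in>B. (\<integral>x. (U ^^ n) f (A (x + b)) \<partial>\<mu>)) /\<^sub>R card B"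
      by (rule self_affine_integral[OF \<mu> U, where K = 1]) (simp add: Ubdd)
    ultimately show ?case using Suc.IH by (simp add: U_def divide_inverse mult_ac)
  qed simp
  have "(\<lambda>n. \<integral>x. (U ^^ n) f 0 - (U ^^ n) f x \<partial>\<mu>) \<longlonglongrightarrow> (\<integral>x. 0 \<partial>\<mu>)"
  proof (rule integral_dominated_convergence[where w = "\<lambda>_. 2"])
    show "AE x in \<mu>. (\<lambda>n. (U ^^ n) f 0 - (U ^^ n) f x) \<longlonglongrightarrow> 0"
    proof (rule AE_I2)
      fix x
      show "(\<lambda>n. (U ^^ n) f 0 - (U ^^ n) f x) \<longlonglongrightarrow> 0"
      proof (rule Lim_null_comparison)
        show "(\<lambda>n. K * norm ((A ^^ n) (0 - x))) \<longlonglongrightarrow> 0"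
          using tendsto_norm_zero[OF powers_tendsto_0, of "0 - x"] by (intro tendsto_mult_right_zero)
        show "eventually (\<lambda>n. norm ((U ^^ n) f 0 - (U ^^ n) f x) \<le> K * norm ((A ^^ n) (0 - x))) sequentially"
          using Ulip[of _ 0 x] by (auto intro!: always_eventually)
      qed
    qed
    show "AE x in \<mu>. norm ((U ^^ n) f 0 - (U ^^ n) f x) \<le> 2" for n
      using Ubdd[of n 0] Ubdd[of n] by (intro AE_I2) (smt (verit) real_norm_def)
    show "(\<lambda>x. (U ^^ n) f 0 - (U ^^ n) f x) \<in> borel_measurable \<mu>" for n
      using U[of n] by measurable
  qed auto
  moreover have "(\<integral>x. (U ^^ n) f 0 - (U ^^ n) f x \<partial>\<mu>) = (U ^^ n) f 0 - (\<integral>x. f x \<partial>\<mu>)" for n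
  proof -
    have "integrable \<mu> ((U ^^ n) f)"
      by (rule \<mu>.integrable_const_bound[where B=1]) (use U Ubdd in auto)
    then show ?thesis using inv[of n] by (simp add: \<mu>.prob_space)
  qed
  ultimately show ?thesis
    by (simp add: LIM_zero_iff)
qed

end

section \<open>Bounded Lipschitz functions determine a probability measure\<close>

lemma infdist_bump:
  fixes S :: "'a::metric_space set"
  defines "f \<equiv> \<lambda>n x. max 0 (1 - real n * infdist x S)"
  shows "\<bar>f n x - f n y\<bar> \<le> real n * dist x y" "0 \<le> f n x" "f n x \<le> 1"
    "closed S \<Longrightarrow> S \<noteq> {} \<Longrightarrow> (\<lambda>n. f n x) \<longlonglongrightarrow> indicator S x"
proof -
  have "\<bar>infdist x S - infdist y S\<bar> \<le> dist x y"
    using infdist_triangle_abs by blast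
  then have "\<bar>real n * infdist x S - real n * infdist y S\<bar> \<le> real n * dist x y"
    by (simp add: abs_mult flip: right_diff_distrib) (intro mult_left_mono, auto)
  then show "\<bar>f n x - f n y\<bar> \<le> real n * dist x y" by (simp add: f_def)
  show "0 \<le> f n x" "f n x \<le> 1" by (auto simp: f_def infdist_nonneg)
  assume S: "closed S" "S \<noteq> {}"
  show "(\<lambda>n. f n x) \<longlonglongrightarrow> indicator S x"
  proof (cases "x \<in> S")
    case True then show ?thesis by (simp add: f_def)
  next
    case False
    then have pos: "infdist x S > 0"
      using S infdist_pos_not_in_closed by blast
    have "eventually (\<lambda>n. f n x = 0) sequentially"
    proof -
      have "eventually (\<lambda>n. real n \<ge> 1 / infdist x S) sequentially"
        using filterlim_at_top filterlim_real_sequentially by blast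
      then show ?thesis
        by eventually_elim (use pos in \<open>simp add: f_def field_simps\<close>)
    qed
    then show ?thesis using False by (simp add: tendsto_eventually)
  qed
qed

text \<open>Truncated distance functions are Lipschitz and tend to the indicator of a nonempty
  closed set, so the measures agree on closed sets, an intersection-stable generator.\<close>

lemma prob_space_eqI_lipschitz:
  fixes \<mu> \<nu> :: "'a::euclidean_space measure"
  assumes "borel_prob \<mu>" "borel_prob \<nu>"
    and eq: "\<And>f :: 'a \<Rightarrow> real. \<And>K. (\<And>x y. \<bar>f x - f y\<bar> \<le> K * norm (x - y)) \<Longrightarrow> (\<And>x. \<bar>f x\<bar> \<le> 1) \<Longrightarrow>
      (\<integral>x. f x \<partial>\<mu>) = (\<integral>x. f x \<partial>\<nu>)"
  shows "\<mu> = \<nu>"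
proof -
  interpret \<mu>: prob_space \<mu> using assms by (simp add: borel_prob_def)
  interpret \<nu>: prob_space \<nu> using assms by (simp add: borel_prob_def)
  have sets [measurable_cong]: "sets \<mu> = sets borel" "sets \<nu> = sets borel"
    using assms by (simp_all add: borel_prob_def)
  have lim: "(\<lambda>n. \<integral>x. max 0 (1 - real n * infdist x S) \<partial>M) \<longlonglongrightarrow> measure M S"
    if S: "closed S" "S \<noteq> {}" and "borel_prob M" for M and S :: "'a set"
  proof -
    interpret M: prob_space M using that by (simp add: borel_prob_def)
    have [measurable_cong]: "sets M = sets borel" using that by (simp add: borel_prob_def)
    have "(\<lambda>n. \<integral>x. max 0 (1 - real n * infdist x S) \<partial>M) \<longlonglongrightarrow> (\<integral>x. indicator S x \<partial>M)"
    proof (rule integral_dominated_convergence[where w = "\<lambda>_. 1"])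
      have "(\<lambda>x. max 0 (1 - real n * infdist x S)) \<in> borel_measurable borel" for n
        by (intro borel_measurable_continuous_onI continuous_intros continuous_on_infdist)
      then show "(\<lambda>x. max 0 (1 - real n * infdist x S)) \<in> borel_measurable M" for n
        by simp
      show "AE x in M. (\<lambda>n. max 0 (1 - real n * infdist x S)) \<longlonglongrightarrow> indicator S x"
        using infdist_bump(4)[OF S] by simp
      show "AE x in M. norm (max 0 (1 - real n * infdist x S)) \<le> 1" for n
        using infdist_bump(3)[of n _ S] by (intro AE_I2) auto
      show "indicator S \<in> borel_measurable M"
        using S by (intro borel_measurable_indicator) (simp add: sets_eq_imp_space_eq \<open>sets M = sets borel\<close>)
    qed simp
    then show ?thesis
      using S by (simp add: sets_eq_imp_space_eq[OF \<open>sets M = sets borel\<close>])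
  qed
  have closed: "sets borel = sigma_sets UNIV (Collect closed :: 'a set set)"
    by (subst borel_eq_closed) (rule sets_measure_of, simp)
  show ?thesis
  proof (rule measure_eqI_generator_eq[where E = "Collect closed" and \<Omega> = UNIV and A = "\<lambda>_. UNIV"])
    fix S :: "'a set" assume "S \<in> Collect closed"
    then have S: "closed S" by simp
    show "emeasure \<mu> S = emeasure \<nu> S"
    proof (cases "S = {}")
      case False
      have "(\<integral>x. max 0 (1 - real n * infdist x S) \<partial>\<mu>) = (\<integral>x. max 0 (1 - real n * infdist x S) \<partial>\<nu>)" for n
        using infdist_bump(1-3)[where n = n and S = S] by (intro eq[where K = "real n"]) (auto simp: dist_norm)
      then have "measure \<mu> S = measure \<nu> S"
        using lim[OF S False assms(1)] lim[OF S False assms(2)] LIMSEQ_unique by simp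
      then show ?thesis by (simp add: \<mu>.emeasure_eq_measure \<nu>.emeasure_eq_measure)
    qed simp
  qed (auto simp: sets closed Int_stable_def)
qed

section \<open>Uniqueness and existence of the invariant measure\<close>

context affine_ifs begin

lemma self_affine_unique:
  assumes "is_self_affine A B \<mu>" "is_self_affine A B \<nu>"
  shows "\<mu> = \<nu>"
proof (rule prob_space_eqI_lipschitz)
  show "borel_prob \<mu>" "borel_prob \<nu>" using assms by (auto simp: is_self_affine_def)
  show "(\<integral>x. f x \<partial>\<mu>) = (\<integral>x. f x \<partial>\<nu>)"
    if "\<And>x y. \<bar>f x - f y\<bar> \<le> K * norm (x - y)" "\<And>x. \<bar>f x\<bar> \<le> 1" for f K
    using self_affine_integral_limit[OF assms(1) that] self_affine_integral_limit[OF assms(2) that]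
    by (rule LIMSEQ_unique)
qed

text \<open>The measure is the law of the random series \<open>X\<close> with independent uniform
  digits. Prepending a digit \<open>b\<close> turns \<open>X\<close> into \<open>A (X + b)\<close>,
  which gives invariance, and geometric decay of the terms confines the measure to a ball.\<close>

lemma self_affine_exists:
  obtains \<mu> K where "is_self_affine A B \<mu>" "AE x in \<mu>. norm x \<le> K"
proof -
  \<comment> \<open>Digits outside \<open>B\<close> are replaced by 0, so that the series converges
    and is bounded for every stream and not just almost surely.\<close>
  define d where "d b = (if b \<in> B then b else 0)" for b
  define D where "D = Max (norm ` B)"
  have dD: "norm (d b) \<le> D" for b
  proof -
    obtain b' where "b' \<in> B" using B by auto
    then have "0 \<le> D" unfolding D_def using B by (meson Max_ge finite_imageI imageI norm_ge_zero order_trans)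
    then show ?thesis using B by (auto simp: d_def D_def)
  qed
  let ?P = "measure_pmf (pmf_of_set B)"
  define S where "S = stream_space ?P"
  interpret P: prob_space ?P by (rule prob_space_measure_pmf)
  interpret S: prob_space S unfolding S_def by (rule prob_space.prob_space_stream_space[OF prob_space_measure_pmf])
  define t where "t \<omega> n = (A ^^ Suc n) (d (\<omega> !! n))" for \<omega> n
  define X where "X \<omega> = (\<Sum>n. t \<omega> n)" for \<omega>
  have tb: "norm (t \<omega> n) \<le> C * D * r * r ^ n" for \<omega> n
  proof -
    have "norm (t \<omega> n) \<le> C * r ^ Suc n * norm (d (\<omega> !! n))"
      unfolding t_def by (rule bound)
    also have "\<dots> \<le> C * r ^ Suc n * D"
      using C_nonneg r by (intro mult_left_mono dD) auto
    finally show ?thesis by (simp add: mult_ac)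
  qed
  have geo: "summable (\<lambda>n. C * D * r * r ^ n)"
    using r by (intro summable_mult summable_geometric) auto
  have sm: "summable (t \<omega>)" for \<omega>
    by (rule summable_comparison_test'[OF geo tb])
  define K where "K = (\<Sum>n. C * D * r * r ^ n)"
  have XK: "norm (X \<omega>) \<le> K" for \<omega>
  proof -
    have "summable (\<lambda>n. norm (t \<omega> n))"
      by (rule summable_comparison_test'[OF geo]) (use tb in auto)
    then show ?thesis unfolding X_def K_def
      by (intro order_trans[OF summable_norm] suminf_le tb geo)
  qed
  have X_step: "X (b ## \<omega>) = A (X \<omega> + d b)" for b \<omega>
  proof -
    interpret bl: bounded_linear A using linA by (simp add: linear_conv_bounded_linear)
    have "X (b ## \<omega>) = t (b ## \<omega>) 0 + (\<Sum>n. t (b ## \<omega>) (Suc n))"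
      unfolding X_def using suminf_split_head[OF sm] by (simp add: algebra_simps)
    also have "(\<Sum>n. t (b ## \<omega>) (Suc n)) = (\<Sum>n. A (t \<omega> n))"
      by (simp add: t_def)
    also have "\<dots> = A (X \<omega>)" unfolding X_def by (rule bl.suminf[OF sm, symmetric])
    finally show ?thesis by (simp add: t_def linear_add[OF linA] add.commute)
  qed
  have X_meas [measurable]: "X \<in> S \<rightarrow>\<^sub>M borel"
  proof -
    have "(\<lambda>\<omega>. t \<omega> n) \<in> S \<rightarrow>\<^sub>M borel" for n
      unfolding t_def S_def
      by (rule measurable_compose[OF measurable_snth]) simp
    then show ?thesis unfolding X_def by (rule borel_measurable_suminf)
  qed
  define \<mu> where "\<mu> = distr S borel X"
  have "prob_space \<mu>" unfolding \<mu>_def by (rule S.prob_space_distr) measurable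
  then interpret \<mu>: prob_space \<mu> .
  have "measure \<mu> E = 1 / card B * (\<Sum>b\<in>B. measure \<mu> ((\<lambda>x. A (x + b)) -` E))"
    if E [measurable]: "E \<in> sets borel" for E
  proof -
    have E': "X -` E \<inter> space S \<in> sets S" using E by measurable
    have "emeasure \<mu> E = emeasure S (X -` E \<inter> space S)"
      by (simp add: \<mu>_def emeasure_distr)
    \<comment> \<open>A random stream consists of an independent first digit and a remaining stream
      with the same law.\<close>
    also have "\<dots> = (\<integral>\<^sup>+b. emeasure S {\<omega>\<in>space S. b ## \<omega> \<in> X -` E \<inter> space S} \<partial>?P)"
      using prob_space.emeasure_stream_space[OF prob_space_measure_pmf] E' unfolding S_def by blast
    also have "\<dots> = (\<Sum>b\<in>B. emeasure S {\<omega>\<in>space S. b ## \<omega> \<in> X -` E \<inter> space S}) / ennreal (card B)"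
      using B by (simp add: nn_integral_pmf_of_set ennreal_of_nat_eq_real_of_nat)
    also have "(\<Sum>b\<in>B. emeasure S {\<omega>\<in>space S. b ## \<omega> \<in> X -` E \<inter> space S})
      = (\<Sum>b\<in>B. emeasure \<mu> ((\<lambda>x. A (x + b)) -` E))"
    proof (rule sum.cong[OF refl])
      fix b assume b: "b \<in> B"
      have "(\<lambda>x. A (x + b)) -` E \<in> sets borel"
        using measurable_sets[of "\<lambda>x. A (x + b)" borel borel E] by simp
      moreover have "{\<omega>\<in>space S. b ## \<omega> \<in> X -` E \<inter> space S} = X -` ((\<lambda>x. A (x + b)) -` E) \<inter> space S"
        using b by (auto simp: X_step d_def S_def space_stream_space)
      ultimately show "emeasure S {\<omega>\<in>space S. b ## \<omega> \<in> X -` E \<inter> space S} = emeasure \<mu> ((\<lambda>x. A (x + b)) -` E)"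
        by (simp add: \<mu>_def emeasure_distr)
    qed
    also have "\<dots> / ennreal (card B) = ennreal ((\<Sum>b\<in>B. measure \<mu> ((\<lambda>x. A (x + b)) -` E)) / card B)"
      using B by (simp add: \<mu>.emeasure_eq_measure divide_ennreal sum_nonneg card_gt_0_iff)
    finally have "ennreal (measure \<mu> E) = ennreal ((\<Sum>b\<in>B. measure \<mu> ((\<lambda>x. A (x + b)) -` E)) / card B)"
      by (simp add: \<mu>.emeasure_eq_measure)
    then show ?thesis by (simp add: ennreal_inj sum_nonneg)
  qed
  moreover have "AE x in \<mu>. norm x \<le> K"
    unfolding \<mu>_def by (subst AE_distr_iff) (auto simp: XK)
  ultimately show ?thesis
    using that[of \<mu> K] \<open>prob_space \<mu>\<close> by (auto simp: is_self_affine_def borel_prob_def \<mu>_def)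
qed

end

section \<open>Density of exponentials\<close>

definition linear_combinations :: "'i set \<Rightarrow> ('i \<Rightarrow> 'a \<Rightarrow> complex) \<Rightarrow> ('a \<Rightarrow> complex) set" where
  "linear_combinations I e = {\<lambda>x. \<Sum>i\<in>F. c i * e i x |F c. finite F \<and> F \<subseteq> I}"

lemma linear_combinationsI:
  "finite F \<Longrightarrow> F \<subseteq> I \<Longrightarrow> (\<And>x. f x = (\<Sum>i\<in>F. c i * e i x)) \<Longrightarrow> f \<in> linear_combinations I e"
  unfolding linear_combinations_def by blast

lemma linear_combinations_add:
  assumes "f \<in> linear_combinations I e" "g \<in> linear_combinations I e"
  shows "(\<lambda>x. f x + g x) \<in> linear_combinations I e"
proof -
  obtain F c where F: "f = (\<lambda>x. \<Sum>i\<in>F. c i * e i x)" "finite F" "F \<subseteq> I"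
    using assms(1) by (auto simp: linear_combinations_def)
  obtain G d where G: "g = (\<lambda>x. \<Sum>i\<in>G. d i * e i x)" "finite G" "G \<subseteq> I"
    using assms(2) by (auto simp: linear_combinations_def)
  define c' where "c' i = (if i \<in> F then c i else 0)" for i
  define d' where "d' i = (if i \<in> G then d i else 0)" for i
  have "f = (\<lambda>x. \<Sum>i\<in>F \<union> G. c' i * e i x)"
    unfolding F c'_def using F G by (auto simp: fun_eq_iff intro!: sum.mono_neutral_cong_left)
  moreover have "g = (\<lambda>x. \<Sum>i\<in>F \<union> G. d' i * e i x)"
    unfolding G d'_def using F G by (auto simp: fun_eq_iff intro!: sum.mono_neutral_cong_left)
  ultimately have "(\<lambda>x. f x + g x) = (\<lambda>x. \<Sum>i\<in>F \<union> G. (c' i + d' i) * e i x)"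
    by (simp add: distrib_right sum.distrib)
  then show ?thesis
    by (intro linear_combinationsI[of "F \<union> G"]) (use F(2,3) G(2,3) in \<open>auto simp: fun_eq_iff\<close>)
qed

lemma linear_combinations_cmult:
  assumes "f \<in> linear_combinations I e"
  shows "(\<lambda>x. a * f x) \<in> linear_combinations I e"
proof -
  obtain F c where F: "f = (\<lambda>x. \<Sum>i\<in>F. c i * e i x)" "finite F" "F \<subseteq> I"
    using assms(1) by (auto simp: linear_combinations_def)
  have "(\<lambda>x. a * f x) = (\<lambda>x. \<Sum>i\<in>F. (a * c i) * e i x)"
    by (simp add: F sum_distrib_left mult_ac)
  then show ?thesis
    by (intro linear_combinationsI[of F]) (use F(2,3) in \<open>auto simp: fun_eq_iff\<close>)
qed

lemma linear_combinations_zero: "(\<lambda>x. 0) \<in> linear_combinations I e"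
  unfolding linear_combinations_def by (auto intro!: exI[of _ "{}"])

lemma linear_combinations_base: "i \<in> I \<Longrightarrow> e i \<in> linear_combinations I e"
  unfolding linear_combinations_def by (auto intro!: exI[of _ "{i}"] exI[of _ "\<lambda>_. 1"])

lemma linear_combinations_sum:
  "(\<And>a. a \<in> A \<Longrightarrow> h a \<in> linear_combinations I e) \<Longrightarrow> (\<lambda>x. \<Sum>a\<in>A. h a x) \<in> linear_combinations I e"
  by (induction A rule: infinite_finite_induct)
    (auto simp: linear_combinations_zero intro!: linear_combinations_add)

section \<open>Square-integrable functions\<close>

lemma norm_add_squared_le: "(norm (a + b :: complex))\<^sup>2 \<le> 2 * (norm a)\<^sup>2 + 2 * (norm b)\<^sup>2"
proof -
  have "(norm (a + b))\<^sup>2 \<le> (norm a + norm b)\<^sup>2"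
    by (intro power_mono norm_triangle_ineq) auto
  also have "\<dots> \<le> 2 * (norm a)\<^sup>2 + 2 * (norm b)\<^sup>2"
    using zero_le_power2[of "norm a - norm b"] by (simp add: power2_eq_square algebra_simps)
  finally show ?thesis .
qed

lemma L2_add:
  assumes "f \<in> L2 \<mu>" "g \<in> L2 \<mu>"
  shows "(\<lambda>x. f x + g x) \<in> L2 \<mu>"
proof -
  have [measurable]: "f \<in> borel_measurable \<mu>" "g \<in> borel_measurable \<mu>"
    and int: "integrable \<mu> (\<lambda>x. (norm (f x))\<^sup>2)" "integrable \<mu> (\<lambda>x. (norm (g x))\<^sup>2)"
    using assms by (auto simp: L2_def)
  have "integrable \<mu> (\<lambda>x. (norm (f x + g x))\<^sup>2)"
    by (rule Bochner_Integration.integrable_bound[where f = "\<lambda>x. 2 * (norm (f x))\<^sup>2 + 2 * (norm (g x))\<^sup>2"])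
      (use int norm_add_squared_le in auto)
  then show ?thesis by (simp add: L2_def)
qed

lemma L2_cmult: "f \<in> L2 \<mu> \<Longrightarrow> (\<lambda>x. c * f x) \<in> L2 \<mu>"
  by (auto simp: L2_def norm_mult power_mult_distrib)

lemma L2_diff: "f \<in> L2 \<mu> \<Longrightarrow> g \<in> L2 \<mu> \<Longrightarrow> (\<lambda>x. f x - g x) \<in> L2 \<mu>"
  using L2_add[of f \<mu> "\<lambda>x. - 1 * g x"] L2_cmult[of g \<mu> "- 1"] by simp

lemma L2_bounded:
  assumes "finite_measure \<mu>" "f \<in> borel_measurable \<mu>" "AE x in \<mu>. norm (f x) \<le> K"
  shows "f \<in> L2 \<mu>"
proof -
  interpret finite_measure \<mu> by fact
  have [measurable]: "f \<in> borel_measurable \<mu>" by fact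
  have "integrable \<mu> (\<lambda>x. (norm (f x))\<^sup>2)"
    by (rule integrable_const_bound[where B = "K\<^sup>2"])
      (use assms(3) in \<open>auto elim!: eventually_mono intro: power_mono\<close>)
  then show ?thesis using assms by (simp add: L2_def)
qed

lemma L2_linear_combinations:
  assumes "\<And>i. i \<in> I \<Longrightarrow> e i \<in> L2 \<mu>" "f \<in> linear_combinations I e"
  shows "f \<in> L2 \<mu>"
proof -
  obtain F c where F: "f = (\<lambda>x. \<Sum>i\<in>F. c i * e i x)" "finite F" "F \<subseteq> I"
    using assms(2) by (auto simp: linear_combinations_def)
  from F(2,3) have "(\<lambda>x. \<Sum>i\<in>F. c i * e i x) \<in> L2 \<mu>"
  proof (induction F)
    case empty then show ?case by (simp add: L2_def)
  next
    case (insert i F) then show ?case by (auto intro!: L2_add L2_cmult assms(1))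
  qed
  then show ?thesis using F by simp
qed

text \<open>The square is kept to avoid roots: \<open>sq_norm_add\<close> acts as a triangle
  inequality with a factor two, which limit arguments absorb.\<close>

definition sq_norm :: "'a measure \<Rightarrow> ('a \<Rightarrow> complex) \<Rightarrow> real" where
  "sq_norm \<mu> f = (\<integral>x. (norm (f x))\<^sup>2 \<partial>\<mu>)"

lemma sq_norm_add:
  assumes "f \<in> L2 \<mu>" "g \<in> L2 \<mu>"
  shows "sq_norm \<mu> (\<lambda>x. f x + g x) \<le> 2 * sq_norm \<mu> f + 2 * sq_norm \<mu> g"
proof -
  have "sq_norm \<mu> (\<lambda>x. f x + g x) \<le> (\<integral>x. 2 * (norm (f x))\<^sup>2 + 2 * (norm (g x))\<^sup>2 \<partial>\<mu>)"
    unfolding sq_norm_def using assms L2_add[OF assms]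
    by (intro integral_mono norm_add_squared_le) (auto simp: L2_def)
  also have "\<dots> = 2 * sq_norm \<mu> f + 2 * sq_norm \<mu> g"
    using assms by (simp add: L2_def sq_norm_def)
  finally show ?thesis .
qed

lemma sq_norm_cmult: "sq_norm \<mu> (\<lambda>x. c * f x) = (norm c)\<^sup>2 * sq_norm \<mu> f"
  by (simp add: sq_norm_def norm_mult power_mult_distrib)

lemma sq_norm_tendsto_0:
  assumes "finite_measure \<mu>" "\<And>n. f n \<in> borel_measurable \<mu>" "\<And>n x. norm (f n x) \<le> 1"
    and "\<And>x. (\<lambda>n. f n x) \<longlonglongrightarrow> 0"
  shows "(\<lambda>n. sq_norm \<mu> (f n)) \<longlonglongrightarrow> 0"
proof -
  interpret finite_measure \<mu> by fact
  have [measurable]: "\<And>n. f n \<in> borel_measurable \<mu>" by fact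
  have "(\<lambda>n. \<integral>x. (norm (f n x))\<^sup>2 \<partial>\<mu>) \<longlonglongrightarrow> (\<integral>x. 0 \<partial>\<mu>)"
  proof (rule integral_dominated_convergence[where w = "\<lambda>_. 1"])
    show "AE x in \<mu>. (\<lambda>n. (norm (f n x))\<^sup>2) \<longlonglongrightarrow> 0"
      using assms(4) by (auto intro!: AE_I2 tendsto_eq_intros tendsto_norm_zero)
    show "AE x in \<mu>. norm ((norm (f n x))\<^sup>2) \<le> 1" for n
      using assms(3) by (auto simp: power_le_one)
  qed auto
  then show ?thesis by (simp add: sq_norm_def)
qed

text \<open>Membership in the L2 closure of \<open>V\<close>, stated for representatives.\<close>

definition approximable :: "'a measure \<Rightarrow> ('a \<Rightarrow> complex) set \<Rightarrow> ('a \<Rightarrow> complex) \<Rightarrow> bool" where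
  "approximable \<mu> V f \<longleftrightarrow> f \<in> L2 \<mu> \<and> (\<forall>\<epsilon>>0. \<exists>g\<in>V. sq_norm \<mu> (\<lambda>x. f x - g x) < \<epsilon>)"

locale L2_family =
  fixes \<mu> :: "'a measure" and I :: "'i set" and e :: "'i \<Rightarrow> 'a \<Rightarrow> complex"
  assumes e_L2: "i \<in> I \<Longrightarrow> e i \<in> L2 \<mu>"
begin

abbreviation "approx \<equiv> approximable \<mu> (linear_combinations I e)"

lemma approxE:
  assumes "approx f" "\<epsilon> > 0"
  obtains g where "g \<in> linear_combinations I e" "sq_norm \<mu> (\<lambda>x. f x - g x) < \<epsilon>" "g \<in> L2 \<mu>"
proof -
  obtain g where g: "g \<in> linear_combinations I e" "sq_norm \<mu> (\<lambda>x. f x - g x) < \<epsilon>"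
    using assms unfolding approximable_def by blast
  then show ?thesis by (rule that) (rule L2_linear_combinations[OF e_L2 g(1)])
qed

lemma approx_L2: "approx f \<Longrightarrow> f \<in> L2 \<mu>"
  by (simp add: approximable_def)

lemma approx_add:
  assumes "approx f" "approx g"
  shows "approx (\<lambda>x. f x + g x)"
  unfolding approximable_def
proof safe
  show L2: "(\<lambda>x. f x + g x) \<in> L2 \<mu>"
    using assms by (auto simp: approximable_def intro: L2_add)
  fix \<epsilon> :: real assume "\<epsilon> > 0"
  then have "\<epsilon> / 4 > 0" by simp
  obtain f' where f': "f' \<in> linear_combinations I e" "sq_norm \<mu> (\<lambda>x. f x - f' x) < \<epsilon> / 4" "f' \<in> L2 \<mu>"
    using approxE[OF assms(1) \<open>\<epsilon> / 4 > 0\<close>] by blast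
  obtain g' where g': "g' \<in> linear_combinations I e" "sq_norm \<mu> (\<lambda>x. g x - g' x) < \<epsilon> / 4" "g' \<in> L2 \<mu>"
    using approxE[OF assms(2) \<open>\<epsilon> / 4 > 0\<close>] by blast
  have "(\<lambda>x. f x - f' x) \<in> L2 \<mu>" "(\<lambda>x. g x - g' x) \<in> L2 \<mu>"
    by (rule L2_diff[OF approx_L2[OF assms(1)] f'(3)], rule L2_diff[OF approx_L2[OF assms(2)] g'(3)])
  from sq_norm_add[OF this] f' g'
  have "sq_norm \<mu> (\<lambda>x. f x + g x - (f' x + g' x)) < \<epsilon>"
    by (simp add: algebra_simps)
  then show "\<exists>h\<in>linear_combinations I e. sq_norm \<mu> (\<lambda>x. f x + g x - h x) < \<epsilon>"
    using linear_combinations_add[OF f'(1) g'(1)] by (intro bexI[of _ "\<lambda>x. f' x + g' x"])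
qed

lemma approx_cmult:
  assumes "approx f"
  shows "approx (\<lambda>x. c * f x)"
  unfolding approximable_def
proof safe
  show L2: "(\<lambda>x. c * f x) \<in> L2 \<mu>"
    using assms by (auto simp: approximable_def intro: L2_cmult)
  fix \<epsilon> :: real assume "\<epsilon> > 0"
  moreover have pos: "(norm c)\<^sup>2 + 1 > 0" by (rule add_nonneg_pos) auto
  ultimately have "\<epsilon> / ((norm c)\<^sup>2 + 1) > 0" by simp
  then obtain f' where f': "f' \<in> linear_combinations I e" "sq_norm \<mu> (\<lambda>x. f x - f' x) < \<epsilon> / ((norm c)\<^sup>2 + 1)"
    using approxE[OF assms] by blast
  have "sq_norm \<mu> (\<lambda>x. c * f x - c * f' x) = (norm c)\<^sup>2 * sq_norm \<mu> (\<lambda>x. f x - f' x)"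
    by (simp add: sq_norm_cmult flip: right_diff_distrib)
  also have "\<dots> \<le> ((norm c)\<^sup>2 + 1) * sq_norm \<mu> (\<lambda>x. f x - f' x)"
    by (intro mult_right_mono) (auto simp: sq_norm_def)
  also have "\<dots> < \<epsilon>"
    using f'(2) pos by (simp add: field_simps)
  finally show "\<exists>h\<in>linear_combinations I e. sq_norm \<mu> (\<lambda>x. c * f x - h x) < \<epsilon>"
    using linear_combinations_cmult[OF f'(1), of c] by (intro bexI[of _ "\<lambda>x. c * f' x"])
qed

lemma approx_diff: "approx f \<Longrightarrow> approx g \<Longrightarrow> approx (\<lambda>x. f x - g x)"
  using approx_add[of f "\<lambda>x. - 1 * g x"] approx_cmult[of g "- 1"] by simp

lemma approx_zero: "approx (\<lambda>x. 0)"
  unfolding approximable_def using linear_combinations_zero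
  by (auto simp: L2_def sq_norm_def intro!: bexI[of _ "\<lambda>x. 0"])

lemma approx_sum: "(\<And>a. a \<in> A \<Longrightarrow> approx (h a)) \<Longrightarrow> approx (\<lambda>x. \<Sum>a\<in>A. h a x)"
  by (induction A rule: infinite_finite_induct) (auto intro!: approx_add approx_zero)

lemma approx_closed:
  assumes f: "f \<in> L2 \<mu>" and lim: "\<And>\<epsilon>. \<epsilon> > 0 \<Longrightarrow> \<exists>g. approx g \<and> sq_norm \<mu> (\<lambda>x. f x - g x) < \<epsilon>"
  shows "approx f"
  unfolding approximable_def
proof safe
  fix \<epsilon> :: real assume "\<epsilon> > 0"
  then obtain g where g: "approx g" "sq_norm \<mu> (\<lambda>x. f x - g x) < \<epsilon> / 4"
    using lim[of "\<epsilon> / 4"] by auto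
  have "\<epsilon> / 4 > 0" using \<open>\<epsilon> > 0\<close> by simp
  from approxE[OF g(1) this]
  obtain h where h: "h \<in> linear_combinations I e" "sq_norm \<mu> (\<lambda>x. g x - h x) < \<epsilon> / 4" "h \<in> L2 \<mu>"
    by blast
  have "(\<lambda>x. f x - g x) \<in> L2 \<mu>" "(\<lambda>x. g x - h x) \<in> L2 \<mu>"
    by (rule L2_diff[OF f approx_L2[OF g(1)]], rule L2_diff[OF approx_L2[OF g(1)] h(3)])
  from sq_norm_add[OF this] g h show "\<exists>g\<in>linear_combinations I e. sq_norm \<mu> (\<lambda>x. f x - g x) < \<epsilon>"
    by (intro bexI[of _ h]) auto
qed fact

text \<open>Bounded convergence: for a finite measure, pointwise convergence with errors at most one
  forces convergence in mean square. This leads from continuous functions to indicators.\<close>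

lemma approx_lim:
  assumes "finite_measure \<mu>" and f: "f \<in> borel_measurable \<mu>" and g: "\<And>n. approx (g n)"
    and bdd: "\<And>n x. norm (f x - g n x) \<le> 1" and lim: "\<And>x. (\<lambda>n. g n x) \<longlonglongrightarrow> f x"
  shows "approx f"
proof (rule approx_closed)
  have g_L2: "g n \<in> L2 \<mu>" for n using g by (auto simp: approximable_def)
  have meas: "(\<lambda>x. f x - g n x) \<in> borel_measurable \<mu>" for n
    using f g_L2[of n] by (auto simp: L2_def)
  have "(\<lambda>x. f x - g 0 x) \<in> L2 \<mu>"
    using assms(1) by (rule L2_bounded[where K = 1]) (use bdd meas in auto)
  from L2_add[OF this g_L2[of 0]] show "f \<in> L2 \<mu>" by simp
  have lim0: "(\<lambda>n. sq_norm \<mu> (\<lambda>x. f x - g n x)) \<longlonglongrightarrow> 0"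
    using assms(1) meas bdd
  proof (rule sq_norm_tendsto_0)
    show "(\<lambda>n. f x - g n x) \<longlonglongrightarrow> 0" for x
      using tendsto_diff[OF tendsto_const lim, of "f x" x] by simp
  qed
  show "\<exists>h. approx h \<and> sq_norm \<mu> (\<lambda>x. f x - h x) < \<epsilon>" if \<epsilon>: "\<epsilon> > 0" for \<epsilon>
  proof -
    obtain n where "sq_norm \<mu> (\<lambda>x. f x - g n x) < \<epsilon>"
      using eventually_happens[OF order_tendstoD(2)[OF lim0 \<epsilon>]] by auto
    then show ?thesis using g by blast
  qed
qed

end


section \<open>Exponentials and trigonometric polynomials\<close>

lemma expo_add: "expo (\<xi> + \<eta>) x = expo \<xi> x * expo \<eta> x"
  by (simp add: expo_def inner_add_left distrib_left exp_add)

lemma expo_add_right: "expo \<xi> (x + y) = expo \<xi> x * expo \<xi> y"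
  by (simp add: expo_def inner_add_right distrib_left exp_add)

lemma expo_0 [simp]: "expo 0 x = 1" "expo \<xi> 0 = 1"
  by (simp_all add: expo_def)

lemma expo_cis: "expo \<xi> x = cis (2 * pi * (\<xi> \<bullet> x))"
  by (simp add: expo_def cis_conv_exp mult_ac)

lemma norm_expo [simp]: "norm (expo \<xi> x) = 1"
  by (simp add: expo_cis)

lemma expo_uminus: "expo (- \<xi>) x = cnj (expo \<xi> x)" "expo \<xi> (- x) = cnj (expo \<xi> x)"
  by (simp_all add: expo_cis cis_cnj)

lemma continuous_expo: "continuous_on S (expo \<xi>)"
  unfolding expo_def by (intro continuous_intros)

lemma borel_measurable_expo [measurable]: "expo \<xi> \<in> borel_measurable borel"
  by (intro borel_measurable_continuous_onI continuous_expo)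

abbreviation "trig_polynomials \<equiv> linear_combinations UNIV expo"

lemma expo_in_trig: "expo \<xi> \<in> trig_polynomials"
  by (rule linear_combinations_base) simp

lemma trig_mult:
  assumes "f \<in> trig_polynomials" "g \<in> trig_polynomials"
  shows "(\<lambda>x. f x * g x) \<in> trig_polynomials"
proof -
  obtain F c where F: "f = (\<lambda>x. \<Sum>i\<in>F. c i * expo i x)"
    using assms(1) by (auto simp: linear_combinations_def)
  obtain G d where G: "g = (\<lambda>x. \<Sum>i\<in>G. d i * expo i x)"
    using assms(2) by (auto simp: linear_combinations_def)
  have "(\<lambda>x. f x * g x) = (\<lambda>x. \<Sum>i\<in>F. \<Sum>j\<in>G. (c i * d j) * expo (i + j) x)"
    by (simp add: F G sum_product expo_add mult_ac)
  moreover have "\<dots> \<in> trig_polynomials"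
    by (intro linear_combinations_sum linear_combinations_cmult expo_in_trig)
  ultimately show ?thesis by simp
qed

lemma trig_continuous: "f \<in> trig_polynomials \<Longrightarrow> continuous_on S f"
  by (auto simp: linear_combinations_def intro!: continuous_intros continuous_expo)

text \<open>Stone-Weierstrass is applied in its real form, so these are the real-valued members of
  the complex algebra; they include cosines and sines.\<close>

definition real_trig :: "('a::euclidean_space \<Rightarrow> real) set" where
  "real_trig = {g. (\<lambda>x. complex_of_real (g x)) \<in> trig_polynomials}"

lemma real_trig_cos: "(\<lambda>x. cos (2 * pi * (\<xi> \<bullet> x))) \<in> real_trig"
proof -
  have "(\<lambda>x. complex_of_real (cos (2 * pi * (\<xi> \<bullet> x)))) = (\<lambda>x. 1/2 * expo \<xi> x + 1/2 * expo (- \<xi>) x)"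
    by (simp add: fun_eq_iff expo_uminus expo_cis complex_eq_iff)
  moreover have "\<dots> \<in> trig_polynomials"
    by (intro linear_combinations_add linear_combinations_cmult expo_in_trig)
  ultimately show ?thesis by (simp add: real_trig_def)
qed

lemma real_trig_sin: "(\<lambda>x. sin (2 * pi * (\<xi> \<bullet> x))) \<in> real_trig"
proof -
  have "(\<lambda>x. complex_of_real (sin (2 * pi * (\<xi> \<bullet> x)))) = (\<lambda>x. (- \<i>/2) * expo \<xi> x + (\<i>/2) * expo (- \<xi>) x)"
    by (simp add: fun_eq_iff expo_uminus expo_cis complex_eq_iff)
  moreover have "\<dots> \<in> trig_polynomials"
    by (intro linear_combinations_add linear_combinations_cmult expo_in_trig)
  ultimately show ?thesis by (simp add: real_trig_def)
qed

lemma function_ring_trig: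
  assumes "compact (S :: 'a::euclidean_space set)"
  shows "function_ring_on real_trig S"
proof
  show "compact S" by fact
  show "continuous_on S f" if "f \<in> real_trig" for f
  proof -
    have "continuous_on S (\<lambda>x. Re (complex_of_real (f x)))"
      using that by (intro continuous_intros trig_continuous) (simp add: real_trig_def)
    then show ?thesis by simp
  qed
  show "(\<lambda>x. f x + g x) \<in> real_trig" if "f \<in> real_trig" "g \<in> real_trig" for f g :: "'a \<Rightarrow> real"
    using that linear_combinations_add by (fastforce simp: real_trig_def)
  show "(\<lambda>x. f x * g x) \<in> real_trig" if "f \<in> real_trig" "g \<in> real_trig" for f g :: "'a \<Rightarrow> real"
    using that trig_mult by (fastforce simp: real_trig_def)
  show "(\<lambda>_. c) \<in> real_trig" for c
    using linear_combinations_cmult[OF expo_in_trig[of 0], of "of_real c"] by (simp add: real_trig_def)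
  show "\<exists>f\<in>real_trig. f x \<noteq> f y" if "x \<in> S" "y \<in> S" "x \<noteq> y" for x y
  proof (rule ccontr)
    assume "\<not> (\<exists>f\<in>real_trig. f x \<noteq> f y)"
    then have eq: "f x = f y" if "f \<in> real_trig" for f using that by blast
    \<comment> \<open>The scaling gives \<open>\<xi> \<bullet> (x - y) = 1 / 4\<close>, where the
      exponential takes the value \<open>\<i>\<close> and not 1.\<close>
    define \<xi> where "\<xi> = (1 / (4 * (norm (x - y))\<^sup>2)) *\<^sub>R (x - y)"
    have "cos (2 * pi * (\<xi> \<bullet> x)) = cos (2 * pi * (\<xi> \<bullet> y))" "sin (2 * pi * (\<xi> \<bullet> x)) = sin (2 * pi * (\<xi> \<bullet> y))"
      using eq[OF real_trig_cos[of \<xi>]] eq[OF real_trig_sin[of \<xi>]] by simp_all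
    then have "expo \<xi> x = expo \<xi> y" by (simp add: expo_cis complex_eq_iff)
    then have "expo \<xi> (x - y) = 1"
      using expo_add_right[of \<xi> x "- y"] norm_expo[of \<xi> y]
      by (simp add: expo_uminus(2) complex_norm_square[symmetric])
    moreover have quarter: "\<xi> \<bullet> (x - y) = 1 / 4"
      using that(3) by (simp add: \<xi>_def power2_norm_eq_inner)
    have "expo \<xi> (x - y) = \<i>"
      unfolding expo_cis quarter by (simp add: complex_eq_iff)
    ultimately show False by (simp add: complex_eq_iff)
  qed
qed

section \<open>From exponentials to all square-integrable functions\<close>

locale exponential_family = L2_family \<mu> I e for \<mu> :: "'a::euclidean_space measure" and I :: "'i set" and e +
  fixes K :: real
  assumes prob: "borel_prob \<mu>" and support: "AE x in \<mu>. norm x \<le> K"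
    and exponentials: "approx (expo \<xi>)"
begin

sublocale prob_space \<mu> using prob by (simp add: borel_prob_def)

lemma sets_\<mu> [measurable_cong]: "sets \<mu> = sets borel" using prob by (simp add: borel_prob_def)

lemma space_\<mu>: "space \<mu> = UNIV" using sets_eq_imp_space_eq[OF sets_\<mu>] by simp

lemma approx_trig:
  assumes "f \<in> trig_polynomials"
  shows "approx f"
proof -
  obtain F c where "f = (\<lambda>x. \<Sum>i\<in>F. c i * expo i x)"
    using assms by (auto simp: linear_combinations_def)
  then show ?thesis by (auto intro!: approx_sum approx_cmult exponentials)
qed

text \<open>Stone-Weierstrass on the ball that carries \<open>\<mu>\<close>: a uniform error there
  bounds the error in mean square.\<close>

lemma approx_continuous:
  fixes f :: "'a \<Rightarrow> real"
  assumes cont: "continuous_on UNIV f" and bdd: "\<And>x. \<bar>f x\<bar> \<le> M"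
  shows "approx (\<lambda>x. of_real (f x))"
proof (rule approx_closed)
  have [measurable]: "f \<in> borel_measurable borel" using cont by (rule borel_measurable_continuous_onI)
  show "(\<lambda>x. complex_of_real (f x)) \<in> L2 \<mu>"
    by (rule L2_bounded[where K = M, OF finite_measure_axioms]) (use bdd in auto)
  fix \<epsilon> :: real assume \<epsilon>: "\<epsilon> > 0"
  \<comment> \<open>A uniform error \<open>d\<close> costs \<open>d\<^sup>2 = \<epsilon> / 2\<close>
    in the squared norm.\<close>
  define d where "d = sqrt (\<epsilon> / 2)"
  have d: "d > 0" "d\<^sup>2 < \<epsilon>" using \<epsilon> by (auto simp: d_def)
  interpret function_ring_on real_trig "cball 0 K :: 'a set"
    by (rule function_ring_trig) simp
  obtain g where g: "g \<in> real_trig" "\<And>x. norm x \<le> K \<Longrightarrow> \<bar>f x - g x\<bar> < d"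
    using Stone_Weierstrass_basic[of f d] continuous_on_subset[OF cont] d by auto
  have ap: "approx (\<lambda>x. complex_of_real (g x))"
    using g by (intro approx_trig) (simp add: real_trig_def)
  have "sq_norm \<mu> (\<lambda>x. complex_of_real (f x) - complex_of_real (g x)) \<le> (\<integral>x. d\<^sup>2 \<partial>\<mu>)"
    unfolding sq_norm_def
  proof (rule integral_mono_AE)
    show "integrable \<mu> (\<lambda>x. (norm (complex_of_real (f x) - complex_of_real (g x)))\<^sup>2)"
      using L2_diff[OF \<open>(\<lambda>x. complex_of_real (f x)) \<in> L2 \<mu>\<close> approx_L2[OF ap]] by (simp add: L2_def)
    show "AE x in \<mu>. (norm (complex_of_real (f x) - complex_of_real (g x)))\<^sup>2 \<le> d\<^sup>2"
      using support
    proof eventually_elim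
      case (elim x)
      then have "norm (complex_of_real (f x) - complex_of_real (g x)) \<le> d"
        using g(2)[of x] by (simp flip: of_real_diff)
      then show ?case by (intro power_mono) auto
    qed
  qed simp
  then show "\<exists>g. approx g \<and> sq_norm \<mu> (\<lambda>x. complex_of_real (f x) - g x) < \<epsilon>"
    using ap d prob_space by (intro exI[of _ "\<lambda>x. complex_of_real (g x)"]) auto
qed

text \<open>Induction over the Borel sets from the intersection-stable family of closed sets. Closed
  sets are limits of continuous bumps, complements are differences with the constant one, and
  disjoint unions are bounded limits of finite sums.\<close>

lemma approx_indicator:
  assumes "E \<in> sets borel"
  shows "approx (indicator E)"
proof -
  have closed: "sets borel = sigma_sets UNIV (Collect closed :: 'a set set)"
    by (subst borel_eq_closed) (rule sets_measure_of, simp)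
  have meas: "indicator A \<in> borel_measurable \<mu>" if "A \<in> sets borel" for A
    using that by (intro borel_measurable_indicator) (simp add: sets_\<mu>)
  have "Int_stable (Collect closed :: 'a set set)" by (auto simp: Int_stable_def)
  moreover have "Collect closed \<subseteq> Pow (UNIV :: 'a set)" by simp
  moreover have "E \<in> sigma_sets UNIV (Collect closed)" using assms closed by simp
  ultimately show ?thesis
  proof (induction rule: sigma_sets_induct_disjoint)
    case (basic S)
    then have S: "closed S" by simp
    show ?case
    proof (cases "S = {}")
      case False
      note bump = infdist_bump[where S = S]
      show ?thesis
      proof (rule approx_lim[OF finite_measure_axioms meas])
        show "S \<in> sets borel" using S by simp
        show "approx (\<lambda>x. of_real (max 0 (1 - real n * infdist x S)))" for n
          by (rule approx_continuous[where M = 1])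
            (use bump(2,3) in \<open>auto intro!: continuous_intros continuous_on_infdist\<close>)
        show "norm (indicator S x - complex_of_real (max 0 (1 - real n * infdist x S))) \<le> 1" for n x
        proof -
          have "indicator S x - complex_of_real (max 0 (1 - real n * infdist x S))
            = of_real (indicator S x - max 0 (1 - real n * infdist x S))"
            by (simp add: of_real_indicator)
          then show ?thesis
            unfolding norm_of_real using bump(2,3)[of n x] by (auto simp: indicator_def)
        qed
        show "(\<lambda>n. complex_of_real (max 0 (1 - real n * infdist x S))) \<longlonglongrightarrow> indicator S x" for x
          using tendsto_of_real[OF bump(4)[OF S False, of x], where 'a = complex]
          by (simp add: of_real_indicator)
      qed
    qed (simp add: approx_zero)
  next
    case empty then show ?case by (simp add: approx_zero)
  next
    case (compl A)
    have "indicator (UNIV - A) = (\<lambda>x. expo 0 x - indicator A x :: complex)"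
      by (auto simp: fun_eq_iff indicator_def)
    then show ?case using approx_diff[OF exponentials[of 0] compl.IH] by simp
  next
    case (union A)
    have A: "A i \<in> sets borel" for i using union closed by auto
    have part: "(\<Sum>i<n. indicator (A i) x) = (indicator (\<Union>i<n. A i) x :: complex)" for n x
      using union(1) by (subst indicator_UN_disjoint) (auto simp: disjoint_family_on_def)
    show ?case
    proof (rule approx_lim[OF finite_measure_axioms meas])
      show "(\<Union>i. A i) \<in> sets borel" using A by auto
      show "approx (\<lambda>x. \<Sum>i<n. indicator (A i) x)" for n
        by (intro approx_sum union.IH)
      show "norm (indicator (\<Union>i. A i) x - (\<Sum>i<n. indicator (A i) x :: complex)) \<le> 1" for n x
        unfolding part by (auto simp: indicator_def)
      show "(\<lambda>n. \<Sum>i<n. indicator (A i) x) \<longlonglongrightarrow> (indicator (\<Union>i. A i) x :: complex)" for x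
        unfolding part by (rule LIMSEQ_indicator_UN)
    qed
  qed
qed

text \<open>Simple functions, which are combinations of indicators, tend to \<open>f\<close> in mean
  square by dominated convergence.\<close>

theorem approx_all:
  assumes f: "f \<in> L2 \<mu>"
  shows "approx f"
proof (rule approx_closed[OF f])
  have [measurable]: "f \<in> borel_measurable \<mu>" and int: "integrable \<mu> (\<lambda>x. (norm (f x))\<^sup>2)"
    using f by (auto simp: L2_def)
  obtain s where s: "\<And>i. simple_function \<mu> (s i)" "\<And>x. (\<lambda>i. s i x) \<longlonglongrightarrow> f x"
    "\<And>i x. norm (s i x) \<le> 2 * norm (f x)"
    using borel_measurable_implies_sequence_metric[of f \<mu> 0] by (auto simp: space_\<mu>)
  have ap: "approx (s i)" for i
  proof -
    have "s i = (\<lambda>x. \<Sum>y\<in>range (s i). y * indicator (s i -` {y}) x)"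
    proof
      fix x
      have fin: "finite (range (s i))"
        using s(1)[of i] by (simp add: simple_function_def space_\<mu>)
      have "(\<Sum>y\<in>range (s i). y * indicator (s i -` {y}) x) = (\<Sum>y\<in>{s i x}. y * indicator (s i -` {y}) x)"
        using fin by (intro sum.mono_neutral_right) auto
      then show "s i x = (\<Sum>y\<in>range (s i). y * indicator (s i -` {y}) x)" by simp
    qed
    moreover have "s i -` {y} \<in> sets borel" for y
      using simple_functionD(2)[OF s(1)[of i], of "{y}"] by (simp add: space_\<mu> sets_\<mu>)
    then have "approx (\<lambda>x. \<Sum>y\<in>range (s i). y * indicator (s i -` {y}) x)"
      by (intro approx_sum approx_cmult approx_indicator)
    ultimately show ?thesis by simp
  qed
  have "(\<lambda>n. \<integral>x. (norm (f x - s n x))\<^sup>2 \<partial>\<mu>) \<longlonglongrightarrow> (\<integral>x. 0 \<partial>\<mu>)"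
  \<comment> \<open>The approximants are bounded by \<open>2 * norm (f x)\<close>, so the error is
    at most three times \<open>norm (f x)\<close>.\<close>
  proof (rule integral_dominated_convergence[where w = "\<lambda>x. 9 * (norm (f x))\<^sup>2"])
    show "AE x in \<mu>. (\<lambda>n. (norm (f x - s n x))\<^sup>2) \<longlonglongrightarrow> 0"
    proof (rule AE_I2)
      fix x
      have "(\<lambda>n. f x - s n x) \<longlonglongrightarrow> f x - f x"
        by (intro tendsto_intros s)
      then show "(\<lambda>n. (norm (f x - s n x))\<^sup>2) \<longlonglongrightarrow> 0"
        using tendsto_power[OF tendsto_norm_zero, of "\<lambda>n. f x - s n x" sequentially 2] by simp
    qed
    show "AE x in \<mu>. norm ((norm (f x - s n x))\<^sup>2) \<le> 9 * (norm (f x))\<^sup>2" for n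
    proof (rule AE_I2)
      fix x
      have "norm (f x - s n x) \<le> 3 * norm (f x)"
        using norm_triangle_ineq4[of "f x" "s n x"] s(3)[of n x] by simp
      then have "(norm (f x - s n x))\<^sup>2 \<le> (3 * norm (f x))\<^sup>2" by (intro power_mono) auto
      then show "norm ((norm (f x - s n x))\<^sup>2) \<le> 9 * (norm (f x))\<^sup>2"
        by (simp add: power_mult_distrib)
    qed
    show "(\<lambda>x. (norm (f x - s n x))\<^sup>2) \<in> borel_measurable \<mu>" for n
      using borel_measurable_simple_function[OF s(1)[of n]] by measurable
  qed (use int in auto)
  then have lim0: "(\<lambda>n. sq_norm \<mu> (\<lambda>x. f x - s n x)) \<longlonglongrightarrow> 0" by (simp add: sq_norm_def)
  fix \<epsilon> :: real assume "\<epsilon> > 0"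
  then obtain n where "sq_norm \<mu> (\<lambda>x. f x - s n x) < \<epsilon>"
    using eventually_happens[OF order_tendstoD(2)[OF lim0]] by auto
  then show "\<exists>g. approx g \<and> sq_norm \<mu> (\<lambda>x. f x - g x) < \<epsilon>" using ap by blast
qed

end

section \<open>Spectra of self-affine measures\<close>

lemma norm_cis_diff_le: "norm (cis a - cis b) \<le> \<bar>a - b\<bar>"
proof -
  have "cis a - cis b = cis b * (cis (a - b) - 1)"
    by (simp add: right_diff_distrib cis_mult)
  then have "norm (cis a - cis b) = norm (cis (a - b) - 1)"
    by (simp add: norm_mult)
  also have "\<dots> \<le> \<bar>a - b\<bar>"
    using iexp_approx1[of "a - b" 0] by (simp add: cis_conv_exp)
  finally show ?thesis .
qed

text \<open>For \<open>k = q ^ n\<close> this splits off the leading base \<open>q\<close> digit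
  \<open>a\<close>, as \<open>ftn_sum\<close> requires.\<close>

lemma sum_nat_digits:
  fixes f :: "nat \<Rightarrow> 'b::comm_monoid_add"
  shows "(\<Sum>N<q * k. f N) = (\<Sum>N'<k. \<Sum>a<q. f (a * k + N'))"
proof -
  have "(\<Sum>N<q * k. f N) = (\<Sum>a<q. sum f {a * k..<a * k + k})"
    by (rule sum.nat_group[symmetric])
  also have "\<dots> = (\<Sum>a<q. \<Sum>N'<k. f (a * k + N'))"
  proof (rule sum.cong[OF refl])
    fix a
    show "sum f {a * k..<a * k + k} = (\<Sum>N'<k. f (a * k + N'))"
      using sum.shift_bounds_nat_ivl[of f 0 "a * k" k] by (simp add: lessThan_atLeast0 add.commute)
  qed
  also have "\<dots> = (\<Sum>N'<k. \<Sum>a<q. f (a * k + N'))" by (rule sum.swap)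
  finally show ?thesis .
qed

text \<open>\<open>Z\<close> stands for the integer lattice and \<open>S\<close> is the adjoint of
  \<open>A\<close>. Additivity of \<open>Z\<close>, its stability under \<open>T\<close> and its
  integral pairing with the digits are what periodicity of the mask rests on.\<close>

locale self_affine = affine_ifs A B C r for A :: "'a::euclidean_space \<Rightarrow> 'a" and B C r +
  fixes S T :: "'a \<Rightarrow> 'a" and Z :: "'a set" and \<mu> :: "'a measure" and K :: real
  assumes linS: "linear S" and linT: "linear T"
    and adj: "A x \<bullet> y = x \<bullet> S y" and TS: "T (S x) = x" and ST: "S (T x) = x"
    and Z_add: "z \<in> Z \<Longrightarrow> w \<in> Z \<Longrightarrow> z + w \<in> Z"
    and T_Z: "z \<in> Z \<Longrightarrow> T z \<in> Z"
    and B_Z: "b \<in> B \<Longrightarrow> z \<in> Z \<Longrightarrow> b \<bullet> z \<in> \<int>"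
    and \<mu>: "is_self_affine A B \<mu>" and support: "AE x in \<mu>. norm x \<le> K"
begin

sublocale prob_space \<mu> using \<mu> by (simp add: is_self_affine_def borel_prob_def)

lemma sets_\<mu> [measurable_cong]: "sets \<mu> = sets borel"
  using \<mu> by (simp add: is_self_affine_def borel_prob_def)

definition q :: nat where "q = card B"
definition ft :: "'a \<Rightarrow> complex" where "ft \<xi> = (\<integral>x. expo (- \<xi>) x \<partial>\<mu>)"
definition mask :: "'a \<Rightarrow> complex" where "mask \<xi> = (\<Sum>b\<in>B. expo (- \<xi>) b) / q"
text \<open>The Fourier transform of the law of the first \<open>n\<close> terms of the random
  series.\<close>

definition ftn :: "nat \<Rightarrow> 'a \<Rightarrow> complex" where "ftn n \<xi> = (\<Prod>j<n. mask ((S ^^ Suc j) \<xi>))"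

lemma q_pos: "q > 0" using B by (simp add: q_def card_gt_0_iff)

lemma integrable_expo [simp, intro]: "integrable \<mu> (expo \<xi>)"
  by (rule integrable_const_bound[where B = 1]) auto

lemma ft_0 [simp]: "ft 0 = 1" by (simp add: ft_def prob_space)

lemma norm_ft_le: "norm (ft \<xi>) \<le> 1"
proof -
  have "norm (ft \<xi>) \<le> (\<integral>x. norm (expo (- \<xi>) x) \<partial>\<mu>)"
    unfolding ft_def by (rule integral_norm_bound)
  then show ?thesis by (simp add: prob_space)
qed

lemma norm_mask_le: "norm (mask \<xi>) \<le> 1"
proof -
  have "norm (\<Sum>b\<in>B. expo (- \<xi>) b) \<le> (\<Sum>b\<in>B. 1)"
    by (rule sum_norm_le) simp
  then show ?thesis using q_pos by (simp add: mask_def norm_divide q_def)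
qed

lemma mask_0 [simp]: "mask 0 = 1" using q_pos by (simp add: mask_def q_def)

lemma expo_int: "\<xi> \<bullet> x \<in> \<int> \<Longrightarrow> expo \<xi> x = 1"
proof -
  assume "\<xi> \<bullet> x \<in> \<int>"
  then have "sin (2 * pi * (\<xi> \<bullet> x)) = 0" "cos (2 * pi * (\<xi> \<bullet> x)) = 1"
    using sin_integer_2pi cos_integer_2pi by blast+
  then show ?thesis by (simp add: expo_cis complex_eq_iff)
qed

lemma mask_periodic:
  assumes "k \<in> Z"
  shows "mask (\<xi> + k) = mask \<xi>"
proof -
  have "expo (- (\<xi> + k)) b = expo (- \<xi>) b" if "b \<in> B" for b
  proof -
    have "expo (- k) b = 1"
      using B_Z[OF that assms] by (intro expo_int) (simp add: inner_commute)
    then show ?thesis using expo_add[of "- \<xi>" "- k" b] by simp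
  qed
  then show ?thesis by (simp add: mask_def)
qed

text \<open>Invariance applied to an exponential: the adjoint moves \<open>A\<close> over to the
  frequency, and the digit factors out into the mask.\<close>

lemma ft_step: "ft \<xi> = mask (S \<xi>) * ft (S \<xi>)"
proof -
  have eq: "expo (- \<xi>) (A (x + b)) = expo (- S \<xi>) b * expo (- S \<xi>) x" for x b
  proof -
    have "\<xi> \<bullet> A y = S \<xi> \<bullet> y" for y
      using adj[of y \<xi>] by (simp add: inner_commute)
    then have "expo (- \<xi>) (A (x + b)) = expo (- S \<xi>) (x + b)"
      by (simp add: expo_def)
    then show ?thesis by (simp add: expo_add_right mult.commute)
  qed
  have "ft \<xi> = (\<Sum>b\<in>B. (\<integral>x. expo (- \<xi>) (A (x + b)) \<partial>\<mu>)) /\<^sub>R card B"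
    unfolding ft_def by (rule self_affine_integral[OF \<mu>, where K = 1]) auto
  also have "\<dots> = mask (S \<xi>) * ft (S \<xi>)"
    unfolding eq by (simp add: ft_def mask_def q_def scaleR_conv_of_real divide_inverse sum_distrib_right mult_ac sum_distrib_left)
  finally show ?thesis .
qed

lemma funpow_S_T: "(S ^^ n) ((T ^^ n) x) = x" "(T ^^ n) ((S ^^ n) x) = x"
proof -
  show "(S ^^ n) ((T ^^ n) x) = x"
    by (induction n arbitrary: x) (simp_all add: ST funpow_swap1[of T])
  show "(T ^^ n) ((S ^^ n) x) = x"
    by (induction n arbitrary: x) (simp_all add: TS funpow_swap1[of S])
qed

lemma linear_funpow_S: "linear (S ^^ n)" and linear_funpow_T: "linear (T ^^ n)"
  by (intro linear_funpow linS linT)+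

lemma funpow_T_Z: "z \<in> Z \<Longrightarrow> (T ^^ n) z \<in> Z"
  by (induction n) (auto intro: T_Z)

lemma ftn_Suc: "ftn (Suc n) \<xi> = ftn n \<xi> * mask ((S ^^ Suc n) \<xi>)"
  by (simp add: ftn_def)

lemma ft_ftn: "ft \<xi> = ftn n \<xi> * ft ((S ^^ n) \<xi>)"
  by (induction n) (simp_all add: ftn_Suc ftn_def[of 0] ft_step[of "(S ^^ _) \<xi>"])

lemma norm_ftn_le: "norm (ftn n \<xi>) \<le> 1"
  unfolding ftn_def prod_norm[symmetric] by (intro prod_le_1) (auto simp: norm_mask_le)

text \<open>Each factor applies at most \<open>n\<close> powers of \<open>S\<close>, which carry
  \<open>(T ^^ n) k\<close> to an element of \<open>Z\<close>, a period of
  \<open>mask\<close>.\<close>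

lemma ftn_periodic:
  assumes "k \<in> Z"
  shows "ftn n (\<xi> + (T ^^ n) k) = ftn n \<xi>"
  unfolding ftn_def
proof (rule prod.cong[OF refl])
  fix j assume "j \<in> {..<n}"
  then have n: "n = Suc j + (n - Suc j)" by simp
  have "(T ^^ n) k = (T ^^ Suc j) ((T ^^ (n - Suc j)) k)"
    by (subst n, subst funpow_add) simp
  then have "(S ^^ Suc j) (\<xi> + (T ^^ n) k) = (S ^^ Suc j) \<xi> + (T ^^ (n - Suc j)) k"
    by (simp only: linear_add[OF linear_funpow_S] funpow_S_T)
  then show "mask ((S ^^ Suc j) (\<xi> + (T ^^ n) k)) = mask ((S ^^ Suc j) \<xi>)"
    using mask_periodic[OF funpow_T_Z[OF assms]] by simp
qed

text \<open>A chord is at most as long as its arc, and on the support the two phases differ by at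
  most the stated bound.\<close>

lemma ft_lipschitz: "norm (ft \<xi> - ft \<eta>) \<le> 2 * pi * K * norm (\<xi> - \<eta>)"
proof -
  have "ft \<xi> - ft \<eta> = (\<integral>x. expo (- \<xi>) x - expo (- \<eta>) x \<partial>\<mu>)"
    by (simp add: ft_def)
  also have "norm \<dots> \<le> (\<integral>x. norm (expo (- \<xi>) x - expo (- \<eta>) x) \<partial>\<mu>)"
    by (rule integral_norm_bound)
  also have "\<dots> \<le> (\<integral>x. 2 * pi * K * norm (\<xi> - \<eta>) \<partial>\<mu>)"
  proof (rule integral_mono_AE)
    show "AE x in \<mu>. norm (expo (- \<xi>) x - expo (- \<eta>) x) \<le> 2 * pi * K * norm (\<xi> - \<eta>)"
      using support
    proof eventually_elim
      case (elim x)
      have "norm (expo (- \<xi>) x - expo (- \<eta>) x) \<le> \<bar>2 * pi * (- \<xi> \<bullet> x) - 2 * pi * (- \<eta> \<bullet> x)\<bar>"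
        unfolding expo_cis by (rule norm_cis_diff_le)
      also have "\<dots> = 2 * pi * \<bar>(\<eta> - \<xi>) \<bullet> x\<bar>"
        by (simp add: abs_mult inner_diff_left flip: right_diff_distrib)
      also have "\<dots> \<le> 2 * pi * (norm (\<eta> - \<xi>) * K)"
        using elim
        by (intro mult_left_mono order_trans[OF Cauchy_Schwarz_ineq2 mult_left_mono]) auto
      finally show ?case by (simp add: norm_minus_commute mult_ac)
    qed
  qed auto
  finally show ?thesis by (simp add: prob_space)
qed

lemma C_ge_1: "1 \<le> C"
proof -
  obtain b :: 'a where "b \<in> Basis" using nonempty_Basis by blast
  with bound[of 0 b] show ?thesis by (simp add: norm_Basis)
qed

text \<open>\<open>S ^^ n\<close> is adjoint to \<open>A ^^ n\<close>. Writing the square of the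
  left side as an inner product with \<open>v\<close> and cancelling one factor passes the bound on
  with the same constants.\<close>

lemma S_bound: "norm ((S ^^ n) v) \<le> C * r ^ n * norm v"
proof -
  have "(A ^^ n) x \<bullet> y = x \<bullet> (S ^^ n) y" for x y
    by (induction n arbitrary: y) (simp_all add: adj funpow_swap1[of S])
  then have "(norm ((S ^^ n) v))\<^sup>2 = (A ^^ n) ((S ^^ n) v) \<bullet> v"
    by (simp add: power2_norm_eq_inner)
  also have "\<dots> \<le> norm ((A ^^ n) ((S ^^ n) v)) * norm v"
    by (rule norm_cauchy_schwarz)
  also have "\<dots> \<le> C * r ^ n * norm ((S ^^ n) v) * norm v"
    by (intro mult_right_mono bound) auto
  finally have "norm ((S ^^ n) v) * norm ((S ^^ n) v) \<le> norm ((S ^^ n) v) * (C * r ^ n * norm v)"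
    by (simp add: power2_eq_square mult_ac)
  then show ?thesis
    using C_ge_1 r by (cases "norm ((S ^^ n) v) = 0") (auto simp: mult_le_cancel_left)
qed

lemma S_tendsto_0: "(\<lambda>n. (S ^^ n) v) \<longlonglongrightarrow> 0"
proof (rule Lim_null_comparison)
  show "(\<lambda>n. C * r ^ n * norm v) \<longlonglongrightarrow> 0"
    using r by (auto intro!: tendsto_eq_intros LIMSEQ_power_zero)
qed (auto intro!: always_eventually S_bound)

lemma ft_S_tendsto: "(\<lambda>n. ft ((S ^^ n) \<xi> + \<eta>)) \<longlonglongrightarrow> ft \<eta>"
proof (rule LIM_zero_cancel, rule Lim_null_comparison)
  show "(\<lambda>n. 2 * pi * K * norm ((S ^^ n) \<xi>)) \<longlonglongrightarrow> 0"
    by (intro tendsto_mult_right_zero tendsto_norm_zero S_tendsto_0)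
  show "\<forall>\<^sub>F n in sequentially. norm (ft ((S ^^ n) \<xi> + \<eta>) - ft \<eta>) \<le> 2 * pi * K * norm ((S ^^ n) \<xi>)"
    using ft_lipschitz[of "(S ^^ _) \<xi> + \<eta>" \<eta>] by simp
qed

text \<open>In \<open>ft_ftn\<close> the remaining factor \<open>ft ((S ^^ n) \<xi>)\<close> tends
  to \<open>ft 0 = 1\<close>, while \<open>ftn\<close> stays bounded by one.\<close>

lemma ftn_tendsto: "(\<lambda>n. ftn n \<xi>) \<longlonglongrightarrow> ft \<xi>"
proof -
  have "(\<lambda>n. ftn n \<xi> * (ft ((S ^^ n) \<xi> + 0) - 1)) \<longlonglongrightarrow> 0"
  proof (rule Lim_null_comparison)
    show "(\<lambda>n. norm (ft ((S ^^ n) \<xi> + 0) - 1)) \<longlonglongrightarrow> 0"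
      using tendsto_norm[OF tendsto_diff[OF ft_S_tendsto[of \<xi> 0] tendsto_const[of 1]]] by simp
    show "\<forall>\<^sub>F n in sequentially. norm (ftn n \<xi> * (ft ((S ^^ n) \<xi> + 0) - 1)) \<le> norm (ft ((S ^^ n) \<xi> + 0) - 1)"
      by (auto simp: norm_mult norm_ftn_le intro!: mult_left_le_one_le always_eventually)
  qed
  from tendsto_diff[OF tendsto_const[of "ft \<xi>"] this]
  show ?thesis by (simp add: right_diff_distrib ft_ftn[symmetric])
qed

text \<open>The mask has modulus at most one. Hence a lower bound reached at one level persists at
  all later levels.\<close>

lemma norm_ft_S_mono: "norm (ft \<xi>) \<le> norm (ft (S \<xi>))"
  by (subst ft_step) (auto simp: norm_mult norm_mask_le intro: mult_left_le_one_le)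

text \<open>Large elements come from translating by \<open>(T ^^ n) k\<close>, where \<open>ft k \<noteq> 0\<close>: for large \<open>n\<close> this multiplies
  the modulus of \<open>ft\<close> by at least a number close to \<open>|ft k|\<close>.\<close>

lemma large_translates:
  assumes \<delta>0: "\<And>\<xi>. \<exists>k\<in>Z. \<delta> \<le> norm (ft (\<xi> + k))" "\<delta> > 0"
    and k: "k \<in> Z" "k \<noteq> 0" "ft k \<noteq> 0"
  shows "\<exists>k'\<in>Z. \<delta> * norm (ft k) / 2 \<le> norm (ft (\<xi> + k')) \<and> M \<le> norm (\<xi> + k')"
proof -
  obtain k0 where k0: "k0 \<in> Z" "\<delta> \<le> norm (ft (\<xi> + k0))"
    using \<delta>0(1) by blast
  define \<eta> where "\<eta> = \<xi> + k0"
  have pos: "norm (ft k) > 0" using k by simp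
  have "(\<lambda>n. norm (ft ((S ^^ n) \<eta> + k))) \<longlonglongrightarrow> norm (ft k)"
    by (intro tendsto_norm ft_S_tendsto)
  then have ev1: "eventually (\<lambda>n. norm (ft k) / 2 < norm (ft ((S ^^ n) \<eta> + k))) sequentially"
    using pos by (intro order_tendstoD(1)) auto
  have "(\<lambda>n. C * r ^ n * (M + norm \<eta>)) \<longlonglongrightarrow> 0"
    using r by (auto intro!: tendsto_eq_intros LIMSEQ_power_zero)
  then have ev2: "eventually (\<lambda>n. C * r ^ n * (M + norm \<eta>) < norm k) sequentially"
    using k by (intro order_tendstoD(2)) auto
  obtain n where n: "norm (ft k) / 2 < norm (ft ((S ^^ n) \<eta> + k))" "C * r ^ n * (M + norm \<eta>) < norm k"
    using eventually_happens[OF eventually_conj[OF ev1 ev2]] by auto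
  define x where "x = \<eta> + (T ^^ n) k"
  have Sx: "(S ^^ n) x = (S ^^ n) \<eta> + k"
    by (simp add: x_def linear_add[OF linear_funpow_S] funpow_S_T)
  have "norm (ft \<eta>) \<le> norm (ftn n \<eta>)"
    by (subst ft_ftn[of _ n]) (auto simp: norm_mult norm_ft_le intro: mult_right_le_one_le)
  then have "\<delta> * (norm (ft k) / 2) \<le> norm (ftn n \<eta>) * norm (ft ((S ^^ n) \<eta> + k))"
    using k0 n \<delta>0 by (intro mult_mono) (auto simp: \<eta>_def)
  also have "\<dots> = norm (ft x)"
    using ftn_periodic[OF k(1), of n \<eta>] ft_ftn[of x n] Sx by (simp add: norm_mult x_def)
  finally have low: "\<delta> * norm (ft k) / 2 \<le> norm (ft x)" by simp
  \<comment> \<open>Because \<open>S ^^ n\<close> contracts, the preimage \<open>(T ^^ n) k\<close>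
    of the fixed nonzero vector \<open>k\<close> exceeds any prescribed norm for large
    \<open>n\<close>.\<close>
  have "C * r ^ n * (M + norm \<eta>) < norm ((S ^^ n) ((T ^^ n) k))"
    using n by (simp add: funpow_S_T)
  also have "\<dots> \<le> C * r ^ n * norm ((T ^^ n) k)" by (rule S_bound)
  finally have "M + norm \<eta> < norm ((T ^^ n) k)"
    using C_ge_1 r by (simp add: mult_less_cancel_left)
  then have "M \<le> norm x"
    using norm_triangle_ineq4[of x \<eta>] by (simp add: x_def)
  moreover have "x = \<xi> + (k0 + (T ^^ n) k)" by (simp add: x_def \<eta>_def add_ac)
  ultimately show ?thesis using low k0 k by (metis Z_add funpow_T_Z)
qed

end

section \<open>Construction of the frequencies\<close>

locale hadamard_self_affine = self_affine A B C r S T Z \<mu> K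
  for A :: "'a::euclidean_space \<Rightarrow> 'a" and B C r S T Z \<mu> K +
  fixes l :: "nat \<Rightarrow> 'a" and \<delta> :: real
  assumes l_Z: "a < q \<Longrightarrow> l a \<in> Z" and l_0: "l 0 = 0"
    and hadamard: "(\<Sum>a<q. (norm (mask (\<xi> + S (l a))))\<^sup>2) = 1"
    and \<delta>: "0 < \<delta>" "\<delta> \<le> 1"
    and translates: "\<exists>k\<in>Z. \<delta> \<le> norm (ft (\<xi> + k)) \<and> M \<le> norm (\<xi> + k)"
begin

text \<open>The assumption \<open>translates\<close> at the point \<open>(S ^^ n) \<rho>\<close>,
  pulled back by \<open>T ^^ n\<close>; this is the single step of the construction.\<close>

lemma scaled_translates: "\<exists>k\<in>Z. \<delta> \<le> norm (ft ((S ^^ n) (\<rho> + (T ^^ n) k))) \<and> M \<le> norm (\<rho> + (T ^^ n) k)"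
proof -
  \<comment> \<open>\<open>S ^^ n\<close> enlarges norms by at most the factor \<open>C\<close>, so
    size \<open>C * \<bar>M\<bar>\<close> after it ensures size \<open>M\<close> before it.\<close>
  obtain k where k: "k \<in> Z" "\<delta> \<le> norm (ft ((S ^^ n) \<rho> + k))" "C * \<bar>M\<bar> \<le> norm ((S ^^ n) \<rho> + k)"
    using translates by blast
  have eq: "(S ^^ n) (\<rho> + (T ^^ n) k) = (S ^^ n) \<rho> + k"
    by (simp add: linear_add[OF linear_funpow_S] funpow_S_T)
  have "C * \<bar>M\<bar> \<le> C * r ^ n * norm (\<rho> + (T ^^ n) k)"
    using k(3) S_bound[of n "\<rho> + (T ^^ n) k"] by (simp add: eq)
  also have "\<dots> \<le> C * 1 * norm (\<rho> + (T ^^ n) k)"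
    using C_ge_1 r by (intro mult_right_mono mult_left_mono power_le_one) auto
  finally have "M \<le> norm (\<rho> + (T ^^ n) k)"
    using C_ge_1 by (simp add: mult_le_cancel_left)
  then show ?thesis using k eq by (intro bexI[of _ k]) simp_all
qed

text \<open>A frequency whose index has leading digit \<open>a\<close> at position \<open>n\<close> in base \<open>q\<close> prolongs the frequency
  of the remaining digits by \<open>(T ^^ n) (l a)\<close>, up to an element of \<open>(T ^^ Suc n) Z\<close>.\<close>

definition digit_sequence :: "real \<Rightarrow> (nat \<Rightarrow> 'a) \<Rightarrow> bool" where
  "digit_sequence b s \<longleftrightarrow> s 0 = 0 \<and>
     (\<forall>n a N. 1 \<le> a \<longrightarrow> a < q \<longrightarrow> N < q ^ n \<longrightarrow>
        (\<exists>k\<in>Z. s (a * q ^ n + N) = s N + (T ^^ n) (l a) + (T ^^ Suc n) k) \<and>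
        \<delta> \<le> norm (ft ((S ^^ Suc n) (s (a * q ^ n + N))))) \<and>
     (2 \<le> q \<longrightarrow> (\<forall>N\<ge>1. b \<le> norm (s N) \<and> b * norm (s (N - 1)) \<le> norm (s N)))"

text \<open>Recursive choice: \<open>N\<close> determines its leading position \<open>n\<close>, its
  remaining digits form an earlier index, and \<open>scaled_translates\<close> supplies a lattice
  vector that meets both the lower bound on \<open>ft\<close> and the growth over the previous
  frequency.\<close>

lemma digit_sequence_exists: "\<exists>s. digit_sequence b s"
proof -
  \<comment> \<open>\<open>P f N r\<close> admits \<open>r\<close> as the value at \<open>N\<close>
    after the values \<open>f\<close>. It consults \<open>f\<close> only at
    \<open>N mod q ^ n\<close> and \<open>N - 1\<close>, both below \<open>N\<close>, and for
    \<open>q = 1\<close> it leaves positive \<open>N\<close> unconstrained.\<close>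
  define P where "P f N r \<longleftrightarrow> (N = 0 \<longrightarrow> r = 0) \<and> (1 \<le> N \<longrightarrow> 2 \<le> q \<longrightarrow>
      (\<forall>n. q ^ n \<le> N \<longrightarrow> N < q ^ Suc n \<longrightarrow>
        (\<exists>k\<in>Z. r = f (N mod q ^ n) + (T ^^ n) (l (N div q ^ n)) + (T ^^ Suc n) k) \<and>
        \<delta> \<le> norm (ft ((S ^^ Suc n) r))) \<and>
      b \<le> norm r \<and> b * norm (f (N - 1)) \<le> norm r)" for f :: "nat \<Rightarrow> 'a" and N r
  have "\<exists>s. \<forall>N. P s N (s N)"
  proof (rule dependent_wellorder_choice)
    fix r f g and N :: nat assume fg: "\<And>y. y < N \<Longrightarrow> f y = (g y :: 'a)"
    have "f (N mod q ^ n) = g (N mod q ^ n)" if "q ^ n \<le> N" for n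
      using q_pos that by (intro fg less_le_trans[OF mod_less_divisor]) auto
    moreover have "f (N - 1) = g (N - 1)" if "1 \<le> N" using that by (intro fg) auto
    ultimately show "P f N r = P g N r" unfolding P_def by (metis (no_types, lifting))
  next
    fix N :: nat and f :: "nat \<Rightarrow> 'a"
    show "\<exists>r. P f N r"
    proof (cases "1 \<le> N \<and> 2 \<le> q")
      case True
      then obtain n where n: "q ^ n \<le> N" "N < q ^ (n + 1)"
        using ex_power_ivl1[of q N] by auto
      obtain k where k: "k \<in> Z"
        "\<delta> \<le> norm (ft ((S ^^ Suc n) (f (N mod q ^ n) + (T ^^ n) (l (N div q ^ n)) + (T ^^ Suc n) k)))"
        "max b (b * norm (f (N - 1))) \<le> norm (f (N mod q ^ n) + (T ^^ n) (l (N div q ^ n)) + (T ^^ Suc n) k)"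
        using scaled_translates by blast
      \<comment> \<open>\<open>P\<close> quantifies over all positions, so the position found must
        be the only one.\<close>
      have "m = n" if m: "q ^ m \<le> N" "N < q ^ Suc m" for m
      proof -
        have "1 < q" using True by simp
        moreover have "q ^ m < q ^ Suc n" "q ^ n < q ^ Suc m" using n m by auto
        ultimately have "m < Suc n" "n < Suc m" by (blast intro: power_less_imp_less_exp)+
        then show ?thesis by simp
      qed
      then have "P f N (f (N mod q ^ n) + (T ^^ n) (l (N div q ^ n)) + (T ^^ Suc n) k)"
        unfolding P_def using True k by auto
      then show ?thesis by blast
    qed (auto simp: P_def)
  qed
  then obtain s where s: "\<And>N. P s N (s N)" by blast
  have "digit_sequence b s"
    unfolding digit_sequence_def
  proof (intro conjI allI impI)
    show "s 0 = 0" using s[of 0] by (simp add: P_def)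
    show "b \<le> norm (s N)" "b * norm (s (N - 1)) \<le> norm (s N)" if "2 \<le> q" "1 \<le> N" for N
      using s[of N] that by (auto simp: P_def)
    fix n a N assume a: "1 \<le> a" "a < q" and N: "N < q ^ n"
    define M where "M = a * q ^ n + N"
    have qn: "q ^ n > 0" using q_pos by simp
    have "q ^ n \<le> M" using a by (simp add: M_def trans_le_add1)
    moreover have "M < q ^ Suc n"
    proof -
      have "M < (a + 1) * q ^ n" using N by (simp add: M_def)
      also have "\<dots> \<le> q * q ^ n" using a by (intro mult_right_mono) auto
      finally show ?thesis by simp
    qed
    moreover have "M mod q ^ n = N" "M div q ^ n = a" using N qn by (simp_all add: M_def)
    moreover have "1 \<le> M" "2 \<le> q" using a \<open>q ^ n \<le> M\<close> qn by linarith+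
    ultimately have "(\<exists>k\<in>Z. s M = s N + (T ^^ n) (l a) + (T ^^ Suc n) k) \<and> \<delta> \<le> norm (ft ((S ^^ Suc n) (s M)))"
      using s[of M] unfolding P_def by auto
    then show "\<exists>k\<in>Z. s (a * q ^ n + N) = s N + (T ^^ n) (l a) + (T ^^ Suc n) k"
      "\<delta> \<le> norm (ft ((S ^^ Suc n) (s (a * q ^ n + N))))"
      by (auto simp: M_def)
  qed
  then show ?thesis by blast
qed

text \<open>The indices are all natural numbers if \<open>q \<ge> 2\<close>, but only 0 if
  \<open>q = 1\<close>.\<close>

definition frequencies :: "(nat \<Rightarrow> 'a) \<Rightarrow> 'a set" where "frequencies s = s ` (\<Union>n. {..<q ^ n})"

section \<open>Orthonormality and completeness of the frequencies\<close>

context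
  fixes b s assumes s: "digit_sequence b s"
begin

lemma s_0: "s 0 = 0" using s by (simp add: digit_sequence_def)

text \<open>If the digit at the top position is nonzero, the bound is part of the construction;
  otherwise it is inherited from the previous level by \<open>norm_ft_S_mono\<close>.\<close>

lemma ft_lower_bound: "N < q ^ n \<Longrightarrow> \<delta> \<le> norm (ft ((S ^^ n) (s N)))"
proof (induction n arbitrary: N)
  case 0
  then show ?case using \<delta> by (simp add: s_0)
next
  case (Suc n)
  show ?case
  proof (cases "N < q ^ n")
    case True
    from Suc.IH[OF this] norm_ft_S_mono[of "(S ^^ n) (s N)"] show ?thesis by simp
  next
    case False
    have qn: "q ^ n > 0" using q_pos by simp
    have "1 \<le> N div q ^ n" using False qn by (simp add: Suc_le_eq div_greater_zero_iff)
    moreover have "N div q ^ n < q" using Suc.prems qn by (simp add: less_mult_imp_div_less)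
    moreover have "N mod q ^ n < q ^ n" using qn by simp
    ultimately have "\<delta> \<le> norm (ft ((S ^^ Suc n) (s (N div q ^ n * q ^ n + N mod q ^ n))))"
      using s unfolding digit_sequence_def by blast
    then show ?thesis by (simp only: div_mult_mod_eq)
  qed
qed

text \<open>A new leading digit \<open>a\<close> leaves the first \<open>n\<close> factors unchanged
  by periodicity, and in the new factor it shifts the argument of the mask by
  \<open>S (l a)\<close>; over all digits the squares of this factor sum to one by
  \<open>hadamard\<close>.\<close>

lemma ftn_sum: "(\<Sum>N<q ^ n. (norm (ftn n (\<xi> + s N)))\<^sup>2) = 1"
proof (induction n)
  case 0
  then show ?case by (simp add: ftn_def)
next
  case (Suc n)
  have step: "(norm (ftn (Suc n) (\<xi> + s (a * q ^ n + N))))\<^sup>2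
      = (norm (ftn n (\<xi> + s N)))\<^sup>2 * (norm (mask ((S ^^ Suc n) (\<xi> + s N) + S (l a))))\<^sup>2"
    if N: "N < q ^ n" and a: "a < q" for N a
  proof -
    obtain k where k: "k \<in> Z" "s (a * q ^ n + N) = s N + (T ^^ n) (l a) + (T ^^ Suc n) k"
      "l a \<in> Z"
    \<comment> \<open>The digit zero reproduces the index \<open>N\<close>, which fits the same
      formula with \<open>k = 0\<close> because \<open>l 0 = 0\<close>.\<close>
    proof (cases "a = 0")
      case True
      show ?thesis
        by (rule that[of 0]) (use l_Z[OF q_pos] True in \<open>auto simp: l_0 linear_0[OF linear_funpow_T] linear_0[OF linT]\<close>)
    next
      case False
      then show ?thesis using s N a that l_Z[OF a] unfolding digit_sequence_def
        by (metis One_nat_def Suc_leI neq0_conv)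
    qed
    have "s (a * q ^ n + N) = s N + (T ^^ n) (l a + T k)"
      using k by (simp add: linear_add[OF linear_funpow_T] funpow_swap1)
    then have "ftn n (\<xi> + s (a * q ^ n + N)) = ftn n (\<xi> + s N)"
      using ftn_periodic[of "l a + T k" n "\<xi> + s N"] k by (simp add: Z_add T_Z add_ac)
    moreover have "(S ^^ Suc n) ((T ^^ n) (l a)) = S (l a)"
      by (simp add: funpow_S_T)
    then have "(S ^^ Suc n) (\<xi> + s (a * q ^ n + N)) = ((S ^^ Suc n) (\<xi> + s N) + S (l a)) + k"
      unfolding k(2) by (simp only: linear_add[OF linear_funpow_S] funpow_S_T add_ac)
    then have "mask ((S ^^ Suc n) (\<xi> + s (a * q ^ n + N))) = mask ((S ^^ Suc n) (\<xi> + s N) + S (l a))"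
      using mask_periodic[OF k(1)] by simp
    ultimately show ?thesis
      by (simp add: ftn_Suc norm_mult power_mult_distrib)
  qed
  have "(\<Sum>N<q ^ Suc n. (norm (ftn (Suc n) (\<xi> + s N)))\<^sup>2)
      = (\<Sum>N<q ^ n. \<Sum>a<q. (norm (ftn (Suc n) (\<xi> + s (a * q ^ n + N))))\<^sup>2)"
    unfolding power_Suc by (rule sum_nat_digits)
  also have "\<dots> = (\<Sum>N<q ^ n. (norm (ftn n (\<xi> + s N)))\<^sup>2 * (\<Sum>a<q. (norm (mask ((S ^^ Suc n) (\<xi> + s N) + S (l a))))\<^sup>2))"
    by (simp add: step sum_distrib_left del: funpow.simps)
  also have "\<dots> = 1" using Suc.IH by (simp add: hadamard del: funpow.simps)
  finally show ?case .
qed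

lemma norm_ft_le_ftn: "norm (ft \<xi>) \<le> norm (ftn n \<xi>)"
  by (subst ft_ftn[of _ n]) (auto simp: norm_mult norm_ft_le intro: mult_right_le_one_le)

text \<open>At \<open>\<xi> = - s N\<close> the index \<open>N\<close> alone contributes
  \<open>ftn n 0 = 1\<close> to a sum of squares equal to one. All other terms vanish, and
  \<open>ft\<close> is dominated by \<open>ftn\<close>.\<close>

lemma ft_orthogonal:
  assumes "M < q ^ n" "N < q ^ n" "M \<noteq> N"
  shows "ft (s M - s N) = 0"
proof -
  have "1 = (\<Sum>N'<q ^ n. (norm (ftn n (- s N + s N')))\<^sup>2)" by (rule ftn_sum[symmetric])
  also have "\<dots> = (norm (ftn n 0))\<^sup>2 + (\<Sum>N'\<in>{..<q ^ n} - {N}. (norm (ftn n (- s N + s N')))\<^sup>2)"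
    using assms by (subst sum.remove[of _ N]) auto
  also have "ftn n 0 = 1"
    using ft_ftn[of 0 n] by (simp add: linear_0[OF linear_funpow_S])
  finally have "(\<Sum>N'\<in>{..<q ^ n} - {N}. (norm (ftn n (- s N + s N')))\<^sup>2) = 0" by simp
  then have "ftn n (- s N + s M) = 0"
    using assms by (subst (asm) sum_nonneg_eq_0_iff) auto
  then show ?thesis using norm_ft_le_ftn[of "s M - s N" n] by (simp add: algebra_simps)
qed

lemma bessel: "(\<Sum>N<q ^ n. (norm (ft (\<xi> + s N)))\<^sup>2) \<le> 1"
proof -
  have "(\<Sum>N<q ^ n. (norm (ft (\<xi> + s N)))\<^sup>2) \<le> (\<Sum>N<q ^ n. (norm (ftn n (\<xi> + s N)))\<^sup>2)"
    by (intro sum_mono power_mono norm_ft_le_ftn) auto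
  then show ?thesis using ftn_sum by simp
qed

text \<open>The total mass of \<open>ftn n\<close> is one at every level; the lower bound on \<open>ft\<close> dominates the tails of
  these sums by tails of the sum for \<open>ft\<close>, so no mass is lost in the limit.\<close>

lemma parseval:
  assumes "\<epsilon> > 0"
  shows "\<exists>n. 1 - \<epsilon> < (\<Sum>N<q ^ n. (norm (ft (\<xi> + s N)))\<^sup>2)"
proof -
  define t where "t N = (norm (ft (\<xi> + s N)))\<^sup>2" for N
  define U where "U n = (\<Sum>N<q ^ n. t N)" for n
  \<comment> \<open>Chosen so that the tail bound \<open>\<eta> / (\<delta> / 2)\<^sup>2\<close>
    equals \<open>\<epsilon> / 4\<close>.\<close>
  define \<eta> where "\<eta> = \<epsilon> * (\<delta> / 2)\<^sup>2 / 4"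
  have \<eta>: "\<eta> > 0" using assms \<delta> by (simp add: \<eta>_def)
  have q1: "1 \<le> q" using q_pos by simp
  have U_mono: "U m \<le> U n" if "m \<le> n" for m n
    unfolding U_def using power_increasing[OF that q1] by (intro sum_mono2) (auto simp: t_def)
  have "U n \<le> 1" for n using bessel by (simp add: U_def t_def)
  then have "convergent U"
    using U_mono by (intro Bseq_mono_convergent) (auto simp: Bseq_def U_def t_def intro!: exI[of _ 1] simp: sum_nonneg)
  then have "Cauchy U" by (rule convergent_Cauchy)
  then obtain m where m: "\<And>n. m \<le> n \<Longrightarrow> \<bar>U n - U m\<bar> < \<eta>"
    using \<eta> unfolding Cauchy_def dist_real_def by (metis order_refl)
  have "(\<lambda>n. \<Sum>N<q ^ m. (norm (ftn n (\<xi> + s N)))\<^sup>2) \<longlonglongrightarrow> U m"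
    unfolding U_def t_def by (intro tendsto_sum tendsto_power tendsto_norm ftn_tendsto)
  then have ev1: "eventually (\<lambda>n. (\<Sum>N<q ^ m. (norm (ftn n (\<xi> + s N)))\<^sup>2) < U m + \<epsilon> / 2) sequentially"
    using assms by (intro order_tendstoD(2)) auto
  have "(\<lambda>n. 2 * pi * K * norm ((S ^^ n) \<xi>)) \<longlonglongrightarrow> 0"
    by (intro tendsto_mult_right_zero tendsto_norm_zero S_tendsto_0)
  then have ev2: "eventually (\<lambda>n. 2 * pi * K * norm ((S ^^ n) \<xi>) < \<delta> / 2) sequentially"
    using \<delta> by (intro order_tendstoD(2)) auto
  \<comment> \<open>With \<open>m\<close> fixed, \<open>n\<close> is so large that the head of the
    level \<open>n\<close> sum is close to its limit \<open>U m\<close>, and that the shift by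
    \<open>(S ^^ n) \<xi>\<close> costs at most half of the lower bound
    \<open>\<delta>\<close>.\<close>
  obtain n where n: "m \<le> n" "(\<Sum>N<q ^ m. (norm (ftn n (\<xi> + s N)))\<^sup>2) < U m + \<epsilon> / 2"
      "2 * pi * K * norm ((S ^^ n) \<xi>) < \<delta> / 2"
    using eventually_happens[OF eventually_conj[OF eventually_ge_at_top[of m] eventually_conj[OF ev1 ev2]]] by auto
  have dom: "(norm (ftn n (\<xi> + s N)))\<^sup>2 \<le> t N / (\<delta> / 2)\<^sup>2" if "N < q ^ n" for N
  proof -
    have "norm (ft ((S ^^ n) (s N)) - ft ((S ^^ n) (\<xi> + s N))) \<le> 2 * pi * K * norm ((S ^^ n) \<xi>)"
      using ft_lipschitz[of "(S ^^ n) (s N)" "(S ^^ n) (\<xi> + s N)"] by (simp add: linear_add[OF linear_funpow_S])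
    then have "\<delta> / 2 \<le> norm (ft ((S ^^ n) (\<xi> + s N)))"
      using ft_lower_bound[OF that] n(3) norm_triangle_ineq2[of "ft ((S ^^ n) (s N))" "ft ((S ^^ n) (\<xi> + s N))"]
      by linarith
    then have "norm (ftn n (\<xi> + s N)) * (\<delta> / 2) \<le> norm (ft (\<xi> + s N))"
      unfolding ft_ftn[of "\<xi> + s N" n] norm_mult by (intro mult_left_mono) auto
    then have "(norm (ftn n (\<xi> + s N)) * (\<delta> / 2))\<^sup>2 \<le> t N"
      unfolding t_def using \<delta> by (intro power_mono) auto
    then have "(norm (ftn n (\<xi> + s N)))\<^sup>2 * (\<delta> / 2)\<^sup>2 \<le> t N"
      by (simp only: power_mult_distrib)
    then show ?thesis using \<delta> by (subst pos_le_divide_eq) auto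
  qed
  have mn: "q ^ m \<le> q ^ n" using power_increasing[OF n(1) q1] .
  then have split: "{..<q ^ n} = {..<q ^ m} \<union> {q ^ m..<q ^ n}" by auto
  have "1 = (\<Sum>N<q ^ n. (norm (ftn n (\<xi> + s N)))\<^sup>2)" by (rule ftn_sum[symmetric])
  also have "\<dots> = (\<Sum>N<q ^ m. (norm (ftn n (\<xi> + s N)))\<^sup>2) + (\<Sum>N=q ^ m..<q ^ n. (norm (ftn n (\<xi> + s N)))\<^sup>2)"
    unfolding split by (rule sum.union_disjoint) auto
  also have "(\<Sum>N=q ^ m..<q ^ n. (norm (ftn n (\<xi> + s N)))\<^sup>2) \<le> (\<Sum>N=q ^ m..<q ^ n. t N / (\<delta> / 2)\<^sup>2)"
    by (intro sum_mono dom) auto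
  also have "\<dots> = (U n - U m) / (\<delta> / 2)\<^sup>2"
    unfolding U_def split using mn
    by (subst sum.union_disjoint) (auto simp: sum_divide_distrib)
  also have "\<dots> \<le> \<eta> / (\<delta> / 2)\<^sup>2"
    using m[OF n(1)] by (intro divide_right_mono) auto
  also have "\<dots> = \<epsilon> / 4" using \<delta> by (simp add: \<eta>_def)
  finally have "1 - \<epsilon> < U m" using n(2) assms by linarith
  then show ?thesis unfolding U_def t_def by blast
qed

lemma expo_inner: "(\<integral>x. expo \<xi> x * cnj (expo \<eta> x) \<partial>\<mu>) = ft (\<eta> - \<xi>)"
  unfolding ft_def expo_uminus(1)[symmetric] expo_add[symmetric] by simp

lemma expo_L2: "expo \<xi> \<in> L2 \<mu>"
  by (rule L2_bounded[where K = 1]) (auto simp: finite_measure_axioms)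

text \<open>Equal values at distinct indices would give \<open>ft 0 = 0\<close> by
  orthogonality.\<close>

lemma inj_s: "inj_on s (\<Union>n. {..<q ^ n})"
proof (rule inj_onI, rule ccontr)
  fix M N assume "M \<in> (\<Union>n. {..<q ^ n})" "N \<in> (\<Union>n. {..<q ^ n})" and eq: "s M = s N" "M \<noteq> N"
  then obtain i j where ij: "M < q ^ i" "N < q ^ j" by auto
  have "q ^ i \<le> q ^ max i j" "q ^ j \<le> q ^ max i j" using q_pos by (auto intro!: power_increasing)
  then have "M < q ^ max i j" "N < q ^ max i j" using ij by linarith+
  from ft_orthogonal[OF this eq(2)] eq(1) show False by simp
qed

lemma expo_orthonormal:
  assumes "\<xi> \<in> (frequencies s)" "\<eta> \<in> (frequencies s)"
  shows "(\<integral>x. expo \<xi> x * cnj (expo \<eta> x) \<partial>\<mu>) = (if \<xi> = \<eta> then 1 else 0)"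
proof -
  obtain M N i j where ij: "\<xi> = s M" "\<eta> = s N" "M < q ^ i" "N < q ^ j"
    using assms by (auto simp: frequencies_def)
  have "q ^ i \<le> q ^ max i j" "q ^ j \<le> q ^ max i j" using q_pos by (auto intro!: power_increasing)
  then have "M < q ^ max i j" "N < q ^ max i j" using ij by linarith+
  then have "ft (s N - s M) = 0" if "M \<noteq> N"
    using ft_orthogonal that by blast
  then show ?thesis unfolding expo_inner ij by auto
qed

text \<open>Pythagoras: \<open>ft (\<eta> - \<xi>)\<close> is the Fourier coefficient of
  \<open>expo \<xi>\<close> along \<open>expo \<eta>\<close>, so the sum is the orthogonal
  projection onto the span of \<open>F\<close>.\<close>

lemma sq_norm_projection:
  assumes F: "finite F" "F \<subseteq> (frequencies s)"
  shows "sq_norm \<mu> (\<lambda>x. expo \<xi> x - (\<Sum>\<eta>\<in>F. ft (\<eta> - \<xi>) * expo \<eta> x)) = 1 - (\<Sum>\<eta>\<in>F. (norm (ft (\<eta> - \<xi>)))\<^sup>2)"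
proof -
  define c where "c \<eta> = ft (\<eta> - \<xi>)" for \<eta>
  define g where "g x = (\<Sum>\<eta>\<in>F. c \<eta> * expo \<eta> x)" for x
  have int: "integrable \<mu> (\<lambda>x. expo \<eta> x * cnj (expo \<zeta> x))" for \<eta> \<zeta>
    unfolding expo_uminus(1)[symmetric] expo_add[symmetric] by simp
  have cn: "ft (\<xi> - \<eta>) = cnj (c \<eta>)" for \<eta>
    using Bochner_Integration.integral_cnj[of \<mu> "expo (\<xi> - \<eta>)"]
    by (simp add: c_def ft_def expo_uminus(1)[symmetric])
  have pt: "complex_of_real ((norm (expo \<xi> x - g x))\<^sup>2)
    = expo \<xi> x * cnj (expo \<xi> x) - (\<Sum>\<eta>\<in>F. cnj (c \<eta>) * (expo \<xi> x * cnj (expo \<eta> x)))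
      - (\<Sum>\<eta>\<in>F. c \<eta> * (expo \<eta> x * cnj (expo \<xi> x)))
      + (\<Sum>\<eta>\<in>F. \<Sum>\<zeta>\<in>F. c \<eta> * cnj (c \<zeta>) * (expo \<eta> x * cnj (expo \<zeta> x)))" for x
  proof -
    have "complex_of_real ((norm (expo \<xi> x - g x))\<^sup>2) = (expo \<xi> x - g x) * cnj (expo \<xi> x - g x)"
      by (rule complex_norm_square)
    also have "\<dots> = expo \<xi> x * cnj (expo \<xi> x) - expo \<xi> x * cnj (g x) - g x * cnj (expo \<xi> x) + g x * cnj (g x)"
      by (simp add: algebra_simps)
    also have "expo \<xi> x * cnj (g x) = (\<Sum>\<eta>\<in>F. cnj (c \<eta>) * (expo \<xi> x * cnj (expo \<eta> x)))"
      by (simp add: g_def sum_distrib_left mult_ac)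
    also have "g x * cnj (expo \<xi> x) = (\<Sum>\<eta>\<in>F. c \<eta> * (expo \<eta> x * cnj (expo \<xi> x)))"
      unfolding g_def sum_distrib_right by (simp add: mult_ac)
    also have "g x * cnj (g x) = (\<Sum>\<eta>\<in>F. \<Sum>\<zeta>\<in>F. c \<eta> * cnj (c \<zeta>) * (expo \<eta> x * cnj (expo \<zeta> x)))"
      by (simp add: g_def sum_product mult_ac)
    finally show ?thesis .
  qed
  have "complex_of_real (sq_norm \<mu> (\<lambda>x. expo \<xi> x - g x)) = (\<integral>x. complex_of_real ((norm (expo \<xi> x - g x))\<^sup>2) \<partial>\<mu>)"
    unfolding sq_norm_def by (rule integral_complex_of_real[symmetric])
  also have "\<dots> = ft 0 - (\<Sum>\<eta>\<in>F. cnj (c \<eta>) * ft (\<eta> - \<xi>)) - (\<Sum>\<eta>\<in>F. c \<eta> * ft (\<xi> - \<eta>))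
      + (\<Sum>\<eta>\<in>F. \<Sum>\<zeta>\<in>F. c \<eta> * cnj (c \<zeta>) * (\<integral>x. expo \<eta> x * cnj (expo \<zeta> x) \<partial>\<mu>))"
    unfolding pt by (simp add: int expo_inner)
  also have "(\<Sum>\<eta>\<in>F. \<Sum>\<zeta>\<in>F. c \<eta> * cnj (c \<zeta>) * (\<integral>x. expo \<eta> x * cnj (expo \<zeta> x) \<partial>\<mu>))
      = (\<Sum>\<eta>\<in>F. \<Sum>\<zeta>\<in>F. if \<eta> = \<zeta> then c \<eta> * cnj (c \<eta>) else 0)"
    by (intro sum.cong refl) (use F in \<open>auto simp: expo_orthonormal subset_iff\<close>)
  also have "\<dots> = (\<Sum>\<eta>\<in>F. c \<eta> * cnj (c \<eta>))"
    using F by simp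
  also have "ft 0 - (\<Sum>\<eta>\<in>F. cnj (c \<eta>) * ft (\<eta> - \<xi>)) - (\<Sum>\<eta>\<in>F. c \<eta> * ft (\<xi> - \<eta>)) + (\<Sum>\<eta>\<in>F. c \<eta> * cnj (c \<eta>))
      = complex_of_real (1 - (\<Sum>\<eta>\<in>F. (norm (c \<eta>))\<^sup>2))"
  proof -
    have "cnj (c \<eta>) * c \<eta> = of_real ((norm (c \<eta>))\<^sup>2)" "c \<eta> * cnj (c \<eta>) = of_real ((norm (c \<eta>))\<^sup>2)" for \<eta>
      by (simp_all only: complex_norm_square mult.commute)
    then show ?thesis unfolding cn by (simp add: c_def[symmetric])
  qed
  finally show ?thesis unfolding g_def c_def by (simp only: of_real_eq_iff)
qed

text \<open>\<open>parseval\<close> at \<open>- \<xi>\<close> makes the projection error of each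
  exponential arbitrarily small, and density of the exponentials extends this to all of L2.\<close>

lemma frequencies_basis: "L2_orthonormal_basis \<mu> (frequencies s) expo"
proof -
  interpret fam: L2_family \<mu> "frequencies s" expo
    by standard (rule expo_L2)
  interpret fam: exponential_family \<mu> "frequencies s" expo K
  proof
    show "borel_prob \<mu>" using \<mu> by (simp add: is_self_affine_def)
    show "AE x in \<mu>. norm x \<le> K" by (rule support)
    show "fam.approx (expo \<xi>)" for \<xi>
      unfolding approximable_def
    proof safe
      show "expo \<xi> \<in> L2 \<mu>" by (rule expo_L2)
      fix \<epsilon> :: real assume "\<epsilon> > 0"
      then obtain n where n: "1 - \<epsilon> < (\<Sum>N<q ^ n. (norm (ft (- \<xi> + s N)))\<^sup>2)"
        using parseval by blast
      define F where "F = s ` {..<q ^ n}"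
      have F: "finite F" "F \<subseteq> (frequencies s)" by (auto simp: F_def frequencies_def)
      have "inj_on s {..<q ^ n}" by (rule inj_on_subset[OF inj_s]) auto
      then have "(\<Sum>\<eta>\<in>F. (norm (ft (\<eta> - \<xi>)))\<^sup>2) = (\<Sum>N<q ^ n. (norm (ft (- \<xi> + s N)))\<^sup>2)"
        unfolding F_def by (simp add: sum.reindex)
      with n sq_norm_projection[OF F, of \<xi>]
      have "sq_norm \<mu> (\<lambda>x. expo \<xi> x - (\<Sum>\<eta>\<in>F. ft (\<eta> - \<xi>) * expo \<eta> x)) < \<epsilon>" by linarith
      moreover have "(\<lambda>x. \<Sum>\<eta>\<in>F. ft (\<eta> - \<xi>) * expo \<eta> x) \<in> linear_combinations (frequencies s) expo"
        using F by (intro linear_combinationsI[of F]) auto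
      ultimately show "\<exists>g\<in>linear_combinations (frequencies s) expo. sq_norm \<mu> (\<lambda>x. expo \<xi> x - g x) < \<epsilon>"
        by (rule bexI)
    qed
  qed
  show ?thesis
    unfolding L2_orthonormal_basis_def
  proof (intro conjI ballI allI impI)
    show "expo \<xi> \<in> L2 \<mu>" for \<xi> by (rule expo_L2)
    show "L2_inner \<mu> (expo \<xi>) (expo \<eta>) = (if \<xi> = \<eta> then 1 else 0)"
      if "\<xi> \<in> (frequencies s)" "\<eta> \<in> (frequencies s)" for \<xi> \<eta>
      unfolding L2_inner_def by (rule expo_orthonormal[OF that])
    fix f and \<epsilon> :: real assume "f \<in> L2 \<mu>" "\<epsilon> > 0"
    then obtain g where g: "g \<in> linear_combinations (frequencies s) expo" "sq_norm \<mu> (\<lambda>x. f x - g x) < \<epsilon>\<^sup>2"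
      using fam.approxE[OF fam.approx_all, of f "\<epsilon>\<^sup>2"] by auto
    then obtain F c where F: "g = (\<lambda>x. \<Sum>\<eta>\<in>F. c \<eta> * expo \<eta> x)" "finite F" "F \<subseteq> (frequencies s)"
      by (auto simp: linear_combinations_def)
    have "L2_norm \<mu> (\<lambda>x. f x - g x) < \<epsilon>"
      using g(2) \<open>\<epsilon> > 0\<close> unfolding L2_norm_def sq_norm_def by (intro real_less_lsqrt) auto
    then show "\<exists>F c. finite F \<and> F \<subseteq> (frequencies s) \<and> L2_norm \<mu> (\<lambda>x. f x - (\<Sum>\<eta>\<in>F. c \<eta> * expo \<eta> x)) < \<epsilon>"
      using F by blast
  qed
qed

end

end

section \<open>Expansive integer matrices and Hadamard triples\<close>

text \<open>The sum factors into one geometric sum per coordinate; at \<open>i0\<close> the ratio is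
  an \<open>N\<close>-th root of unity different from one.\<close>

lemma sum_expo_box:
  fixes w :: "real ^ 'n"
  assumes N: "\<And>i. real N * w $ i \<in> \<int>" and i0: "w $ i0 \<notin> \<int>"
  shows "(\<Sum>g\<in>PiE UNIV (\<lambda>_. {..<N}). expo w (\<chi> i. real (g i))) = 0"
proof -
  define z where "z i = exp (2 * of_real pi * \<i> * of_real (w $ i))" for i
  have "expo w (\<chi> i. real (g i)) = (\<Prod>i\<in>UNIV. z i ^ g i)" for g
  proof -
    have "expo w (\<chi> i. real (g i)) = exp (\<Sum>i\<in>UNIV. of_nat (g i) * (2 * of_real pi * \<i> * of_real (w $ i)))"
      by (simp add: expo_def inner_vec_def sum_distrib_left mult_ac)
    also have "\<dots> = (\<Prod>i\<in>UNIV. z i ^ g i)"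
      by (simp add: exp_sum exp_of_nat_mult z_def)
    finally show ?thesis .
  qed
  then have "(\<Sum>g\<in>PiE UNIV (\<lambda>_. {..<N}). expo w (\<chi> i. real (g i))) = (\<Prod>i\<in>UNIV. \<Sum>a<N. z i ^ a)"
    by (subst prod_sum_PiE) auto
  also have "\<dots> = 0"
  proof (rule prod_zero)
    have "z i0 \<noteq> 1"
      using i0 by (auto simp: z_def exp_eq_1)
    moreover have "z i0 ^ N = 1"
    proof -
      have "z i0 ^ N = exp (2 * of_real pi * \<i> * of_real (real N * w $ i0))"
        by (simp add: z_def mult_ac flip: exp_of_nat_mult)
      also have "\<dots> = 1" using N[of i0] by (auto simp: exp_eq_1 elim!: Ints_cases)
      finally show ?thesis .
    qed
    ultimately show "\<exists>i\<in>UNIV. (\<Sum>a<N. z i ^ a) = 0"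
      by (intro bexI[of _ i0]) (simp_all add: geometric_sum)
  qed simp
  finally show ?thesis .
qed

section \<open>The transposed action on the integer lattice\<close>

definition dual_apply :: "int ^ 'n ^ 'n \<Rightarrow> real ^ 'n \<Rightarrow> real ^ 'n" where
  "dual_apply R x = transpose (map_matrix real_of_int R) *v x"

definition dual_inv_apply :: "int ^ 'n ^ 'n \<Rightarrow> real ^ 'n \<Rightarrow> real ^ 'n" where
  "dual_inv_apply R x = transpose (matrix_inv (map_matrix real_of_int R)) *v x"

lemma dual_apply_inverse:
  assumes "expansive R"
  shows "dual_apply R (dual_inv_apply R x) = x" "dual_inv_apply R (dual_apply R x) = x"
proof -
  let ?M = "map_matrix real_of_int R"
  have "(?M ** matrix_inv ?M) *v y = y" "(matrix_inv ?M ** ?M) *v y = y" for y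
    using inv_apply_inverse[OF assms, of y] by (simp_all add: inv_apply_def matrix_vector_mul_assoc)
  then have "?M ** matrix_inv ?M = mat 1" "matrix_inv ?M ** ?M = mat 1"
    by (simp_all add: matrix_eq)
  then show "dual_apply R (dual_inv_apply R x) = x" "dual_inv_apply R (dual_apply R x) = x"
    unfolding dual_apply_def dual_inv_apply_def matrix_vector_mul_assoc matrix_transpose_mul[symmetric]
    by (simp_all only: transpose_mat matrix_vector_mul_lid)
qed

lemma inv_apply_adjoint: "inv_apply R x \<bullet> y = x \<bullet> dual_inv_apply R y"
  unfolding inv_apply_def dual_inv_apply_def transpose_matrix_vector
  by (metis dot_lmul_matrix inner_commute)

lemma dual_apply_real_vec: "dual_apply R (real_vec z) = real_vec (transpose R *v z)"
proof -
  have "transpose (map_matrix real_of_int R) = map_matrix real_of_int (transpose R)"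
    by (simp add: transpose_def map_matrix_def vec_eq_iff)
  then show ?thesis by (simp only: dual_apply_def real_vec_mult)
qed

lemma inner_real_vec: "real_vec x \<bullet> real_vec y \<in> \<int>"
  by (auto simp: inner_vec_def intro!: Ints_sum Ints_mult)

lemma inv_apply_diff:
  "inv_apply R (x - y) = inv_apply R x - inv_apply R y"
  by (simp add: inv_apply_def matrix_vector_mult_diff_distrib)

text \<open>Cramer's rule: the numerator is the determinant of an integer matrix.\<close>

lemma det_inv_apply_int:
  assumes "expansive R"
  shows "real_of_int (det R) * inv_apply R (real_vec z) $ k \<in> \<int>"
proof -
  let ?M = "map_matrix real_of_int R"
  have "inv_apply R (real_vec z) $ k = det (\<chi> i j. if j = k then real_vec z $ i else ?M $ i $ j) / det ?M"
    using iffD1[OF cramer[OF expansive_det_nonzero[OF assms]] inv_apply_inverse(1)[OF assms, of "real_vec z"]]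
    by (metis (no_types, lifting) vec_lambda_beta)
  moreover have "(\<chi> i j. if j = k then real_vec z $ i else ?M $ i $ j) = map_matrix real_of_int (\<chi> i j. if j = k then z $ i else R $ i $ j)"
    by (simp add: vec_eq_iff map_matrix_def)
  ultimately show ?thesis
    using expansive_det_nonzero[OF assms] by (simp add: det_map_matrix_of_int)
qed

section \<open>Self-affine measures with integer data\<close>

locale lattice_self_affine =
  self_affine "inv_apply R" "real_vec ` B" C r "dual_inv_apply R" "dual_apply R" "range real_vec" \<mu> K
  for R :: "int ^ 'n ^ 'n" and B C r \<mu> K +
  assumes expansive: "expansive R"
begin

text \<open>Uniqueness resolves the definite description to the constructed measure.\<close>

lemma self_affine_measure_eq: "self_affine_measure R B = \<mu>"
proof -
  have inj: "inj_on real_vec B" by (auto simp: inj_on_def)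
  have "(borel_prob \<nu> \<and> (\<forall>E \<in> sets borel. measure \<nu> E =
        1 / real (card B) * (\<Sum>b\<in>B. measure \<nu> (affine_map R b -` E)))) \<longleftrightarrow> is_self_affine (inv_apply R) (real_vec ` B) \<nu>" for \<nu>
    by (simp add: is_self_affine_def card_image[OF inj] sum.reindex[OF inj] affine_map_def[abs_def])
  then show ?thesis
    unfolding self_affine_measure_def using self_affine_unique \<mu> by (simp add: the_equality)
qed

lemma fourier_transform_eq: "fourier_transform \<mu> \<xi> = ft \<xi>"
  by (simp add: fourier_transform_def ft_def expo_def)

lemma expo_dual: "expo (- dual_inv_apply R x) b = expo (- inv_apply R b) x"
  using inv_apply_adjoint[of R b x] by (simp add: expo_def inner_commute)

text \<open>A character sum over an integer box. If \<open>ft\<close> vanishes at all nonzero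
  lattice points, the mask forces every term to be 0 or 1, with 1 at the origin. If no digit were
  congruent to \<open>z\<close>, expanding the mask would make the same sum zero.\<close>

lemma exists_residue:
  assumes ft: "\<And>k. k \<in> range real_vec \<Longrightarrow> k \<noteq> 0 \<Longrightarrow> ft k = 0"
    and nz: "\<And>\<xi>. \<exists>k\<in>range real_vec. ft (\<xi> + k) \<noteq> 0"
  shows "\<exists>b\<in>B. inv_apply R (real_vec (z - b)) \<in> range real_vec"
proof (rule ccontr)
  assume neg: "\<not> (\<exists>b\<in>B. inv_apply R (real_vec (z - b)) \<in> range real_vec)"
  \<comment> \<open>This side length clears the denominators of
    \<open>inv_apply R (real_vec (z - b))\<close>.\<close>
  define N where "N = nat \<bar>det R\<bar>"
  define G where "G = PiE (UNIV :: 'n set) (\<lambda>_. {..<N})"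
  define x where "x g = (\<chi> i. real (g i))" for g :: "'n \<Rightarrow> nat"
  have detR: "det R \<noteq> 0" using expansive_det_nonzero[OF expansive] by (simp add: det_map_matrix_of_int)
  have xZ: "x g \<in> range real_vec" for g
    by (rule range_eqI[of _ _ "\<chi> i. int (g i)"]) (simp add: x_def vec_eq_iff)
  \<comment> \<open>Some lattice translate \<open>k\<close> has
    \<open>ft (dual_inv_apply R l + k) \<noteq> 0\<close>; one step of the recursion makes
    \<open>ft\<close> nonzero at \<open>l + dual_apply R k\<close>, which must therefore be
    0.\<close>
  have mask: "dual_inv_apply R l \<in> range real_vec" if l: "l \<in> range real_vec" "mask (dual_inv_apply R l) \<noteq> 0" for l
  proof -
    obtain k where k: "k \<in> range real_vec" "ft (dual_inv_apply R l + k) \<noteq> 0" using nz by blast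
    have "dual_inv_apply R (l + dual_apply R k) = dual_inv_apply R l + k"
      by (simp add: linear_add[OF linS] ST)
    then have "ft (l + dual_apply R k) \<noteq> 0"
      using k l mask_periodic[OF k(1)] ft_step[of "l + dual_apply R k"] by simp
    moreover have "l + dual_apply R k \<in> range real_vec" using l k by (intro Z_add T_Z)
    ultimately have "l + dual_apply R k = 0" using ft by blast
    then have "dual_inv_apply R l + k = 0"
      using ST[of k] linear_add[OF linS, of l "dual_apply R k"] linear_0[OF linS] by simp
    moreover obtain k' where "k = real_vec k'" using k by auto
    ultimately have "dual_inv_apply R l = real_vec (- k')" by (simp add: eq_neg_iff_add_eq_0)
    then show ?thesis by blast
  qed
  define t where "t g = mask (dual_inv_apply R (x g)) * expo (inv_apply R (real_vec z)) (x g)" for g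
  have t01: "t g = 0 \<or> t g = 1" for g
  proof (cases "mask (dual_inv_apply R (x g)) = 0")
    case False
    from mask[OF xZ this] have S: "dual_inv_apply R (x g) \<in> range real_vec" .
    then have "mask (dual_inv_apply R (x g)) = 1" using mask_periodic[of _ 0] by simp
    moreover have "expo (inv_apply R (real_vec z)) (x g) = 1"
      using S inner_real_vec by (intro expo_int) (auto simp: inv_apply_adjoint)
    ultimately show ?thesis by (simp add: t_def)
  qed (simp add: t_def)
  have "(\<lambda>_. 0) \<in> G" using detR by (auto simp: G_def N_def)
  moreover have "t (\<lambda>_. 0) = 1"
  proof -
    have "x (\<lambda>_. 0) = 0" by (simp add: x_def vec_eq_iff)
    then show ?thesis by (simp add: t_def linear_0[OF linS])
  qed
  moreover have finG: "finite G" unfolding G_def by (intro finite_PiE) auto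
  ultimately have "Re (t (\<lambda>_. 0)) \<le> (\<Sum>g\<in>G. Re (t g))"
    using t01 by (intro member_le_sum) (metis order_refl zero_complex.sel(1) one_complex.sel(1) zero_le_one)+
  then have "(\<Sum>g\<in>G. t g) \<noteq> 0" using \<open>t (\<lambda>_. 0) = 1\<close> by (metis Re_sum not_one_le_zero one_complex.sel(1) zero_complex.sel(1))
  moreover have "(\<Sum>g\<in>G. t g) = 0"
  proof -
    \<comment> \<open>The term is an average of characters over the digits \<open>b\<close>; their
      frequencies \<open>inv_apply R (real_vec z - b)\<close> are not integral by assumption, so
      each sums to zero over the box.\<close>
    have "t g = (\<Sum>b\<in>real_vec ` B. expo (inv_apply R (real_vec z - b)) (x g)) / q" for g
      by (simp add: t_def mask_def expo_dual sum_distrib_right inv_apply_diff flip: expo_add)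
    then have "(\<Sum>g\<in>G. t g) = (\<Sum>b\<in>real_vec ` B. \<Sum>g\<in>G. expo (inv_apply R (real_vec z - b)) (x g)) / q"
      by (simp add: sum_divide_distrib[symmetric] sum.swap[of _ G])
    also have "(\<Sum>b\<in>real_vec ` B. \<Sum>g\<in>G. expo (inv_apply R (real_vec z - b)) (x g)) = 0"
    proof (rule sum.neutral, rule ballI)
      fix b assume "b \<in> real_vec ` B"
      then obtain b' where b': "b' \<in> B" "b = real_vec b'" by blast
      define w where "w = inv_apply R (real_vec (z - b'))"
      have "\<exists>i. w $ i \<notin> \<int>"
      proof (rule ccontr)
        assume "\<not> (\<exists>i. w $ i \<notin> \<int>)"
        then have "w = real_vec (\<chi> i. \<lfloor>w $ i\<rfloor>)"
          by (auto simp: vec_eq_iff elim!: Ints_cases)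
        then show False using neg b' by (auto simp: w_def)
      qed
      then obtain i0 where i0: "w $ i0 \<notin> \<int>" by blast
      have "real N * w $ i \<in> \<int>" for i
      proof -
        have "real N * w $ i = real_of_int (det R) * w $ i \<or> real N * w $ i = - (real_of_int (det R) * w $ i)"
          by (cases "det R \<ge> 0") (auto simp: N_def)
        then show ?thesis using det_inv_apply_int[OF expansive, of "z - b'" i] by (auto simp: w_def)
      qed
      from sum_expo_box[OF this i0] show "(\<Sum>g\<in>G. expo (inv_apply R (real_vec z - b)) (x g)) = 0"
        by (simp add: G_def x_def w_def b')
    qed
    finally show ?thesis by simp
  qed
  ultimately show False by simp
qed

text \<open>The bound on \<open>card B\<close> enters here: otherwise the digits would represent
  every residue modulo \<open>R\<close>, which takes at least \<open>\<bar>det R\<bar>\<close> of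
  them.\<close>

lemma exists_nonzero_frequency:
  assumes card: "int (card B) < \<bar>det R\<bar>"
    and nz: "\<And>\<xi>. \<exists>k\<in>range real_vec. ft (\<xi> + k) \<noteq> 0"
  shows "\<exists>k\<in>range real_vec. k \<noteq> 0 \<and> ft k \<noteq> 0"
proof (rule ccontr)
  assume "\<not> ?thesis"
  then have ft: "ft k = 0" if "k \<in> range real_vec" "k \<noteq> 0" for k using that by blast
  have finB: "finite B" using B(1) by (rule finite_imageD) (auto simp: inj_on_def)
  have "\<exists>b\<in>B. \<exists>k. z = b + R *v k" for z
  proof -
    obtain b k where b: "b \<in> B" "inv_apply R (real_vec (z - b)) = real_vec k"
      using exists_residue[OF ft nz] by blast
    then have "real_vec (z - b) = real_vec (R *v k)"
      using inv_apply_inverse(1)[OF expansive, of "real_vec (z - b)"] by (simp add: real_vec_mult)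
    then have "z = b + R *v k" by (simp only: real_vec_eq_iff) (simp add: algebra_simps)
    then show ?thesis using b by blast
  qed
  moreover have "det R \<noteq> 0" using card by auto
  ultimately have "\<bar>det R\<bar> \<le> int (card B)"
    by (intro abs_det_le_card_residues finB)
  with card show False by simp
qed

text \<open>Compactness of the unit cube: lattice shifts bring a sequence of counterexamples into
  the cube, and at a limit point all translates of \<open>ft\<close> would vanish by Lipschitz
  continuity.\<close>

lemma uniform_frequency:
  assumes nz: "\<And>\<xi>. \<exists>k\<in>range real_vec. ft (\<xi> + k) \<noteq> 0"
  shows "\<exists>\<delta>>0. \<forall>\<xi>. \<exists>k\<in>range real_vec. \<delta> \<le> norm (ft (\<xi> + k))"
proof (rule ccontr)
  assume neg: "\<not> ?thesis"
  have "\<exists>\<xi>\<in>cbox 0 1. \<forall>k\<in>range real_vec. norm (ft (\<xi> + k)) < 1 / real (Suc n)" for n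
  proof -
    have "1 / real (Suc n) > 0" by simp
    with neg obtain \<xi> where \<xi>: "\<And>k. k \<in> range real_vec \<Longrightarrow> norm (ft (\<xi> + k)) < 1 / real (Suc n)"
      by (meson not_le)
    obtain z where z: "\<xi> - real_vec z \<in> cbox 0 1" using exists_floor_vector by blast
    have "norm (ft ((\<xi> - real_vec z) + real_vec k)) < 1 / real (Suc n)" for k
      using \<xi>[OF rangeI, of "k - z"] by (simp add: algebra_simps)
    then show ?thesis using z by blast
  qed
  then obtain x where x: "\<And>n. x n \<in> cbox 0 1" "\<And>n k. norm (ft (x n + real_vec k)) < 1 / real (Suc n)"
    by (metis rangeI)
  obtain \<xi> f where f: "strict_mono f" "(x \<circ> f) \<longlonglongrightarrow> \<xi>"
    using compact_cbox[of 0 "1 :: real ^ 'n"] x(1) unfolding compact_eq_seq_compact_metric seq_compact_def by metis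
  obtain k where k: "ft (\<xi> + real_vec k) \<noteq> 0" using nz by blast
  have "(\<lambda>n. ft ((x \<circ> f) n + real_vec k)) \<longlonglongrightarrow> ft (\<xi> + real_vec k)"
  proof (rule LIM_zero_cancel, rule Lim_null_comparison)
    show "(\<lambda>n. 2 * pi * K * norm ((x \<circ> f) n - \<xi>)) \<longlonglongrightarrow> 0"
      by (intro tendsto_mult_right_zero tendsto_norm_zero LIM_zero f)
    show "\<forall>\<^sub>F n in sequentially. norm (ft ((x \<circ> f) n + real_vec k) - ft (\<xi> + real_vec k)) \<le> 2 * pi * K * norm ((x \<circ> f) n - \<xi>)"
      using ft_lipschitz[of "(x \<circ> f) _ + real_vec k" "\<xi> + real_vec k"] by simp
  qed
  moreover have "(\<lambda>n. ft ((x \<circ> f) n + real_vec k)) \<longlonglongrightarrow> 0"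
  proof (rule Lim_null_comparison)
    show "(\<lambda>n. 1 / real (Suc n)) \<longlonglongrightarrow> 0" by (rule LIMSEQ_Suc) (rule lim_1_over_n)
    have "norm (ft ((x \<circ> f) n + real_vec k)) \<le> 1 / real (Suc n)" for n
    proof -
      have "norm (ft (x (f n) + real_vec k)) \<le> 1 / real (Suc (f n))"
        using x(2) less_imp_le by blast
      also have "\<dots> \<le> 1 / real (Suc n)"
        using seq_suble[OF f(1), of n] by (intro divide_left_mono) auto
      finally show ?thesis by simp
    qed
    then show "\<forall>\<^sub>F n in sequentially. norm (ft ((x \<circ> f) n + real_vec k)) \<le> 1 / real (Suc n)" by simp
  qed
  ultimately have "ft (\<xi> + real_vec k) = 0" by (rule LIMSEQ_unique)
  with k show False by simp
qed

text \<open>Up to the factor \<open>1 / sqrt (card B)\<close>, the values of the mask are the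
  entries of a row vector \<open>v\<close> times the Hadamard matrix. The entries of
  \<open>v\<close> are unimodular, so its squared norm is \<open>card B\<close>, and the orthonormal
  rows preserve it.\<close>

lemma hadamard_mask_sum:
  assumes H: "hadamard_triple R B L"
  shows "(\<Sum>l\<in>L. (norm (mask (\<eta> + dual_inv_apply R (real_vec l))))\<^sup>2) = 1"
proof -
  define h where "h b l = 1 / of_real (sqrt (real (card B))) *
       exp (- 2 * of_real pi * \<i> * of_real (inv_apply R (real_vec b) \<bullet> real_vec l))" for b l
  define v where "v b = expo (- \<eta>) (real_vec b)" for b
  have inj: "inj_on real_vec B" by (auto simp: inj_on_def)
  have fin: "finite B" "finite L" and pos: "card B > 0"
    using H by (auto simp: hadamard_triple_def card_gt_0_iff)
  have orth: "(\<Sum>l\<in>L. h b l * cnj (h b' l)) = (if b = b' then 1 else 0)" if "b \<in> B" "b' \<in> B" for b b'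
    using H that unfolding hadamard_triple_def unitary_on_def h_def by blast
  have mask: "mask (\<eta> + dual_inv_apply R (real_vec l)) = (\<Sum>b\<in>B. v b * h b l) / sqrt (card B)" for l
  proof -
    have "complex_of_real (sqrt (card B)) * complex_of_real (sqrt (card B)) = of_nat (card B)"
      by (simp flip: of_real_mult)
    moreover have "expo (- (\<eta> + dual_inv_apply R (real_vec l))) (real_vec b) = v b * h b l * sqrt (card B)" for b
    proof -
      have "expo (- dual_inv_apply R (real_vec l)) (real_vec b) = exp (- 2 * of_real pi * \<i> * of_real (inv_apply R (real_vec b) \<bullet> real_vec l))"
        unfolding expo_dual by (simp add: expo_def)
      then show ?thesis
        using pos expo_add[of "- \<eta>" "- dual_inv_apply R (real_vec l)" "real_vec b"] by (simp add: v_def h_def)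
    qed
    then have "(\<Sum>b\<in>real_vec ` B. expo (- (\<eta> + dual_inv_apply R (real_vec l))) b) = (\<Sum>b\<in>B. v b * h b l) * sqrt (card B)"
      unfolding sum.reindex[OF inj] o_def sum_distrib_right by (intro sum.cong refl)
    ultimately show ?thesis
      using pos by (simp add: mask_def q_def card_image[OF inj] field_simps)
  qed
  have "complex_of_real (\<Sum>l\<in>L. (norm (mask (\<eta> + dual_inv_apply R (real_vec l))))\<^sup>2)
    = (\<Sum>l\<in>L. (\<Sum>b\<in>B. v b * h b l) * cnj (\<Sum>b\<in>B. v b * h b l)) / card B"
  proof -
    have "complex_of_real ((norm (mask (\<eta> + dual_inv_apply R (real_vec l))))\<^sup>2)
      = (\<Sum>b\<in>B. v b * h b l) * cnj (\<Sum>b\<in>B. v b * h b l) / card B" for l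
    proof -
      have "complex_of_real (sqrt (card B)) * complex_of_real (sqrt (card B)) = of_nat (card B)"
        by (simp flip: of_real_mult)
      then show ?thesis unfolding complex_norm_square mask by simp
    qed
    then show ?thesis unfolding of_real_sum sum_divide_distrib by (intro sum.cong refl)
  qed
  also have "(\<Sum>l\<in>L. (\<Sum>b\<in>B. v b * h b l) * cnj (\<Sum>b\<in>B. v b * h b l))
    = (\<Sum>l\<in>L. \<Sum>b\<in>B. \<Sum>b'\<in>B. v b * cnj (v b') * (h b l * cnj (h b' l)))"
    by (simp add: sum_product mult_ac)
  also have "\<dots> = (\<Sum>b\<in>B. \<Sum>b'\<in>B. v b * cnj (v b') * (\<Sum>l\<in>L. h b l * cnj (h b' l)))"
    by (subst sum.swap, rule sum.cong[OF refl], subst sum.swap) (simp add: sum_distrib_left)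
  also have "\<dots> = (\<Sum>b\<in>B. \<Sum>b'\<in>B. if b = b' then v b * cnj (v b) else 0)"
    by (intro sum.cong refl) (simp add: orth)
  also have "\<dots> = of_nat (card B)"
    using fin by (simp add: v_def flip: complex_norm_square)
  also have "of_nat (card B) / of_nat (card B) = (1 :: complex)"
    using pos by simp
  finally have "complex_of_real (\<Sum>l\<in>L. (norm (mask (\<eta> + dual_inv_apply R (real_vec l))))\<^sup>2) = 1" .
  then show ?thesis using of_real_eq_1_iff by blast
qed

end

section \<open>Instantiation for a Hadamard triple and the lacunary spectrum\<close>

lemma exists_lattice_self_affine:
  fixes R :: "int ^ 'n ^ 'n"
  assumes R: "expansive R" and B: "finite B" "B \<noteq> {}"
  shows "\<exists>C r \<mu> K. lattice_self_affine R B C r \<mu> K"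
proof -
  obtain C r where Cr: "0 < r" "r < 1" "\<And>n v. norm ((inv_apply R ^^ n) v) \<le> C * r ^ n * norm v"
    using expansive_power_bound[OF R] by auto
  interpret affine_ifs "inv_apply R" "real_vec ` B" C r
    by (rule affine_ifs.intro) (use Cr B linear_inv_apply in auto)
  obtain \<mu> K where \<mu>: "is_self_affine (inv_apply R) (real_vec ` B) \<mu>" "AE x in \<mu>. norm x \<le> K"
    by (rule self_affine_exists)
  have "lattice_self_affine R B C r \<mu> K"
  proof (intro lattice_self_affine.intro self_affine.intro self_affine_axioms.intro lattice_self_affine_axioms.intro affine_ifs_axioms R)
    show "linear (dual_inv_apply R)" "linear (dual_apply R)"
      unfolding dual_inv_apply_def[abs_def] dual_apply_def[abs_def] by (simp_all add: matrix_vector_mul_linear)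
    show "z + w \<in> range real_vec" if "z \<in> range real_vec" "w \<in> range real_vec" for z w :: "real ^ 'n"
      using that by (auto simp flip: real_vec_simps(1))
    show "dual_apply R z \<in> range real_vec" if "z \<in> range real_vec" for z
      using that by (auto simp: dual_apply_real_vec)
    show "b \<bullet> z \<in> \<int>" if "b \<in> real_vec ` B" "z \<in> range real_vec" for b z
      using that inner_real_vec by auto
  qed (use \<mu> inv_apply_adjoint dual_apply_inverse[OF R] in auto)
  then show ?thesis by blast
qed

theorem theorem1p6:
  fixes R :: "int ^ 'n ^ 'n" and B L :: "(int ^ 'n) set"
  assumes "expansive R"
    and "hadamard_triple R B L"
    and "int (card B) < \<bar>det R\<bar>"
    and "periodic_zero_set (self_affine_measure R B) = {}"
  shows "\<forall>b :: real. b > 1 \<longrightarrow> ( \<exists>\<Lambda>. lacunary b \<Lambda> \<and> is_spectrum (self_affine_measure R B) \<Lambda>)"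
proof (intro allI impI)
  fix b :: real assume "b > 1"
  have B: "finite B" "B \<noteq> {}" and L: "finite L" "L \<noteq> {}" "card B = card L"
    using assms(2) by (auto simp: hadamard_triple_def)
  obtain C r \<mu> K where "lattice_self_affine R B C r \<mu> K"
    using exists_lattice_self_affine[OF assms(1) B] by blast
  then interpret lattice_self_affine R B C r \<mu> K .
  have nz: "\<exists>k\<in>range real_vec. ft (\<xi> + k) \<noteq> 0" for \<xi>
    using assms(4) by (auto simp: self_affine_measure_eq periodic_zero_set_def fourier_transform_eq)
  obtain \<delta>0 where \<delta>0: "\<delta>0 > 0" "\<And>\<xi>. \<exists>k\<in>range real_vec. \<delta>0 \<le> norm (ft (\<xi> + k))"
    using uniform_frequency[OF nz] by blast
  obtain k where k: "k \<in> range real_vec" "k \<noteq> 0" "ft k \<noteq> 0"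
    using exists_nonzero_frequency[OF assms(3) nz] by blast
  \<comment> \<open>The lower bound that \<open>large_translates\<close> guarantees when it shifts
    by images of \<open>k\<close>.\<close>
  define \<delta> where "\<delta> = \<delta>0 * norm (ft k) / 2"
  have qL: "q = card L"
    unfolding q_def using L by (simp add: card_image inj_on_def)
  obtain h where h: "bij_betw h {..<q} L"
    using ex_bij_betw_nat_finite[OF L(1)] by (auto simp: qL lessThan_atLeast0)
  \<comment> \<open>\<open>L\<close> is translated by \<open>h 0\<close> so that the digit zero gets
    the zero vector. The mask identity holds at every point, so this translation is absorbed into
    \<open>\<xi>\<close>.\<close>
  interpret hadamard_self_affine "inv_apply R" "real_vec ` B" C r "dual_inv_apply R" "dual_apply R" "range real_vec" \<mu> K
    "\<lambda>a. real_vec (h a - h 0)" \<delta>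
  proof
    show "(\<Sum>a<q. (norm (mask (\<xi> + dual_inv_apply R (real_vec (h a - h 0)))))\<^sup>2) = 1" for \<xi>
    proof -
      have "\<xi> + dual_inv_apply R (real_vec (h a - h 0))
        = (\<xi> - dual_inv_apply R (real_vec (h 0))) + dual_inv_apply R (real_vec (h a))" for a
        by (simp add: linear_diff[OF linS])
      then have "(\<Sum>a<q. (norm (mask (\<xi> + dual_inv_apply R (real_vec (h a - h 0)))))\<^sup>2)
        = (\<Sum>a<q. (norm (mask ((\<xi> - dual_inv_apply R (real_vec (h 0))) + dual_inv_apply R (real_vec (h a)))))\<^sup>2)"
        by (simp only:)
      also have "\<dots> = (\<Sum>l\<in>L. (norm (mask ((\<xi> - dual_inv_apply R (real_vec (h 0))) + dual_inv_apply R (real_vec l))))\<^sup>2)"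
        by (rule sum.reindex_bij_betw[OF h, of "\<lambda>l. (norm (mask ((\<xi> - dual_inv_apply R (real_vec (h 0))) + dual_inv_apply R (real_vec l))))\<^sup>2"])
      also have "\<dots> = 1" by (rule hadamard_mask_sum[OF assms(2)])
      finally show ?thesis .
    qed
    show "0 < \<delta>" using \<delta>0 k by (simp add: \<delta>_def)
    have "\<delta>0 \<le> 1" using \<delta>0(2) norm_ft_le order_trans by blast
    then have "\<delta>0 * norm (ft k) \<le> 1" using \<delta>0(1) norm_ft_le by (intro mult_le_one) auto
    then show "\<delta> \<le> 1" by (simp add: \<delta>_def)
    show "\<exists>k\<in>range real_vec. \<delta> \<le> norm (ft (\<xi> + k)) \<and> M \<le> norm (\<xi> + k)" for \<xi> M
      unfolding \<delta>_def by (rule large_translates[OF \<delta>0(2,1) k])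
    show "real_vec (h a - h 0) \<in> range real_vec" for a by (rule rangeI)
  qed simp
  obtain s where s: "digit_sequence b s" using digit_sequence_exists by blast
  have "is_spectrum \<mu> (frequencies s)"
    unfolding is_spectrum_def
  proof
    show "countable (frequencies s)" by (simp add: frequencies_def)
    show "L2_orthonormal_basis \<mu> (frequencies s) (\<lambda>\<xi> x. exp (2 * of_real pi * \<i> * of_real (\<xi> \<bullet> x)))"
      using frequencies_basis[OF s] by (simp add: expo_def[abs_def])
  qed
  moreover have "lacunary b (frequencies s)"
  proof -
    \<comment> \<open>For \<open>q = 1\<close> the spectrum is the single frequency 0; for
      \<open>q \<ge> 2\<close> the ranges below \<open>q ^ n\<close> exhaust the natural
      numbers.\<close>
    define N where "N = (if 2 \<le> q then \<infinity> else 1 :: enat)"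
    have idx: "{n. enat n < N} = (\<Union>n. {..<q ^ n})"
    proof (cases "2 \<le> q")
      case True
      have "n < q ^ n" for n
        using True less_exp[of n] power_mono[of 2 q n] by linarith
      then show ?thesis using True by (auto simp: N_def)
    next
      case False
      then have "q = 1" using q_pos by simp
      then show ?thesis by (auto simp: N_def one_enat_def)
    qed
    have "bij_betw s {n. enat n < N} (frequencies s)"
      unfolding idx frequencies_def using inj_s[OF s] by (rule inj_on_imp_bij_betw)
    moreover have "b \<le> norm (s n) \<and> b * norm (s (n - 1)) \<le> norm (s n)" if "1 \<le> n" "enat n < N" for n
    proof -
      have "2 \<le> q" using that by (auto simp: N_def one_enat_def split: if_splits)
      then show ?thesis using s that(1) unfolding digit_sequence_def by blast
    qed
    moreover have "0 < N" by (simp add: N_def)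
    ultimately show ?thesis
      unfolding lacunary_def using s_0[OF s] by (intro exI[of _ N] exI[of _ s]) fastforce
  qed
  ultimately show "\<exists>\<Lambda>. lacunary b \<Lambda> \<and> is_spectrum (self_affine_measure R B) \<Lambda>"
    unfolding self_affine_measure_eq by blast
qed

end
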